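(* Let $\{\varphi_l:1\le l\le L\}\subset L^2(\mathbb{R}^d)$ be such that $\{\varphi_l(\cdot-k):1\le l\le L,\ k\in\mathbb{Z}^d\}$ is a frame for its closed linear span $V_0$, with frame bounds $C_1$ and $C_2$. Let $H_r(\xi)$ ($0\le r\le a-1$) be the filter matrices, $H(\xi)$ the associated block matrix, and $\lambda,\Lambda$ the associated extreme eigenvalue bounds, all as in the context. Assume that all entries of $H_r(\xi+2\pi B^{-1}\beta_s)$, $0\le r,s\le a-1$, are bounded measurable functions such that $0<\lambda\le\Lambda<\infty$. Let $\{f^n_l:n\ge0,\ 1\le l\le L\}$ be the wavelet frame packets and let $V_j=\{f: f(A^{-j}\cdot)\in V_0\}$. Then for all $j\ge 0$ the system of functions $$\{f^n_l(\cdot-k):0\le n\le a^j-1,\ 1\le l\le L,\ k\in\mathbb{Z}^d\}$$ is a frame of $V_j$ with frame bounds $\lambda^jC_1$ and $\Lambda^jC_2$.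
   Context: A countable family $\{x_k\}$ in a separable Hilbert space $\mathcal{H}$ is a frame for $\mathcal{H}$ if there exist constants $0<C_1\le C_2<\infty$ such that $C_1\|x\|^2\le\sum_k|\langle x,x_k\rangle|^2\le C_2\|x\|^2$ for all $x\in\mathcal{H}$. The largest $C_1$ and the smallest $C_2$ for which this holds are called the frame bounds. A dilation matrix for $\mathbb{R}^d$ is a $d\times d$ matrix $A$ with $A(\mathbb{Z}^d)\subset\mathbb{Z}^d$ all of whose eigenvalues have modulus $>1$; fix one and put $B=A^t$, $a=|\det A|=|\det B|$. A set of digits for $B$ is a subset of $\mathbb{Z}^d$ containing exactly one element of each of the $a$ cosets of $B\mathbb{Z}^d$ in $\mathbb{Z}^d$; fix one, $K_B=\{\beta_0,\dots,\beta_{a-1}\}$. The Fourier transform is $\hat f(\xi)=\int_{\mathbb{R}^d}f(x)e^{-i\langle\xi,x\rangle}dx$. Filters: sequences $\{h^r_{ljk}\}_{k}\in l^2(\mathbb{Z}^d)$, $0\le r\le a-1$, $1\le l,j\le L$, are given, with $h^r_{lj}(\xi)=\sum_{k\in\mathbb{Z}^d}a^{-1/2}h^r_{ljk}e^{-i\langle\xi,k\rangle}$, $H_r(\xi)=(h^r_{lj}(\xi))_{1\le l,j\le L}$, and the $aL\times aL$ block matrix $H(\xi)=\bigl(H_r(\xi+2\pi B^{-1}\beta_s)\bigr)_{0\le r,s\le a-1}$ ($(r,s)$-th block as indicated). Let $\lambda(\xi)$ and $\Lambda(\xi)$ be the minimal and maximal eigenvalues of the matrix $H^*(\xi)H(\xi)$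 ($*$ = conjugate transpose), and let $\lambda=\inf_\xi\lambda(\xi)$ and $\Lambda=\sup_\xi\Lambda(\xi)$. Wavelet frame packets: the functions $f^n_l$, $n\ge0$, $1\le l\le L$, given by $$f^r_l(x)=\sum_{j=1}^L\sum_{k\in\mathbb{Z}^d}h^r_{ljk}a^{1/2}\varphi_j(Ax-k),\qquad 0\le r\le a-1,$$ and recursively, for $0\le s\le a-1$, $r\ge0$, $1\le l\le L$, $$f^{s+ar}_l(x)=\sum_{j=1}^L\sum_{k\in\mathbb{Z}^d}h^s_{ljk}a^{1/2}f^r_j(Ax-k),\quad\text{i.e.}\quad (f^{s+ar}_l)^\wedge(\xi)=\sum_{j=1}^Lh^s_{lj}(B^{-1}\xi)(f^r_j)^\wedge(B^{-1}\xi).$$ Thus, if $n\ge1$ has base-$a$ expansion $n=\mu_1+\mu_2a+\cdots+\mu_ja^{j-1}$ with $0\le\mu_i\le a-1$, $\mu_j\ne0$, then $(f^n_l)^\wedge(\xi)$ is the $l$-th component of $H_{\mu_1}(B^{-1}\xi)H_{\mu_2}(B^{-2}\xi)\cdots H_{\mu_j}(B^{-j}\xi)\hat\Phi(B^{-j}\xi)$, where $\hat\Phi=(\hat\varphi_1,\dots,\hat\varphi_L)^t$.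
   Formalization: Frame bounds here means admissible constants in the frame inequality, not the largest C_1 and smallest C_2; with optimal constants the claim fails: for d=1, A=2, a band-limited φ with C_1=1, C_2=4, λ=1, Λ=4 has optimal upper bound 4 on V_1, not ΛC_2=16. *)

theory Defs
  imports "HOL-Analysis.Analysis" "Jordan_Normal_Form.Spectral_Radius"
    "Jordan_Normal_Form.Schur_Decomposition"
begin

no_notation Matrix.vec_index (infixl "$" 100)

section \<open>Square-integrable functions and frames\<close>

text \<open>Elements of \<open>L\<^sup>2\<close> are represented by functions; every notion of this section is
  invariant under modification on a null set.\<close>

definition L2 :: "'a measure \<Rightarrow> ('a \<Rightarrow> complex) set" where
  "L2 M = {f. f \<in> borel_measurable M \<and> integrable M (\<lambda>x. (cmod (f x))\<^sup>2)}"

definition L2_inner :: "'a measure \<Rightarrow> ('a \<Rightarrow> complex) \<Rightarrow> ('a \<Rightarrow> complex) \<Rightarrow> complex" where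
  "L2_inner M f g = (\<integral>x. f x * cnj (g x) \<partial>M)"

definition L2_norm :: "'a measure \<Rightarrow> ('a \<Rightarrow> complex) \<Rightarrow> real" where
  "L2_norm M f = sqrt (\<integral>x. (cmod (f x))\<^sup>2 \<partial>M)"

text \<open>Unconditional convergence of \<open>\<Sum>i\<in>I. g i\<close> to \<open>f\<close> in the norm of \<open>L\<^sup>2\<close>.\<close>

definition L2_has_sum ::
    "'a measure \<Rightarrow> ('i \<Rightarrow> 'a \<Rightarrow> complex) \<Rightarrow> 'i set \<Rightarrow> ('a \<Rightarrow> complex) \<Rightarrow> bool" where
  "L2_has_sum M g I f \<longleftrightarrow>
     f \<in> L2 M \<and> (\<forall>i\<in>I. g i \<in> L2 M) \<and>
     ((\<lambda>F. L2_norm M (\<lambda>x. f x - (\<Sum>i\<in>F. g i x))) \<longlongrightarrow> 0) (finite_subsets_at_top I)"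

definition closed_span :: "'a measure \<Rightarrow> 'i set \<Rightarrow> ('i \<Rightarrow> 'a \<Rightarrow> complex) \<Rightarrow> ('a \<Rightarrow> complex) set" where
  "closed_span M I g =
     {f \<in> L2 M. \<forall>\<epsilon>>0. \<exists>F c. finite F \<and> F \<subseteq> I \<and>
        L2_norm M (\<lambda>x. f x - (\<Sum>i\<in>F. c i * g i x)) < \<epsilon>}"

text \<open>\<open>C1\<close> and \<open>C2\<close> are admissible constants in the frame inequality, not necessarily the optimal
  ones.  In particular the optimal constants of a frame satisfy this predicate.\<close>

definition is_frame ::
    "'a measure \<Rightarrow> ('a \<Rightarrow> complex) set \<Rightarrow> 'i set \<Rightarrow> ('i \<Rightarrow> 'a \<Rightarrow> complex) \<Rightarrow> real \<Rightarrow> real \<Rightarrow> bool" where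
  "is_frame M V I g C1 C2 \<longleftrightarrow>
     countable I \<and> (\<forall>i\<in>I. g i \<in> V) \<and> 0 < C1 \<and> C1 \<le> C2 \<and>
     (\<forall>f\<in>V. (\<lambda>i. (cmod (L2_inner M f (g i)))\<^sup>2) summable_on I \<and>
        C1 * (L2_norm M f)\<^sup>2 \<le> (\<Sum>\<^sub>\<infinity>i\<in>I. (cmod (L2_inner M f (g i)))\<^sup>2) \<and>
        (\<Sum>\<^sub>\<infinity>i\<in>I. (cmod (L2_inner M f (g i)))\<^sup>2) \<le> C2 * (L2_norm M f)\<^sup>2)"

section \<open>Dilation matrices and digits\<close>

definition Zd :: "(real^'d) set" where
  "Zd = {x. \<forall>i. x $ i \<in> \<int>}"

definition dilation_matrix :: "real^'d^'d \<Rightarrow> bool" where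
  "dilation_matrix A \<longleftrightarrow>
     (\<forall>k\<in>Zd. A *v k \<in> Zd) \<and>
     (\<forall>(z::complex) v. v \<noteq> 0 \<and> (\<chi> i j. complex_of_real (A $ i $ j)) *v v = z *s v \<longrightarrow> cmod z > 1)"

text \<open>\<open>\<bar>det A\<bar>\<close> is an integer when \<open>A\<close> maps \<open>Zd\<close> to itself, so the floor does not round.\<close>

definition dil_index :: "real^'d^'d \<Rightarrow> nat" where
  "dil_index A = nat \<lfloor>\<bar>Determinants.det A\<bar>\<rfloor>"

definition digit_set :: "real^'d^'d \<Rightarrow> (real^'d) set \<Rightarrow> bool" where
  "digit_set B K \<longleftrightarrow> K \<subseteq> Zd \<and> (\<forall>k\<in>Zd. \<exists>!b. b \<in> K \<and> k - b \<in> (\<lambda>y. B *v y) ` Zd)"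

section \<open>Filters\<close>

text \<open>\<open>u\<close> is a (pointwise defined, exactly \<open>2\<pi>Zd\<close>-periodic) representative of the \<open>L\<^sup>2\<close> function
  with Fourier series \<open>\<Sum>k. c k * exp (-\<i> \<langle>\<xi>, k\<rangle>)\<close>.\<close>

definition fourier_series_rep :: "(real^'d \<Rightarrow> complex) \<Rightarrow> (real^'d \<Rightarrow> complex) \<Rightarrow> bool" where
  "fourier_series_rep c u \<longleftrightarrow>
     u \<in> borel_measurable lebesgue \<and>
     (\<forall>\<xi>. \<forall>k\<in>Zd. u (\<xi> + (2 * pi) *\<^sub>R k) = u \<xi>) \<and>
     L2_has_sum (lebesgue_on (cbox 0 (\<chi> i. 2 * pi)))
       (\<lambda>k \<xi>. c k * exp (- \<i> * complex_of_real (\<xi> \<bullet> k))) Zd u"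

text \<open>The argument \<open>u r l j\<close> is the function \<open>h\<^sup>r\<^sub>l\<^sub>j\<close>, with \<open>1 \<le> l, j \<le> L\<close>.  Entry \<open>(p, q)\<close> of the
  block matrix lies in the block with row \<open>p div L\<close> and column \<open>q div L\<close>.\<close>

definition filter_block_matrix ::
    "real^'d^'d \<Rightarrow> nat \<Rightarrow> (nat \<Rightarrow> real^'d) \<Rightarrow> (nat \<Rightarrow> nat \<Rightarrow> nat \<Rightarrow> real^'d \<Rightarrow> complex) \<Rightarrow>
     real^'d \<Rightarrow> complex mat" where
  "filter_block_matrix A L \<beta> u \<xi> =
     Matrix.mat (dil_index A * L) (dil_index A * L)
       (\<lambda>(p, q). u (p div L) (p mod L + 1) (q mod L + 1)
          (\<xi> + (2 * pi) *\<^sub>R (matrix_inv (Finite_Cartesian_Product.transpose A) *v \<beta> (q div L))))"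

text \<open>\<open>H\<^sup>* H\<close> is Hermitian, so its eigenvalues are real and \<open>Re\<close> is just a type conversion.\<close>

definition min_eigenvalue :: "complex mat \<Rightarrow> real" where
  "min_eigenvalue H = Min (Re ` spectrum (mat_adjoint H * H))"

definition max_eigenvalue :: "complex mat \<Rightarrow> real" where
  "max_eigenvalue H = Max (Re ` spectrum (mat_adjoint H * H))"

section \<open>Wavelet frame packets\<close>

text \<open>\<open>g\<close> is obtained from \<open>\<psi>\<^sub>1, \<dots>, \<psi>\<^sub>L\<close> by
  \<open>g x = \<Sum>j. \<Sum>k. c j k * a\<^sup>1\<^sup>/\<^sup>2 * \<psi> j (A x - k)\<close>, the series converging in \<open>L\<^sup>2\<close>.\<close>

definition filtered ::
    "real^'d^'d \<Rightarrow> nat \<Rightarrow> (nat \<Rightarrow> real^'d \<Rightarrow> complex) \<Rightarrow> (nat \<Rightarrow> real^'d \<Rightarrow> complex) \<Rightarrow>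
     (real^'d \<Rightarrow> complex) \<Rightarrow> bool" where
  "filtered A L c \<psi> g \<longleftrightarrow>
     L2_has_sum lebesgue
       (\<lambda>(j, k) x. c j k * complex_of_real (sqrt (real (dil_index A))) * \<psi> j (A *v x - k))
       ({1..L} \<times> Zd) g"

text \<open>For \<open>s < a\<close> both clauses apply to \<open>f s\<close> (the second one with \<open>r = 0\<close>).  This expresses the
  convention \<open>f\<^sup>0 = \<phi>\<close>: for filters whose block matrix is uniformly bounded from below the two clauses
  agree only if \<open>f 0 j = \<phi> j\<close> almost everywhere.\<close>

definition wavelet_frame_packets ::
    "real^'d^'d \<Rightarrow> nat \<Rightarrow> (nat \<Rightarrow> nat \<Rightarrow> nat \<Rightarrow> real^'d \<Rightarrow> complex) \<Rightarrow>
     (nat \<Rightarrow> real^'d \<Rightarrow> complex) \<Rightarrow> (nat \<Rightarrow> nat \<Rightarrow> real^'d \<Rightarrow> complex) \<Rightarrow> bool" where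
  "wavelet_frame_packets A L h \<phi> f \<longleftrightarrow>
     (\<forall>r<dil_index A. \<forall>l\<in>{1..L}. filtered A L (h r l) \<phi> (f r l)) \<and>
     (\<forall>s<dil_index A. \<forall>r. \<forall>l\<in>{1..L}. filtered A L (h s l) (f r) (f (s + dil_index A * r) l))"

text \<open>The space \<open>V\<^sub>j = {f. f (A\<^sup>-\<^sup>j \<cdot>) \<in> V}\<close>.\<close>

definition dilated_space ::
    "real^'d^'d \<Rightarrow> nat \<Rightarrow> (real^'d \<Rightarrow> complex) set \<Rightarrow> (real^'d \<Rightarrow> complex) set" where
  "dilated_space A j V = {f. (\<lambda>x. f (((\<lambda>y. matrix_inv A *v y) ^^ j) x)) \<in> V}"

end

theory Submission
  imports Defs
begin

text \<open>No Fourier transform on the whole space is needed.  The two-scale relations express the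
  coefficients \<open>\<langle>w, f\<^sup>s\<^sup>+\<^sup>a\<^sup>r\<^sub>l(\<cdot> - k)\<rangle>\<close> as the image of the sequence
  \<open>\<langle>w, a\<^sup>1\<^sup>/\<^sup>2 f\<^sup>r\<^sub>j(A \<cdot> - m)\<rangle>\<close> under an operator on square-summable sequences that depends on the
  filters only.  On finitely supported sequences, Parseval's identity on the torus turns this
  operator into pointwise multiplication by the block matrix \<open>H(\<xi>)\<close>, once the Fourier series have been
  averaged over the digit shifts; so Rayleigh quotients of \<open>H\<^sup>* H\<close> bound it by \<open>\<lambda>\<close> and \<open>\<Lambda>\<close>, and the
  bounds extend to all square-summable sequences.  Since dilation by \<open>A\<close> is unitary up to the factor
  \<open>a\<^sup>1\<^sup>/\<^sup>2\<close>, each step from \<open>V\<^sub>j\<close> to \<open>V\<^sub>j\<^sub>+\<^sub>1\<close> multiplies the frame bounds by \<open>\<lambda>\<close> and \<open>\<Lambda>\<close>.  The induction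
  starts at \<open>f\<^sup>0 = \<phi>\<close>, which follows from the injectivity of the same operator.\<close>

section \<open>The space of square-integrable functions\<close>

text \<open>The family may be redundant, so the coefficient sequences of elements of a space are
  only part of all square-summable sequences. Nothing about that part has to be known: the
  eigenvalue bounds hold for every input of the filter bank, and the frame inequality of the
  preceding level measures the input.

  The two-scale series converge unconditionally in norm only, so the operator can be computed
  directly just on finitely supported inputs. The upper bound survives the limit by semicontinuity;
  the lower bound does not, and needs the upper one to control the tail.

  The identification of \<open>f 0\<close> with \<open>\<phi>\<close> cannot presuppose that
  \<open>f 0\<close> lies in \<open>V0\<close>. It is tested against arbitrary square-integrable
  functions, which is why the Bessel inequality is extended from \<open>V0\<close> to the whole
  space.

  That \<open>lam\<close> and \<open>Lam\<close> carry over without loss rests on the cancellation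
  of two factors \<open>a\<close> in the digit averaging: one counts the shifted copies of the
  input, the other is the weight of the surviving frequencies in \<open>A Zd\<close>.\<close>

lemma L2_measurable: "f \<in> L2 M \<Longrightarrow> f \<in> borel_measurable M"
  and L2_integrable: "f \<in> L2 M \<Longrightarrow> integrable M (\<lambda>x. (cmod (f x))\<^sup>2)"
  by (auto simp: L2_def)

lemma L2I: "f \<in> borel_measurable M \<Longrightarrow> integrable M (\<lambda>x. (cmod (f x))\<^sup>2) \<Longrightarrow> f \<in> L2 M"
  by (auto simp: L2_def)

lemma L2_integrable_norm_mult:
  assumes "f \<in> L2 M" "g \<in> L2 M"
  shows "integrable M (\<lambda>x. cmod (f x) * cmod (g x))"
proof (rule Bochner_Integration.integrable_bound)
  show "integrable M (\<lambda>x. (cmod (f x))\<^sup>2 + (cmod (g x))\<^sup>2)"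
    using assms by (auto simp: L2_def)
  show "(\<lambda>x. cmod (f x) * cmod (g x)) \<in> borel_measurable M"
    using assms[THEN L2_measurable] by measurable
  have "a * b \<le> a\<^sup>2 + b\<^sup>2" if "a \<ge> 0" "b \<ge> 0" for a b :: real
    using sum_squares_bound[of a b] mult_nonneg_nonneg[OF that] by linarith
  then show "AE x in M. norm (cmod (f x) * cmod (g x)) \<le> norm ((cmod (f x))\<^sup>2 + (cmod (g x))\<^sup>2)"
    by (auto intro!: AE_I2)
qed

lemma borel_measurable_cnj [measurable (raw)]:
  "f \<in> borel_measurable M \<Longrightarrow> (\<lambda>x. cnj (f x)) \<in> borel_measurable M"
  by (rule borel_measurable_continuous_on[OF continuous_on_cnj]) auto

lemma L2_integrable_mult_cnj:
  assumes "f \<in> L2 M" "g \<in> L2 M"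
  shows "integrable M (\<lambda>x. f x * cnj (g x))"
  by (rule Bochner_Integration.integrable_bound[OF L2_integrable_norm_mult[OF assms]])
    (use assms[THEN L2_measurable] in \<open>auto simp: norm_mult\<close>)

lemma L2_zero [simp]: "(\<lambda>x. 0) \<in> L2 M"
  by (auto simp: L2_def)

lemma L2_cmult [intro]: "f \<in> L2 M \<Longrightarrow> (\<lambda>x. c * f x) \<in> L2 M"
  by (auto simp: L2_def norm_mult power_mult_distrib)

lemma L2_add [intro]:
  assumes "f \<in> L2 M" "g \<in> L2 M"
  shows "(\<lambda>x. f x + g x) \<in> L2 M"
proof (rule L2I)
  note [measurable] = assms[THEN L2_measurable]
  show "(\<lambda>x. f x + g x) \<in> borel_measurable M"
    by measurable
  show "integrable M (\<lambda>x. (cmod (f x + g x))\<^sup>2)"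
  proof (rule Bochner_Integration.integrable_bound)
    show "integrable M (\<lambda>x. (cmod (f x))\<^sup>2 + (cmod (g x))\<^sup>2 + 2 * (cmod (f x) * cmod (g x)))"
      using assms[THEN L2_integrable] L2_integrable_norm_mult[OF assms] by auto
    show "(\<lambda>x. (cmod (f x + g x))\<^sup>2) \<in> borel_measurable M" by measurable
    have "(cmod (f x + g x))\<^sup>2 \<le> (cmod (f x))\<^sup>2 + (cmod (g x))\<^sup>2 + 2 * (cmod (f x) * cmod (g x))" for x
      using power_mono[OF norm_triangle_ineq[of "f x" "g x"], of 2] by (simp add: power2_sum)
    then show "AE x in M. norm ((cmod (f x + g x))\<^sup>2)
        \<le> norm ((cmod (f x))\<^sup>2 + (cmod (g x))\<^sup>2 + 2 * (cmod (f x) * cmod (g x)))"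
      by (auto intro!: AE_I2)
  qed
qed

lemma L2_diff [intro]: "f \<in> L2 M \<Longrightarrow> g \<in> L2 M \<Longrightarrow> (\<lambda>x. f x - g x) \<in> L2 M"
  using L2_add[of f M "\<lambda>x. (-1) * g x"] L2_cmult[of g M "-1"] by simp

lemma L2_sum [intro]: "(\<And>i. i \<in> F \<Longrightarrow> g i \<in> L2 M) \<Longrightarrow> (\<lambda>x. \<Sum>i\<in>F. g i x) \<in> L2 M"
  by (induction F rule: infinite_finite_induct) auto

lemma L2_norm_nonneg [simp]: "0 \<le> L2_norm M f"
  by (simp add: L2_norm_def)

lemma L2_norm_power2: "(L2_norm M f)\<^sup>2 = (\<integral>x. (cmod (f x))\<^sup>2 \<partial>M)"
  by (simp add: L2_norm_def)

lemma L2_norm_cmult: "L2_norm M (\<lambda>x. c * f x) = cmod c * L2_norm M f"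
  by (simp add: L2_norm_def norm_mult power_mult_distrib real_sqrt_mult)

lemma L2_inner_self: "L2_inner M f f = complex_of_real ((L2_norm M f)\<^sup>2)"
proof -
  have "L2_inner M f f = (\<integral>x. complex_of_real ((cmod (f x))\<^sup>2) \<partial>M)"
    unfolding L2_inner_def by (intro Bochner_Integration.integral_cong) (simp_all only: complex_norm_square)
  then show ?thesis by (simp only: L2_norm_power2 integral_complex_of_real)
qed

lemma L2_inner_commute: "L2_inner M f g = cnj (L2_inner M g f)"
  by (simp add: L2_inner_def mult.commute flip: Bochner_Integration.integral_cnj)

lemma L2_inner_add_left:
  "f \<in> L2 M \<Longrightarrow> g \<in> L2 M \<Longrightarrow> w \<in> L2 M \<Longrightarrow>
    L2_inner M (\<lambda>x. f x + g x) w = L2_inner M f w + L2_inner M g w"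
  by (simp add: L2_inner_def distrib_right L2_integrable_mult_cnj)

lemma L2_inner_add_right:
  "f \<in> L2 M \<Longrightarrow> g \<in> L2 M \<Longrightarrow> w \<in> L2 M \<Longrightarrow>
    L2_inner M w (\<lambda>x. f x + g x) = L2_inner M w f + L2_inner M w g"
  by (simp add: L2_inner_def distrib_left L2_integrable_mult_cnj)

lemma L2_inner_cmult_left: "L2_inner M (\<lambda>x. c * f x) w = c * L2_inner M f w"
  by (simp add: L2_inner_def mult.assoc)

lemma L2_inner_cmult_right: "L2_inner M w (\<lambda>x. c * f x) = cnj c * L2_inner M w f"
  by (simp add: L2_inner_def mult.left_commute)

lemma L2_inner_diff_left:
  "f \<in> L2 M \<Longrightarrow> g \<in> L2 M \<Longrightarrow> w \<in> L2 M \<Longrightarrow>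
    L2_inner M (\<lambda>x. f x - g x) w = L2_inner M f w - L2_inner M g w"
  by (simp add: L2_inner_def left_diff_distrib L2_integrable_mult_cnj)

lemma L2_inner_diff_right:
  "f \<in> L2 M \<Longrightarrow> g \<in> L2 M \<Longrightarrow> w \<in> L2 M \<Longrightarrow>
    L2_inner M w (\<lambda>x. f x - g x) = L2_inner M w f - L2_inner M w g"
  by (simp add: L2_inner_def right_diff_distrib L2_integrable_mult_cnj)

lemma L2_inner_sum_left:
  "(\<And>i. i \<in> F \<Longrightarrow> g i \<in> L2 M) \<Longrightarrow> w \<in> L2 M \<Longrightarrow>
    L2_inner M (\<lambda>x. \<Sum>i\<in>F. g i x) w = (\<Sum>i\<in>F. L2_inner M (g i) w)"
proof (induction F rule: infinite_finite_induct)
  case (insert i F)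
  then show ?case
    by (simp add: L2_inner_add_left L2_sum)
qed (simp_all add: L2_inner_def)

lemma L2_inner_sum_right:
  "(\<And>i. i \<in> F \<Longrightarrow> g i \<in> L2 M) \<Longrightarrow> w \<in> L2 M \<Longrightarrow>
    L2_inner M w (\<lambda>x. \<Sum>i\<in>F. g i x) = (\<Sum>i\<in>F. L2_inner M w (g i))"
proof (induction F rule: infinite_finite_induct)
  case (insert i F)
  then show ?case
    by (simp add: L2_inner_add_right L2_sum)
qed (simp_all add: L2_inner_def)

lemma L2_norm_Cauchy_Schwarz:
  assumes "f \<in> L2 M" "g \<in> L2 M"
  shows "cmod (L2_inner M f g) \<le> L2_norm M f * L2_norm M g"
proof -
  note [measurable] = assms[THEN L2_measurable]
  let ?P = "\<integral>x. cmod (f x) * cmod (g x) \<partial>M"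
  have e: "ennreal (\<integral>x. (cmod (h x))\<^sup>2 \<partial>M) = (\<integral>\<^sup>+x. (ennreal (cmod (h x)))\<^sup>2 \<partial>M)" if "h \<in> L2 M" for h
    by (subst nn_integral_eq_integral[symmetric])
      (use that in \<open>auto simp: L2_def ennreal_power\<close>)
  have "ennreal ?P = (\<integral>\<^sup>+x. ennreal (cmod (f x)) * ennreal (cmod (g x)) \<partial>M)"
    by (subst nn_integral_eq_integral[symmetric])
      (use L2_integrable_norm_mult[OF assms] in \<open>auto simp: ennreal_mult\<close>)
  then have "(ennreal ?P)\<^sup>2 \<le> (\<integral>\<^sup>+x. (ennreal (cmod (f x)))\<^sup>2 \<partial>M) * (\<integral>\<^sup>+x. (ennreal (cmod (g x)))\<^sup>2 \<partial>M)"
    by (simp add: Cauchy_Schwarz_nn_integral)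
  also have "\<dots> = ennreal ((L2_norm M f)\<^sup>2 * (L2_norm M g)\<^sup>2)"
    by (simp add: e[OF assms(1), symmetric] e[OF assms(2), symmetric] ennreal_mult L2_norm_power2)
  finally have "?P\<^sup>2 \<le> (L2_norm M f * L2_norm M g)\<^sup>2"
    by (simp add: ennreal_power power_mult_distrib)
  then have "?P \<le> L2_norm M f * L2_norm M g"
    by (rule power2_le_imp_le) simp
  moreover have "cmod (L2_inner M f g) \<le> ?P"
    unfolding L2_inner_def by (rule order_trans[OF integral_norm_bound]) (simp add: norm_mult)
  ultimately show ?thesis by simp
qed

lemma L2_norm_triangle:
  assumes "f \<in> L2 M" "g \<in> L2 M"
  shows "L2_norm M (\<lambda>x. f x + g x) \<le> L2_norm M f + L2_norm M g"
proof (rule power2_le_imp_le)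
  note s = L2_inner_add_left L2_inner_add_right L2_add assms
  have "complex_of_real ((L2_norm M (\<lambda>x. f x + g x))\<^sup>2)
      = complex_of_real ((L2_norm M f)\<^sup>2 + (L2_norm M g)\<^sup>2) + (L2_inner M f g + L2_inner M g f)"
    by (simp add: L2_inner_self[symmetric] s flip: of_real_power)
  then have "(L2_norm M (\<lambda>x. f x + g x))\<^sup>2 = (L2_norm M f)\<^sup>2 + (L2_norm M g)\<^sup>2 + Re (L2_inner M f g + L2_inner M g f)"
    by (drule_tac arg_cong[where f = Re]) simp
  also have "Re (L2_inner M f g + L2_inner M g f) \<le> cmod (L2_inner M f g) + cmod (L2_inner M g f)"
    using complex_Re_le_cmod by (simp add: add_mono)
  also have "\<dots> \<le> 2 * L2_norm M f * L2_norm M g"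
    using L2_norm_Cauchy_Schwarz[OF assms] L2_norm_Cauchy_Schwarz[OF assms(2,1)]
    by (simp add: mult.commute[of "L2_norm M g"])
  finally show "(L2_norm M (\<lambda>x. f x + g x))\<^sup>2 \<le> (L2_norm M f + L2_norm M g)\<^sup>2"
    by (simp add: power2_sum)
qed simp

lemma L2_norm_minus_commute: "L2_norm M (\<lambda>x. f x - g x) = L2_norm M (\<lambda>x. g x - f x)"
  by (simp add: L2_norm_def norm_minus_commute)

lemma L2_norm_triangle_diff:
  assumes "f \<in> L2 M" "g \<in> L2 M"
  shows "L2_norm M f \<le> L2_norm M (\<lambda>x. f x - g x) + L2_norm M g"
  using L2_norm_triangle[OF L2_diff[OF assms] assms(2)] by simp

lemma L2_norm_triangle_diff2:
  assumes "f \<in> L2 M" "g \<in> L2 M" "w \<in> L2 M"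
  shows "L2_norm M (\<lambda>x. f x - w x) \<le> L2_norm M (\<lambda>x. f x - g x) + L2_norm M (\<lambda>x. g x - w x)"
  using L2_norm_triangle[OF L2_diff[OF assms(1,2)] L2_diff[OF assms(2,3)]] by (simp add: diff_add_eq)

text \<open>Elements are functions rather than classes, so equality almost everywhere enters as a
  vanishing norm of the difference; inner products do not notice it by Cauchy-Schwarz.\<close>

lemma L2_inner_eq_if_norm_0:
  assumes "f \<in> L2 M" "g \<in> L2 M" "w \<in> L2 M" "L2_norm M (\<lambda>x. f x - g x) = 0"
  shows "L2_inner M w f = L2_inner M w g"
  using L2_norm_Cauchy_Schwarz[OF assms(3) L2_diff[OF assms(1,2)]] assms
  by (simp add: L2_inner_diff_right)

subsection \<open>Unconditional sums\<close>

lemma L2_has_sumD: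
  assumes "L2_has_sum M g I f"
  shows "f \<in> L2 M" "\<And>i. i \<in> I \<Longrightarrow> g i \<in> L2 M"
    "((\<lambda>F. L2_norm M (\<lambda>x. f x - (\<Sum>i\<in>F. g i x))) \<longlongrightarrow> 0) (finite_subsets_at_top I)"
  using assms by (auto simp: L2_has_sum_def)

text \<open>Cauchy-Schwarz bounds the error of the scalar sums by the norm error. This is how a
  two-scale series becomes a series for frame coefficients.\<close>

lemma L2_has_sum_inner:
  assumes "L2_has_sum M g I f" "w \<in> L2 M"
  shows "((\<lambda>i. L2_inner M w (g i)) has_sum L2_inner M w f) I"
  unfolding has_sum_def
proof (rule Lim_transform2)
  note d = L2_has_sumD[OF assms(1)]
  show "((\<lambda>F. L2_inner M w f) \<longlongrightarrow> L2_inner M w f) (finite_subsets_at_top I)" by simp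
  show "((\<lambda>F. L2_inner M w f - (\<Sum>i\<in>F. L2_inner M w (g i))) \<longlongrightarrow> 0) (finite_subsets_at_top I)"
  proof (rule tendsto_norm_zero_cancel, rule tendsto_sandwich[OF _ _ tendsto_const tendsto_mult_right_zero[OF d(3), of "L2_norm M w"]])
    show "\<forall>\<^sub>F F in finite_subsets_at_top I. norm (L2_inner M w f - (\<Sum>i\<in>F. L2_inner M w (g i)))
       \<le> L2_norm M w * L2_norm M (\<lambda>x. f x - (\<Sum>i\<in>F. g i x))"
    proof (rule eventually_finite_subsets_at_top_weakI)
      fix F assume F: "finite F" "F \<subseteq> I"
      then have i: "(\<lambda>x. \<Sum>i\<in>F. g i x) \<in> L2 M" using d(2) by blast
      have "L2_inner M w (\<lambda>x. \<Sum>i\<in>F. g i x) = (\<Sum>i\<in>F. L2_inner M w (g i))"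
        using F d(2) assms(2) by (intro L2_inner_sum_right) auto
      then have "L2_inner M w f - (\<Sum>i\<in>F. L2_inner M w (g i)) = L2_inner M w (\<lambda>x. f x - (\<Sum>i\<in>F. g i x))"
        using L2_inner_diff_right[OF d(1) i assms(2)] by simp
      then show "norm (L2_inner M w f - (\<Sum>i\<in>F. L2_inner M w (g i)))
         \<le> L2_norm M w * L2_norm M (\<lambda>x. f x - (\<Sum>i\<in>F. g i x))"
        using L2_norm_Cauchy_Schwarz[OF assms(2) L2_diff[OF d(1) i]] by simp
    qed
  qed auto
qed

lemma L2_has_sum_add:
  assumes "L2_has_sum M g I f" "L2_has_sum M g' I f'"
  shows "L2_has_sum M (\<lambda>i x. g i x + g' i x) I (\<lambda>x. f x + f' x)"
  unfolding L2_has_sum_def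
proof (intro conjI ballI)
  note d = L2_has_sumD[OF assms(1)] and d' = L2_has_sumD[OF assms(2)]
  show "(\<lambda>x. f x + f' x) \<in> L2 M" using d d' by auto
  show "(\<lambda>x. g i x + g' i x) \<in> L2 M" if "i \<in> I" for i using d d' that by auto
  show "((\<lambda>F. L2_norm M (\<lambda>x. f x + f' x - (\<Sum>i\<in>F. g i x + g' i x))) \<longlongrightarrow> 0) (finite_subsets_at_top I)"
  proof (rule tendsto_sandwich[OF _ _ tendsto_const tendsto_add_zero[OF d(3) d'(3)]])
    show "\<forall>\<^sub>F F in finite_subsets_at_top I. L2_norm M (\<lambda>x. f x + f' x - (\<Sum>i\<in>F. g i x + g' i x))
      \<le> L2_norm M (\<lambda>x. f x - (\<Sum>i\<in>F. g i x)) + L2_norm M (\<lambda>x. f' x - (\<Sum>i\<in>F. g' i x))"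
    proof (rule eventually_finite_subsets_at_top_weakI)
      fix F assume F: "finite F" "F \<subseteq> I"
      have "(\<lambda>x. f x - (\<Sum>i\<in>F. g i x)) \<in> L2 M" "(\<lambda>x. f' x - (\<Sum>i\<in>F. g' i x)) \<in> L2 M"
        using F d d' by (auto intro!: L2_diff L2_sum)
      from L2_norm_triangle[OF this] show "L2_norm M (\<lambda>x. f x + f' x - (\<Sum>i\<in>F. g i x + g' i x))
         \<le> L2_norm M (\<lambda>x. f x - (\<Sum>i\<in>F. g i x)) + L2_norm M (\<lambda>x. f' x - (\<Sum>i\<in>F. g' i x))"
        by (simp add: sum.distrib algebra_simps)
    qed
  qed auto
qed

lemma L2_has_sum_zero: "L2_has_sum M (\<lambda>i x. 0) I (\<lambda>x. 0)"
  by (simp add: L2_has_sum_def L2_norm_def)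

lemma L2_has_sum_sum:
  assumes "\<And>j. j \<in> J \<Longrightarrow> L2_has_sum M (g j) I (f j)"
  shows "L2_has_sum M (\<lambda>i x. \<Sum>j\<in>J. g j i x) I (\<lambda>x. \<Sum>j\<in>J. f j x)"
  using assms
  by (induction J rule: infinite_finite_induct) (simp_all add: L2_has_sum_zero L2_has_sum_add)

text \<open>Transports unconditional sums along any operation that enlarges the error of finite
  partial sums by at most a constant. It serves for multiplication by a character, for translation
  on the torus and for translation in space.\<close>

lemma L2_has_sum_comparison:
  assumes s: "L2_has_sum M g I f"
    and f': "f' \<in> L2 N" and g': "\<And>i. i \<in> I \<Longrightarrow> g' i \<in> L2 N"
    and le: "\<And>F. finite F \<Longrightarrow> F \<subseteq> I \<Longrightarrow>
      L2_norm N (\<lambda>x. f' x - (\<Sum>i\<in>F. g' i x)) \<le> C * L2_norm M (\<lambda>x. f x - (\<Sum>i\<in>F. g i x))"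
  shows "L2_has_sum N g' I f'"
  unfolding L2_has_sum_def
proof (intro conjI ballI)
  show "((\<lambda>F. L2_norm N (\<lambda>x. f' x - (\<Sum>i\<in>F. g' i x))) \<longlongrightarrow> 0) (finite_subsets_at_top I)"
    by (rule tendsto_sandwich[OF _ eventually_finite_subsets_at_top_weakI[OF le] tendsto_const
          tendsto_mult_right_zero[OF L2_has_sumD(3)[OF s]]]) simp
qed (use f' g' in auto)

lemma L2_has_sum_reindex:
  assumes "bij_betw p J I"
  shows "L2_has_sum M (\<lambda>j. g (p j)) J f \<longleftrightarrow> L2_has_sum M g I f"
proof -
  have I: "I = p ` J" and inj: "inj_on p J"
    using assms by (auto simp: bij_betw_def)
  have "((\<lambda>F. L2_norm M (\<lambda>x. f x - (\<Sum>i\<in>F. g i x))) \<longlongrightarrow> 0) (finite_subsets_at_top I)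
      \<longleftrightarrow> ((\<lambda>F. L2_norm M (\<lambda>x. f x - (\<Sum>i\<in>p ` F. g i x))) \<longlongrightarrow> 0) (finite_subsets_at_top J)"
    unfolding I filtermap_image_finite_subsets_at_top[OF inj, symmetric] filterlim_filtermap ..
  also have "\<dots> \<longleftrightarrow> ((\<lambda>F. L2_norm M (\<lambda>x. f x - (\<Sum>j\<in>F. g (p j) x))) \<longlongrightarrow> 0) (finite_subsets_at_top J)"
  proof (intro tendsto_cong eventually_finite_subsets_at_top_weakI)
    fix F assume "finite F" "F \<subseteq> J"
    then show "L2_norm M (\<lambda>x. f x - (\<Sum>i\<in>p ` F. g i x)) = L2_norm M (\<lambda>x. f x - (\<Sum>j\<in>F. g (p j) x))"
      using inj_on_subset[OF inj] by (simp add: sum.reindex)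
  qed
  finally have "((\<lambda>F. L2_norm M (\<lambda>x. f x - (\<Sum>i\<in>F. g i x))) \<longlongrightarrow> 0) (finite_subsets_at_top I)
      \<longleftrightarrow> ((\<lambda>F. L2_norm M (\<lambda>x. f x - (\<Sum>j\<in>F. g (p j) x))) \<longlongrightarrow> 0) (finite_subsets_at_top J)" .
  then show ?thesis
    by (auto simp: L2_has_sum_def I)
qed

section \<open>Matrices acting on square-summable families\<close>

text \<open>Only finitely supported inputs are tested: on them applying the matrix raises no
  question of convergence, and they are the inputs for which Parseval's identity gives the estimate.
  \<open>l2_bounds_upper\<close> and \<open>l2_bounds_lower\<close> remove the restriction.\<close>

definition l2_bounds :: "'i set \<Rightarrow> 'j set \<Rightarrow> ('i \<Rightarrow> 'j \<Rightarrow> complex) \<Rightarrow> real \<Rightarrow> real \<Rightarrow> bool" where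
  "l2_bounds I J m lo hi \<longleftrightarrow> 0 \<le> hi \<and>
     (\<forall>F x. finite F \<longrightarrow> F \<subseteq> J \<longrightarrow>
        (\<lambda>i. (cmod (\<Sum>j\<in>F. m i j * x j))\<^sup>2) summable_on I \<and>
        lo * (\<Sum>j\<in>F. (cmod (x j))\<^sup>2) \<le> (\<Sum>\<^sub>\<infinity>i\<in>I. (cmod (\<Sum>j\<in>F. m i j * x j))\<^sup>2) \<and>
        (\<Sum>\<^sub>\<infinity>i\<in>I. (cmod (\<Sum>j\<in>F. m i j * x j))\<^sup>2) \<le> hi * (\<Sum>j\<in>F. (cmod (x j))\<^sup>2))"

lemma l2_boundsD:
  assumes "l2_bounds I J m lo hi" "finite F" "F \<subseteq> J"
  shows "(\<lambda>i. (cmod (\<Sum>j\<in>F. m i j * x j))\<^sup>2) summable_on I"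
    and "lo * (\<Sum>j\<in>F. (cmod (x j))\<^sup>2) \<le> (\<Sum>\<^sub>\<infinity>i\<in>I. (cmod (\<Sum>j\<in>F. m i j * x j))\<^sup>2)"
    and "(\<Sum>\<^sub>\<infinity>i\<in>I. (cmod (\<Sum>j\<in>F. m i j * x j))\<^sup>2) \<le> hi * (\<Sum>j\<in>F. (cmod (x j))\<^sup>2)"
  using assms by (auto simp: l2_bounds_def)

text \<open>A Fatou argument: for finitely many fixed outputs the truncated inputs converge entry by
  entry and obey the bound uniformly; only afterwards does the set of outputs grow.\<close>

lemma l2_bounds_upper:
  assumes m: "l2_bounds I J m lo hi"
    and x: "(\<lambda>j. (cmod (x j))\<^sup>2) summable_on J"
    and y: "\<And>i. i \<in> I \<Longrightarrow> ((\<lambda>j. m i j * x j) has_sum y i) J"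
  shows "(\<lambda>i. (cmod (y i))\<^sup>2) summable_on I"
    and "(\<Sum>\<^sub>\<infinity>i\<in>I. (cmod (y i))\<^sup>2) \<le> hi * (\<Sum>\<^sub>\<infinity>j\<in>J. (cmod (x j))\<^sup>2)"
proof -
  have hi: "0 \<le> hi" using m by (simp add: l2_bounds_def)
  have fin: "(\<Sum>i\<in>G. (cmod (y i))\<^sup>2) \<le> hi * (\<Sum>\<^sub>\<infinity>j\<in>J. (cmod (x j))\<^sup>2)" if G: "finite G" "G \<subseteq> I" for G
  proof (rule tendsto_upperbound)
    show "((\<lambda>F. \<Sum>i\<in>G. (cmod (\<Sum>j\<in>F. m i j * x j))\<^sup>2) \<longlongrightarrow> (\<Sum>i\<in>G. (cmod (y i))\<^sup>2)) (finite_subsets_at_top J)"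
      using y G by (intro tendsto_intros) (auto simp: has_sum_def)
    show "\<forall>\<^sub>F F in finite_subsets_at_top J.
        (\<Sum>i\<in>G. (cmod (\<Sum>j\<in>F. m i j * x j))\<^sup>2) \<le> hi * (\<Sum>\<^sub>\<infinity>j\<in>J. (cmod (x j))\<^sup>2)"
    proof (rule eventually_finite_subsets_at_top_weakI)
      fix F assume F: "finite F" "F \<subseteq> J"
      have "(\<Sum>i\<in>G. (cmod (\<Sum>j\<in>F. m i j * x j))\<^sup>2) \<le> (\<Sum>\<^sub>\<infinity>i\<in>I. (cmod (\<Sum>j\<in>F. m i j * x j))\<^sup>2)"
        using l2_boundsD(1)[OF m F] G by (intro finite_sum_le_infsum) auto
      also have "\<dots> \<le> hi * (\<Sum>j\<in>F. (cmod (x j))\<^sup>2)"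
        by (rule l2_boundsD(3)[OF m F])
      also have "\<dots> \<le> hi * (\<Sum>\<^sub>\<infinity>j\<in>J. (cmod (x j))\<^sup>2)"
        using F hi by (intro mult_left_mono finite_sum_le_infsum x) auto
      finally show "(\<Sum>i\<in>G. (cmod (\<Sum>j\<in>F. m i j * x j))\<^sup>2) \<le> hi * (\<Sum>\<^sub>\<infinity>j\<in>J. (cmod (x j))\<^sup>2)" .
    qed
  qed simp
  show s: "(\<lambda>i. (cmod (y i))\<^sup>2) summable_on I"
    by (rule nonneg_bdd_above_summable_on) (use fin in \<open>auto intro!: bdd_aboveI\<close>)
  show "(\<Sum>\<^sub>\<infinity>i\<in>I. (cmod (y i))\<^sup>2) \<le> hi * (\<Sum>\<^sub>\<infinity>j\<in>J. (cmod (x j))\<^sup>2)"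
    by (rule infsum_le_finite_sums[OF s fin])
qed

text \<open>Young's inequality for the cross term, weighted so that the factor of the main summand
  can be brought arbitrarily close to 1 at the expense of the other one.\<close>

lemma cmod_power2_add_le:
  assumes "\<epsilon> > 0"
  shows "(cmod (a + b))\<^sup>2 \<le> (1 + \<epsilon>) * (cmod a)\<^sup>2 + (1 + 1 / \<epsilon>) * (cmod b)\<^sup>2"
proof -
  have "(cmod (a + b))\<^sup>2 \<le> (cmod a + cmod b)\<^sup>2"
    by (simp add: norm_triangle_ineq power_mono)
  moreover have "0 \<le> (\<epsilon> * cmod a - cmod b)\<^sup>2 / \<epsilon>"
    using assms by simp
  then have "2 * cmod a * cmod b \<le> \<epsilon> * (cmod a)\<^sup>2 + (cmod b)\<^sup>2 / \<epsilon>"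
    using assms by (simp add: power2_diff field_simps power2_eq_square)
  ultimately show ?thesis by (simp add: power2_sum algebra_simps)
qed

text \<open>Entrywise convergence of the outputs gives no lower bound in the limit. The input is
  therefore split into a finite section, which obeys the lower bound, and a tail, whose image is
  small by the upper bound. The weight \<open>\<epsilon>\<close> stays fixed while the section
  exhausts \<open>J\<close>, and tends to 0 only at the end.\<close>

lemma l2_bounds_lower:
  assumes m: "l2_bounds I J m lo hi"
    and x: "(\<lambda>j. (cmod (x j))\<^sup>2) summable_on J"
    and y: "\<And>i. i \<in> I \<Longrightarrow> ((\<lambda>j. m i j * x j) has_sum y i) J"
  shows "lo * (\<Sum>\<^sub>\<infinity>j\<in>J. (cmod (x j))\<^sup>2) \<le> (\<Sum>\<^sub>\<infinity>i\<in>I. (cmod (y i))\<^sup>2)"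
proof -
  define S where "S = (\<Sum>\<^sub>\<infinity>j\<in>J. (cmod (x j))\<^sup>2)"
  define Y where "Y = (\<Sum>\<^sub>\<infinity>i\<in>I. (cmod (y i))\<^sup>2)"
  note ys = l2_bounds_upper(1)[OF m x y]
  have xS: "((\<lambda>j. (cmod (x j))\<^sup>2) has_sum S) J"
    using x by (simp add: S_def)
  have key: "lo * (\<Sum>j\<in>F. (cmod (x j))\<^sup>2) \<le> (1 + \<epsilon>) * Y + (1 + 1 / \<epsilon>) * (hi * (S - (\<Sum>j\<in>F. (cmod (x j))\<^sup>2)))"
    if F: "finite F" "F \<subseteq> J" and e: "\<epsilon> > 0" for F \<epsilon>
  proof -
    define x' where "x' j = (if j \<in> F then 0 else x j)" for j
    define yF where "yF i = (\<Sum>j\<in>F. m i j * x j)" for i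
    have fin: "((\<lambda>j. if j \<in> F then g j else 0) has_sum (\<Sum>j\<in>F. g j)) J"
      for g :: "'b \<Rightarrow> 'c :: real_normed_vector"
      using F by (intro has_sum_finite_neutralI[of F]) auto
    have x'S: "((\<lambda>j. (cmod (x' j))\<^sup>2) has_sum (S - (\<Sum>j\<in>F. (cmod (x j))\<^sup>2))) J"
      using has_sum_add[OF xS has_sum_uminusI[OF fin[of "\<lambda>j. (cmod (x j))\<^sup>2"]]] unfolding add_uminus_conv_diff
      by (rule has_sum_cong[THEN iffD1, rotated]) (simp add: x'_def)
    have y': "((\<lambda>j. m i j * x' j) has_sum (y i - yF i)) J" if "i \<in> I" for i
      using has_sum_add[OF y[OF that] has_sum_uminusI[OF fin[of "\<lambda>j. m i j * x j"]]] unfolding yF_def add_uminus_conv_diff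
      by (rule has_sum_cong[THEN iffD1, rotated]) (simp add: x'_def)
    note u = l2_bounds_upper[OF m has_sum_imp_summable[OF x'S] y']
    have s1: "(\<lambda>i. (1 + \<epsilon>) * (cmod (y i))\<^sup>2) summable_on I"
      using ys by (rule summable_on_cmult_right)
    have s2: "(\<lambda>i. (1 + 1 / \<epsilon>) * (cmod (y i - yF i))\<^sup>2) summable_on I"
      using u(1) by (rule summable_on_cmult_right)
    have "lo * (\<Sum>j\<in>F. (cmod (x j))\<^sup>2) \<le> (\<Sum>\<^sub>\<infinity>i\<in>I. (cmod (yF i))\<^sup>2)"
      unfolding yF_def by (rule l2_boundsD(2)[OF m F])
    also have "\<dots> \<le> (\<Sum>\<^sub>\<infinity>i\<in>I. (1 + \<epsilon>) * (cmod (y i))\<^sup>2 + (1 + 1 / \<epsilon>) * (cmod (y i - yF i))\<^sup>2)"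
    proof (rule infsum_mono)
      show "(\<lambda>i. (cmod (yF i))\<^sup>2) summable_on I"
        unfolding yF_def by (rule l2_boundsD(1)[OF m F])
      show "(cmod (yF i))\<^sup>2 \<le> (1 + \<epsilon>) * (cmod (y i))\<^sup>2 + (1 + 1 / \<epsilon>) * (cmod (y i - yF i))\<^sup>2" for i
        using cmod_power2_add_le[OF e, of "y i" "yF i - y i"] by (simp add: norm_minus_commute)
    qed (rule summable_on_add[OF s1 s2])
    also have "\<dots> = (1 + \<epsilon>) * Y + (1 + 1 / \<epsilon>) * (\<Sum>\<^sub>\<infinity>i\<in>I. (cmod (y i - yF i))\<^sup>2)"
      by (subst infsum_add[OF s1 s2]) (simp add: infsum_cmult_right' Y_def)
    also have "\<dots> \<le> (1 + \<epsilon>) * Y + (1 + 1 / \<epsilon>) * (hi * (S - (\<Sum>j\<in>F. (cmod (x j))\<^sup>2)))"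
      using u(2) e infsumI[OF x'S] by (intro add_left_mono mult_left_mono) auto
    finally show ?thesis .
  qed
  have "lo * S \<le> (1 + \<epsilon>) * Y" if e: "\<epsilon> > 0" for \<epsilon>
  proof -
    have t: "((\<lambda>F. \<Sum>j\<in>F. (cmod (x j))\<^sup>2) \<longlongrightarrow> S) (finite_subsets_at_top J)"
      using xS by (simp add: has_sum_def)
    have "lo * S \<le> (1 + \<epsilon>) * Y + (1 + 1 / \<epsilon>) * (hi * (S - S))"
    proof (rule tendsto_le[OF _ _ _ eventually_finite_subsets_at_top_weakI[OF key[OF _ _ e]]])
      show "((\<lambda>F. lo * (\<Sum>j\<in>F. (cmod (x j))\<^sup>2)) \<longlongrightarrow> lo * S) (finite_subsets_at_top J)"
        by (intro tendsto_intros t)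
      show "((\<lambda>F. (1 + \<epsilon>) * Y + (1 + 1 / \<epsilon>) * (hi * (S - (\<Sum>j\<in>F. (cmod (x j))\<^sup>2))))
          \<longlongrightarrow> (1 + \<epsilon>) * Y + (1 + 1 / \<epsilon>) * (hi * (S - S))) (finite_subsets_at_top J)"
        by (intro tendsto_intros t)
    qed simp
    then show ?thesis by simp
  qed
  then have "\<forall>\<^sub>F \<epsilon> in at_right 0. lo * S \<le> (1 + \<epsilon>) * Y"
    by (auto intro: eventually_at_right_less[THEN eventually_mono])
  moreover have "((\<lambda>\<epsilon>. (1 + \<epsilon>) * Y) \<longlongrightarrow> (1 + 0) * Y) (at_right 0)"
    by (intro tendsto_intros)
  ultimately have "lo * S \<le> (1 + 0) * Y"
    by (intro tendsto_lowerbound) auto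
  then show ?thesis by (simp add: S_def Y_def)
qed

section \<open>Closed subspaces and frames\<close>

text \<open>Since closedness is expressed through the seminorm on functions, membership is stable
  under changes on null sets. This is what later puts \<open>f 0\<close> into
  \<open>V0\<close>.\<close>

definition L2_closed_subspace :: "'a measure \<Rightarrow> ('a \<Rightarrow> complex) set \<Rightarrow> bool" where
  "L2_closed_subspace M V \<longleftrightarrow>
     V \<subseteq> L2 M \<and> (\<lambda>x. 0) \<in> V \<and>
     (\<forall>f\<in>V. \<forall>g\<in>V. (\<lambda>x. f x + g x) \<in> V) \<and>
     (\<forall>f\<in>V. \<forall>c. (\<lambda>x. c * f x) \<in> V) \<and>
     (\<forall>f\<in>L2 M. (\<forall>\<epsilon>>0. \<exists>g\<in>V. L2_norm M (\<lambda>x. f x - g x) < \<epsilon>) \<longrightarrow> f \<in> V)"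

lemma L2_closed_subspaceD:
  assumes "L2_closed_subspace M V"
  shows "f \<in> V \<Longrightarrow> f \<in> L2 M"
    and "(\<lambda>x. 0) \<in> V"
    and "f \<in> V \<Longrightarrow> g \<in> V \<Longrightarrow> (\<lambda>x. f x + g x) \<in> V"
    and "f \<in> V \<Longrightarrow> (\<lambda>x. c * f x) \<in> V"
    and "f \<in> L2 M \<Longrightarrow> (\<And>\<epsilon>. \<epsilon> > 0 \<Longrightarrow> \<exists>g\<in>V. L2_norm M (\<lambda>x. f x - g x) < \<epsilon>) \<Longrightarrow> f \<in> V"
  using assms by (auto simp: L2_closed_subspace_def)

lemma L2_closed_subspace_sum:
  assumes "L2_closed_subspace M V" "\<And>i. i \<in> F \<Longrightarrow> g i \<in> V"
  shows "(\<lambda>x. \<Sum>i\<in>F. g i x) \<in> V"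
  using assms(2)
  by (induction F rule: infinite_finite_induct) (simp_all add: L2_closed_subspaceD(2,3)[OF assms(1)])

lemma L2_closed_subspace_has_sum:
  assumes V: "L2_closed_subspace M V" and s: "L2_has_sum M g I f" and g: "\<And>i. i \<in> I \<Longrightarrow> g i \<in> V"
  shows "f \<in> V"
proof (rule L2_closed_subspaceD(5)[OF V])
  show "f \<in> L2 M" using s by (simp add: L2_has_sum_def)
  fix \<epsilon> :: real assume "\<epsilon> > 0"
  then have "\<forall>\<^sub>F F in finite_subsets_at_top I. L2_norm M (\<lambda>x. f x - (\<Sum>i\<in>F. g i x)) < \<epsilon>"
    using L2_has_sumD(3)[OF s] by (auto dest: order_tendstoD(2))
  then obtain F where F: "finite F" "F \<subseteq> I" and e: "L2_norm M (\<lambda>x. f x - (\<Sum>i\<in>F. g i x)) < \<epsilon>"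
    by (auto simp: eventually_finite_subsets_at_top)
  have "(\<lambda>x. \<Sum>i\<in>F. g i x) \<in> V"
    using F g by (intro L2_closed_subspace_sum[OF V]) auto
  then show "\<exists>h\<in>V. L2_norm M (\<lambda>x. f x - h x) < \<epsilon>"
    using e by (intro bexI[of _ "\<lambda>x. \<Sum>i\<in>F. g i x"])
qed

lemma L2_closed_subspace_closed_span:
  assumes g: "\<And>i. i \<in> I \<Longrightarrow> g i \<in> L2 M"
  shows "L2_closed_subspace M (closed_span M I g)"
  unfolding L2_closed_subspace_def
proof (intro conjI ballI allI impI)
  have comb: "(\<lambda>x. \<Sum>i\<in>F. c i * g i x) \<in> L2 M" if "F \<subseteq> I" for F c
    using g that by (intro L2_sum L2_cmult) auto
  show "closed_span M I g \<subseteq> L2 M" by (auto simp: closed_span_def)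
  show "(\<lambda>x. 0) \<in> closed_span M I g"
    by (auto simp: closed_span_def L2_norm_def intro!: exI[of _ "{}"])
  fix f assume f: "f \<in> closed_span M I g"
  then have fL: "f \<in> L2 M" by (simp add: closed_span_def)
  { fix c
    show "(\<lambda>x. c * f x) \<in> closed_span M I g"
      unfolding closed_span_def mem_Collect_eq
    proof (intro conjI allI impI)
      show "(\<lambda>x. c * f x) \<in> L2 M" using fL by auto
      fix \<epsilon> :: real assume "\<epsilon> > 0"
      \<comment> \<open>The added 1 avoids a separate case for \<open>c = 0\<close>.\<close>
      then have "\<epsilon> / (cmod c + 1) > 0"
        by (simp add: add_nonneg_pos)
      then obtain F b where F: "finite F" "F \<subseteq> I"
        "L2_norm M (\<lambda>x. f x - (\<Sum>i\<in>F. b i * g i x)) < \<epsilon> / (cmod c + 1)"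
        using f by (auto simp: closed_span_def)
      have "L2_norm M (\<lambda>x. c * f x - (\<Sum>i\<in>F. (c * b i) * g i x)) = L2_norm M (\<lambda>x. c * (f x - (\<Sum>i\<in>F. b i * g i x)))"
        by (simp add: right_diff_distrib sum_distrib_left mult.assoc)
      also have "\<dots> = cmod c * L2_norm M (\<lambda>x. f x - (\<Sum>i\<in>F. b i * g i x))"
        by (rule L2_norm_cmult)
      also have "\<dots> \<le> (cmod c + 1) * L2_norm M (\<lambda>x. f x - (\<Sum>i\<in>F. b i * g i x))"
        by (intro mult_right_mono) auto
      also have "\<dots> < \<epsilon>"
        using F(3) by (simp add: pos_less_divide_eq add_nonneg_pos mult.commute)
      finally show "\<exists>F b. finite F \<and> F \<subseteq> I \<and> L2_norm M (\<lambda>x. c * f x - (\<Sum>i\<in>F. b i * g i x)) < \<epsilon>"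
        using F(1,2) by (intro exI[of _ F] exI[of _ "\<lambda>i. c * b i"]) auto
    qed }
  fix f' assume f': "f' \<in> closed_span M I g"
  then have f'L: "f' \<in> L2 M" by (simp add: closed_span_def)
  show "(\<lambda>x. f x + f' x) \<in> closed_span M I g"
    unfolding closed_span_def mem_Collect_eq
  proof (intro conjI allI impI)
    show "(\<lambda>x. f x + f' x) \<in> L2 M" using fL f'L by auto
    fix \<epsilon> :: real assume "\<epsilon> > 0"
    then have e2: "\<epsilon> / 2 > 0" by simp
    obtain F b where F: "finite F" "F \<subseteq> I" "L2_norm M (\<lambda>x. f x - (\<Sum>i\<in>F. b i * g i x)) < \<epsilon> / 2"
      using f e2 unfolding closed_span_def by blast
    obtain F' b' where F': "finite F'" "F' \<subseteq> I" "L2_norm M (\<lambda>x. f' x - (\<Sum>i\<in>F'. b' i * g i x)) < \<epsilon> / 2"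
      using f' e2 unfolding closed_span_def by blast
    \<comment> \<open>The two index sets may overlap; there the coefficients have to be
      added.\<close>
    define d where "d i = (if i \<in> F then b i else 0) + (if i \<in> F' then b' i else 0)" for i
    have "(\<Sum>i\<in>F \<union> F'. d i * g i x) = (\<Sum>i\<in>F. b i * g i x) + (\<Sum>i\<in>F'. b' i * g i x)" for x
    proof -
      have "(\<Sum>i\<in>F \<union> F'. d i * g i x) = (\<Sum>i\<in>F \<union> F'. if i \<in> F then b i * g i x else 0)
          + (\<Sum>i\<in>F \<union> F'. if i \<in> F' then b' i * g i x else 0)"
        unfolding sum.distrib[symmetric] by (intro sum.cong) (auto simp: d_def distrib_right)
      also have "\<dots> = (\<Sum>i\<in>F. b i * g i x) + (\<Sum>i\<in>F'. b' i * g i x)"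
        using F(1) F'(1) by (simp add: sum.If_cases Int_absorb1 Int_absorb2 Un_Int_eq)
      finally show ?thesis .
    qed
    then have "L2_norm M (\<lambda>x. f x + f' x - (\<Sum>i\<in>F \<union> F'. d i * g i x))
        = L2_norm M (\<lambda>x. (f x - (\<Sum>i\<in>F. b i * g i x)) + (f' x - (\<Sum>i\<in>F'. b' i * g i x)))"
      by (simp add: algebra_simps)
    also have "\<dots> \<le> L2_norm M (\<lambda>x. f x - (\<Sum>i\<in>F. b i * g i x)) + L2_norm M (\<lambda>x. f' x - (\<Sum>i\<in>F'. b' i * g i x))"
      using F(2) F'(2) by (intro L2_norm_triangle L2_diff fL f'L comb)
    also have "\<dots> < \<epsilon>" using F(3) F'(3) by simp
    finally show "\<exists>F b. finite F \<and> F \<subseteq> I \<and> L2_norm M (\<lambda>x. f x + f' x - (\<Sum>i\<in>F. b i * g i x)) < \<epsilon>"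
      using F F' by (intro exI[of _ "F \<union> F'"] exI[of _ d]) auto
  qed
next
  fix f assume f: "f \<in> L2 M" and lim: "\<forall>\<epsilon>>0. \<exists>h\<in>closed_span M I g. L2_norm M (\<lambda>x. f x - h x) < \<epsilon>"
  show "f \<in> closed_span M I g"
    unfolding closed_span_def mem_Collect_eq
  proof (intro conjI allI impI)
    show "f \<in> L2 M" by fact
    fix \<epsilon> :: real assume "\<epsilon> > 0"
    then have e2: "\<epsilon> / 2 > 0" by simp
    obtain h where h: "h \<in> closed_span M I g" "L2_norm M (\<lambda>x. f x - h x) < \<epsilon> / 2"
      using lim e2 by blast
    obtain F b where F: "finite F" "F \<subseteq> I" "L2_norm M (\<lambda>x. h x - (\<Sum>i\<in>F. b i * g i x)) < \<epsilon> / 2"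
      using h(1) e2 unfolding closed_span_def by blast
    have hL: "h \<in> L2 M" using h(1) by (simp add: closed_span_def)
    have "(\<lambda>x. \<Sum>i\<in>F. b i * g i x) \<in> L2 M"
      using g F(2) by (intro L2_sum L2_cmult) auto
    from L2_norm_triangle_diff2[OF f hL this]
    have "L2_norm M (\<lambda>x. f x - (\<Sum>i\<in>F. b i * g i x)) < \<epsilon>"
      using F(3) h(2) by linarith
    then show "\<exists>F b. finite F \<and> F \<subseteq> I \<and> L2_norm M (\<lambda>x. f x - (\<Sum>i\<in>F. b i * g i x)) < \<epsilon>"
      using F(1,2) by (intro exI[of _ F] exI[of _ b]) simp
  qed
qed

text \<open>A Bessel bound on the span of the family is a Bessel bound on the whole space: test it on
  the finite section \<open>\<Sum>i\<in>F. \<langle>w, g i\<rangle> g i\<close> of the frame operator.\<close>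

lemma is_frame_Bessel:
  assumes V: "L2_closed_subspace M V" and fr: "is_frame M V I g C1 C2" and w: "w \<in> L2 M"
  shows "(\<lambda>i. (cmod (L2_inner M w (g i)))\<^sup>2) summable_on I"
proof -
  have C2: "0 \<le> C2" using fr by (simp add: is_frame_def)
  have gV: "g i \<in> V" if "i \<in> I" for i using fr that by (simp add: is_frame_def)
  then have gL: "g i \<in> L2 M" if "i \<in> I" for i using that L2_closed_subspaceD(1)[OF V] by blast
  have "(\<Sum>i\<in>F. (cmod (L2_inner M w (g i)))\<^sup>2) \<le> C2 * (L2_norm M w)\<^sup>2" if F: "finite F" "F \<subseteq> I" for F
  proof -
    let ?S = "\<Sum>i\<in>F. (cmod (L2_inner M w (g i)))\<^sup>2"
    define y where "y = (\<lambda>x. \<Sum>i\<in>F. L2_inner M w (g i) * g i x)"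
    have gF: "(\<lambda>x. c * g i x) \<in> L2 M" if "i \<in> F" for i c using F that gL by auto
    have yV: "y \<in> V"
      unfolding y_def using F gV
      by (intro L2_closed_subspace_sum[OF V]) (auto intro: L2_closed_subspaceD[OF V])
    then have yL: "y \<in> L2 M" using L2_closed_subspaceD(1)[OF V] by blast
    have inner_y: "L2_inner M v y = (\<Sum>i\<in>F. cnj (L2_inner M w (g i)) * L2_inner M v (g i))" if "v \<in> L2 M" for v
      unfolding y_def by (subst L2_inner_sum_right) (use gF that in \<open>auto simp: L2_inner_cmult_right\<close>)
    have "L2_inner M w y = complex_of_real ?S"
      by (simp only: inner_y[OF w] of_real_sum complex_norm_square mult.commute)
    then have S: "?S \<le> L2_norm M w * L2_norm M y"
      using L2_norm_Cauchy_Schwarz[OF w yL] sum_nonneg[of F "\<lambda>i. (cmod (L2_inner M w (g i)))\<^sup>2"]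
      by (simp flip: of_real_sum of_real_power)
    have "(\<Sum>i\<in>F. (cmod (L2_inner M y (g i)))\<^sup>2) \<le> (\<Sum>\<^sub>\<infinity>i\<in>I. (cmod (L2_inner M y (g i)))\<^sup>2)"
      using fr yV F by (intro finite_sum_le_infsum) (auto simp: is_frame_def)
    also have "\<dots> \<le> C2 * (L2_norm M y)\<^sup>2"
      using fr yV by (auto simp: is_frame_def)
    finally have B: "(\<Sum>i\<in>F. (cmod (L2_inner M y (g i)))\<^sup>2) \<le> C2 * (L2_norm M y)\<^sup>2" .
    have "(L2_norm M y)\<^sup>2 = cmod (L2_inner M y y)"
      by (simp add: L2_inner_self norm_power)
    also have "\<dots> \<le> (\<Sum>i\<in>F. cmod (L2_inner M w (g i)) * cmod (L2_inner M y (g i)))"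
      unfolding inner_y[OF yL] by (rule order_trans[OF norm_sum]) (simp add: norm_mult)
    finally have "((L2_norm M y)\<^sup>2)\<^sup>2 \<le> (\<Sum>i\<in>F. cmod (L2_inner M w (g i)) * cmod (L2_inner M y (g i)))\<^sup>2"
      by (rule power_mono) simp
    also have "\<dots> \<le> ?S * (\<Sum>i\<in>F. (cmod (L2_inner M y (g i)))\<^sup>2)"
      by (rule Cauchy_Schwarz_ineq_sum)
    also have "\<dots> \<le> ?S * (C2 * (L2_norm M y)\<^sup>2)"
      by (intro mult_left_mono B sum_nonneg) auto
    finally have *: "(L2_norm M y)\<^sup>2 * (L2_norm M y)\<^sup>2 \<le> (C2 * ?S) * (L2_norm M y)\<^sup>2"
      by (simp add: power2_eq_square mult_ac)
    \<comment> \<open>Together with \<open>?S \<le> L2_norm M w * L2_norm M y\<close> this bounds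
      the square of \<open>?S\<close> by \<open>C2 * (L2_norm M w)\<^sup>2\<close> times
      \<open>?S\<close>; cancelling \<open>?S\<close> leaves a Bessel bound with the same constant
      \<open>C2\<close>. Both cancellations need the case of a vanishing factor.\<close>
    have y: "(L2_norm M y)\<^sup>2 \<le> C2 * ?S"
    proof (cases "L2_norm M y = 0")
      case False
      then have "0 < (L2_norm M y)\<^sup>2" by simp
      with * show ?thesis by (rule mult_right_le_imp_le)
    qed (use C2 sum_nonneg[of F "\<lambda>i. (cmod (L2_inner M w (g i)))\<^sup>2"] in simp)
    have "?S * ?S \<le> (L2_norm M w * L2_norm M y)\<^sup>2"
      using power_mono[OF S, of 2] sum_nonneg[of F "\<lambda>i. (cmod (L2_inner M w (g i)))\<^sup>2"]
      by (simp add: power2_eq_square)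
    also have "\<dots> \<le> (L2_norm M w)\<^sup>2 * (C2 * ?S)"
      using y by (simp add: power_mult_distrib mult_left_mono)
    finally have **: "?S * ?S \<le> (C2 * (L2_norm M w)\<^sup>2) * ?S"
      by (simp add: mult_ac)
    show ?thesis
    proof (cases "?S = 0")
      case False
      then have "0 < ?S"
        using sum_nonneg[of F "\<lambda>i. (cmod (L2_inner M w (g i)))\<^sup>2"] by simp
      with ** show ?thesis by (rule mult_right_le_imp_le)
    qed (use C2 in simp)
  qed
  then show ?thesis
    by (intro nonneg_bdd_above_summable_on) (auto intro!: bdd_aboveI)
qed

section \<open>Affine changes of variables\<close>

text \<open>The library proves the next result for well-ordered index types only.\<close>

lemma measure_linear_image_finite:
  fixes f :: "real^'n \<Rightarrow> real^'n"
  assumes "linear f" "S \<in> lmeasurable"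
  shows "f ` S \<in> lmeasurable \<and> measure lebesgue (f ` S) = \<bar>Determinants.det (matrix f)\<bar> * measure lebesgue S"
proof -
  let ?Q = "\<lambda>f. \<forall>S\<in>lmeasurable. f ` S \<in> lmeasurable \<and>
    measure lebesgue (f ` S) = \<bar>Determinants.det (matrix f)\<bar> * measure lebesgue S"
  have sing: "?Q f" if "linear f" "\<not> inj f" for f :: "real^'n \<Rightarrow> real^'n"
  proof
    fix S :: "(real^'n) set"
    have "negligible (f ` S)"
      using that by (simp add: negligible_linear_singular_image)
    moreover have "Determinants.det (matrix f) = 0"
      using that det_nz_iff_inj by blast
    ultimately show "f ` S \<in> lmeasurable \<and>
        measure lebesgue (f ` S) = \<bar>Determinants.det (matrix f)\<bar> * measure lebesgue S"
      by (simp add: negligible_imp_measurable negligible_imp_measure0)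
  qed
  \<comment> \<open>For a determinant of modulus 1 it suffices that boxes keep their measure. Among
    the elementary maps this settles the coordinate swap and the shear.\<close>
  have unimodular: "?Q f"
    if "linear f" "\<bar>Determinants.det (matrix f)\<bar> = 1"
      "\<And>a b. cbox a b \<noteq> {} \<Longrightarrow> measure lebesgue (f ` cbox a b) = measure lebesgue (cbox a b)"
    for f :: "real^'n \<Rightarrow> real^'n"
  proof
    fix S :: "(real^'n) set" assume S: "S \<in> lmeasurable"
    have "measure lebesgue (f ` cbox a b) = 1 * measure lebesgue (cbox a b)" for a b
      using that(3)[of a b] by (cases "cbox a b = {}") auto
    from measure_linear_sufficient[OF that(1) S this] that(2)
    show "f ` S \<in> lmeasurable \<and> measure lebesgue (f ` S) = \<bar>Determinants.det (matrix f)\<bar> * measure lebesgue S"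
      by simp
  qed
  have "?Q f"
  proof (rule induct_linear_elementary[OF assms(1)])
    fix f g :: "real^'n \<Rightarrow> real^'n"
    assume "linear f" "linear g" "?Q f" "?Q g"
    then show "?Q (f \<circ> g)"
      by (simp add: image_comp[symmetric] matrix_compose det_mul abs_mult mult.assoc del: o_apply image_comp)
  next
    fix f :: "real^'n \<Rightarrow> real^'n" and i
    assume "linear f" "\<And>x. f x $ i = 0"
    then have "\<not> inj f"
      by (metis axis_nth linear_injective_imp_surjective one_neq_zero surjD)
    with \<open>linear f\<close> show "?Q f" by (rule sing)
  next
    fix c :: "'n \<Rightarrow> real"
    have "matrix (\<lambda>x. \<chi> i. c i * x $ i) = (\<chi> i j. if i = j then c i else 0)"
      by (simp add: matrix_def axis_def Finite_Cartesian_Product.vec_eq_iff)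
    then have "Determinants.det (matrix (\<lambda>x. \<chi> i. c i * x $ i)) = prod c UNIV"
      by (simp add: det_diagonal)
    then show "?Q (\<lambda>x. \<chi> i. c i * x $ i)"
      by (simp add: measurable_stretch measure_stretch)
  next
    fix m n :: 'n assume "m \<noteq> n"
    let ?h = "\<lambda>x::real^'n. \<chi> i. x $ Transposition.transpose m n i"
    show "?Q ?h"
    proof (rule unimodular)
      show "linear ?h"
        by (rule linearI) (simp_all add: Finite_Cartesian_Product.vec_eq_iff)
      have "matrix ?h = (\<chi> i. Finite_Cartesian_Product.mat 1 $ Transposition.transpose m n i)"
        by (auto simp: matrix_def axis_def Finite_Cartesian_Product.mat_def Finite_Cartesian_Product.vec_eq_iff)
      then show "\<bar>Determinants.det (matrix ?h)\<bar> = 1"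
        by (simp add: Determinants.det_permute_rows permutes_swap_id sign_swap_id abs_mult)
      fix a b :: "real^'n" assume ne: "cbox a b \<noteq> {}"
      have eq: "?h ` cbox a b = cbox (?h a) (?h b)"
      proof (intro Set.set_eqI iffI)
        fix x assume "x \<in> cbox (?h a) (?h b)"
        then have "?h x \<in> cbox a b"
          by (auto simp: mem_box_cart) (metis transpose_involutory)+
        then show "x \<in> ?h ` cbox a b"
          by (rule image_eqI[rotated]) (simp add: Finite_Cartesian_Product.vec_eq_iff)
      qed (auto simp: mem_box_cart)
      have "(\<Prod>i\<in>UNIV. ?h b $ i - ?h a $ i) = (\<Prod>i\<in>UNIV. b $ i - a $ i)"
        using prod.permute[OF permutes_swap_id[of m UNIV n], of "\<lambda>i. b $ i - a $ i"] by (simp add: o_def)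
      moreover have "cbox (?h a) (?h b) \<noteq> {}" using ne eq by blast
      ultimately show "measure lebesgue (?h ` cbox a b) = measure lebesgue (cbox a b)"
        using ne by (simp add: eq content_cbox_cart)
    qed
  next
    fix m n :: 'n assume mn: "m \<noteq> n"
    let ?h = "\<lambda>x::real^'n. \<chi> i. if i = m then x $ m + x $ n else x $ i"
    show "?Q ?h"
    proof (rule unimodular)
      show lin: "linear ?h"
        by (rule linearI) (simp_all add: Finite_Cartesian_Product.vec_eq_iff algebra_simps)
      have "matrix ?h = (\<chi> k. if k = m then Finite_Cartesian_Product.row m (Finite_Cartesian_Product.mat 1) + 1 *s Finite_Cartesian_Product.row n (Finite_Cartesian_Product.mat 1) else Finite_Cartesian_Product.row k (Finite_Cartesian_Product.mat 1))"
        by (auto simp: matrix_def axis_def Finite_Cartesian_Product.mat_def Finite_Cartesian_Product.vec_eq_iff Finite_Cartesian_Product.row_def)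
      then show "\<bar>Determinants.det (matrix ?h)\<bar> = 1"
        using det_row_operation[OF mn, of "Finite_Cartesian_Product.mat 1 :: real^'n^'n" 1] by simp
      fix a b :: "real^'n" assume ne: "cbox a b \<noteq> {}"
      \<comment> \<open>The measure formula for sheared boxes wants a nonnegative lower end in
        coordinate \<open>n\<close>. This translation moves that end to 0, and by linearity the
        shear turns it into another translation.\<close>
      define v :: "real^'n" where "v = (\<chi> i. if i = n then - a $ n else 0)"
      have tr: "(+) v ` cbox a b = cbox (v + a) (v + b)"
        by (rule cbox_translation[symmetric])
      have "?h ` (+) v ` cbox a b = (+) (?h v) ` ?h ` cbox a b"
        by (simp add: image_comp o_def linear_add[OF lin])
      then have "measure lebesgue (?h ` cbox a b) = measure lebesgue (?h ` cbox (v + a) (v + b))"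
        by (simp add: tr measure_translation)
      also have "\<dots> = measure lebesgue (cbox (v + a) (v + b))"
      proof (rule measure_shear_interval[OF mn])
        show "cbox (v + a) (v + b) \<noteq> {}" using ne by (simp flip: tr)
        show "0 \<le> (v + a) $ n" by (simp add: v_def)
      qed
      also have "\<dots> = measure lebesgue (cbox a b)"
        by (simp only: tr[symmetric] measure_translation)
      finally show "measure lebesgue (?h ` cbox a b) = measure lebesgue (cbox a b)" .
    qed
  qed
  with assms(2) show ?thesis by blast
qed

text \<open>For infinite measure the finite case is applied to a left inverse: an image of finite
  measure would be carried back to \<open>S\<close>, making \<open>S\<close> finite as well.\<close>

lemma emeasure_linear_image:
  fixes f :: "real^'n \<Rightarrow> real^'n"
  assumes f: "linear f" "inj f" and S: "S \<in> sets lebesgue"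
  shows "emeasure lebesgue (f ` S) = ennreal \<bar>Determinants.det (matrix f)\<bar> * emeasure lebesgue S"
proof (cases "S \<in> lmeasurable")
  case True
  with measure_linear_image_finite[OF f(1) True] show ?thesis
    by (simp add: emeasure_eq_measure2 ennreal_mult)
next
  case False
  obtain g where g: "linear g" "g \<circ> f = id"
    using f linear_injective_left_inverse by blast
  have fS: "f ` S \<in> sets lebesgue"
    by (rule differentiable_image_in_sets_lebesgue[OF S])
      (use f in \<open>auto intro: linear_imp_differentiable_on\<close>)
  have "g ` f ` S = S" using g(2) by (simp add: image_comp)
  then have "f ` S \<notin> lmeasurable"
    using measure_linear_image_finite[OF g(1), of "f ` S"] False by auto
  then have "emeasure lebesgue (f ` S) = \<infinity>" "emeasure lebesgue S = \<infinity>"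
    using False S fS by (auto simp: fmeasurable_def less_top[symmetric])
  moreover have "Determinants.det (matrix f) \<noteq> 0"
    using f det_nz_iff_inj by blast
  ultimately show ?thesis by (simp add: ennreal_mult_top)
qed

lemma matrix_inv_mult:
  assumes "Determinants.det (M :: real^'n^'n) \<noteq> 0"
  shows "M *v (matrix_inv M *v x) = x" "matrix_inv M *v (M *v x) = x"
proof -
  have "M ** matrix_inv M = Finite_Cartesian_Product.mat 1 \<and> matrix_inv M ** M = Finite_Cartesian_Product.mat 1"
    unfolding matrix_inv_def by (rule someI_ex) (use assms in \<open>simp add: invertible_det_nz[symmetric] invertible_def\<close>)
  then show "M *v (matrix_inv M *v x) = x" "matrix_inv M *v (M *v x) = x"
    by (simp_all add: matrix_vector_mul_assoc)
qed

lemma det_matrix_inv: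
  assumes "Determinants.det (M :: real^'n^'n) \<noteq> 0"
  shows "Determinants.det M * Determinants.det (matrix_inv M) = 1"
proof -
  have "M ** matrix_inv M = Finite_Cartesian_Product.mat 1"
    by (simp add: matrix_eq matrix_inv_mult[OF assms] flip: matrix_vector_mul_assoc)
  then show ?thesis by (simp flip: det_mul)
qed

text \<open>An equality of measures lets nonnegative, real and complex integrals, and integrability
  itself, all be transformed by the same identity.\<close>

lemma
  fixes A :: "real^'n^'n" and t :: "real^'n"
  assumes A: "Determinants.det A \<noteq> 0"
  shows measurable_lebesgue_affine: "(\<lambda>x. A *v x + t) \<in> lebesgue \<rightarrow>\<^sub>M lebesgue"
    and lebesgue_eq_density_distr_affine:
      "lebesgue = density (distr lebesgue lebesgue (\<lambda>x. A *v x + t)) (\<lambda>_. ennreal \<bar>Determinants.det A\<bar>)"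
proof -
  let ?T = "\<lambda>x. A *v x + t"
  define g where "g y = matrix_inv A *v y" for y
  have lin: "linear g" unfolding g_def by simp
  have gA: "g (A *v x) = x" "A *v g x = x" for x
    unfolding g_def by (simp_all add: matrix_inv_mult[OF A])
  have inj: "inj g" using gA(2) by (metis injI)
  \<comment> \<open>Preimages under the affine map are rewritten as images under its linear inverse,
    to which the determinant formula for images applies.\<close>
  have vim: "?T -` S = g ` (\<lambda>y. y - t) ` S" for S
  proof (intro Set.set_eqI iffI)
    fix x assume "x \<in> ?T -` S"
    then show "x \<in> g ` (\<lambda>y. y - t) ` S"
      using gA(1)[of x] by (auto simp: image_comp o_def intro!: image_eqI[of _ _ "A *v x + t"])
  qed (auto simp: gA)
  have tr: "(\<lambda>y. y - t) ` S = (+) (- t) ` S" for S by (auto intro!: image_cong)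
  have trm: "(\<lambda>y. y - t) ` S \<in> sets lebesgue" if "S \<in> sets lebesgue" for S
    using that by (simp only: tr lebesgue_sets_translation)
  have vm: "?T -` S \<in> sets lebesgue" if "S \<in> sets lebesgue" for S
    unfolding vim by (rule differentiable_image_in_sets_lebesgue[OF trm[OF that]])
      (use lin in \<open>auto intro: linear_imp_differentiable_on\<close>)
  then show m: "?T \<in> lebesgue \<rightarrow>\<^sub>M lebesgue"
    by (intro measurableI) auto
  have dets: "\<bar>Determinants.det A\<bar> * \<bar>Determinants.det (matrix g)\<bar> = 1"
    unfolding g_def using det_matrix_inv[OF A] by (simp flip: abs_mult)
  show "lebesgue = density (distr lebesgue lebesgue ?T) (\<lambda>_. ennreal \<bar>Determinants.det A\<bar>)"
  proof (rule measure_eqI)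
    fix S :: "(real^'n) set" assume S: "S \<in> sets lebesgue"
    have "emeasure (density (distr lebesgue lebesgue ?T) (\<lambda>_. ennreal \<bar>Determinants.det A\<bar>)) S
        = ennreal \<bar>Determinants.det A\<bar> * emeasure lebesgue (?T -` S)"
      using S m by (simp add: emeasure_density_const emeasure_distr del: emeasure_completion)
    also have "\<dots> = ennreal \<bar>Determinants.det A\<bar> * (ennreal \<bar>Determinants.det (matrix g)\<bar> * emeasure lebesgue ((\<lambda>y. y - t) ` S))"
      unfolding vim emeasure_linear_image[OF lin inj trm[OF S]] ..
    also have "\<dots> = emeasure lebesgue ((\<lambda>y. y - t) ` S)"
      by (simp add: dets mult.assoc[symmetric] ennreal_mult[symmetric] del: emeasure_completion)
    also have "\<dots> = emeasure lebesgue S"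
      using emeasure_lebesgue_affine[of 1 "- t" S] by (simp del: emeasure_completion)
    finally show "emeasure lebesgue S =
      emeasure (density (distr lebesgue lebesgue ?T) (\<lambda>_. ennreal \<bar>Determinants.det A\<bar>)) S" ..
  qed simp
qed

lemma lebesgue_measurable_affine:
  fixes A :: "real^'n^'n"
  assumes "Determinants.det A \<noteq> 0" "f \<in> borel_measurable lebesgue"
  shows "(\<lambda>x. f (A *v x + t)) \<in> borel_measurable lebesgue"
  using measurable_compose[OF measurable_lebesgue_affine[OF assms(1)] assms(2)] .

lemma
  fixes A :: "real^'n^'n" and f :: "real^'n \<Rightarrow> 'b :: {banach, second_countable_topology}"
  assumes A: "Determinants.det A \<noteq> 0" and f: "f \<in> borel_measurable lebesgue"
  shows lebesgue_integral_affine: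
      "integral\<^sup>L lebesgue f = \<bar>Determinants.det A\<bar> *\<^sub>R (\<integral>x. f (A *v x + t) \<partial>lebesgue)"
    and lebesgue_integrable_affine:
      "integrable lebesgue f \<longleftrightarrow> integrable lebesgue (\<lambda>x. f (A *v x + t))"
proof -
  note [measurable] = measurable_lebesgue_affine[OF A, of t] f
  have "integral\<^sup>L lebesgue f =
      integral\<^sup>L (density (distr lebesgue lebesgue (\<lambda>x. A *v x + t)) (\<lambda>_. ennreal \<bar>Determinants.det A\<bar>)) f"
    by (rule arg_cong[OF lebesgue_eq_density_distr_affine[OF A], where f = "\<lambda>M. integral\<^sup>L M f"])
  also have "\<dots> = \<bar>Determinants.det A\<bar> *\<^sub>R (\<integral>x. f (A *v x + t) \<partial>lebesgue)"
    by (subst integral_density) (auto simp: integral_distr)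
  finally show "integral\<^sup>L lebesgue f = \<bar>Determinants.det A\<bar> *\<^sub>R (\<integral>x. f (A *v x + t) \<partial>lebesgue)" .
  have "integrable lebesgue f \<longleftrightarrow>
      integrable (density (distr lebesgue lebesgue (\<lambda>x. A *v x + t)) (\<lambda>_. ennreal \<bar>Determinants.det A\<bar>)) f"
    by (rule arg_cong[OF lebesgue_eq_density_distr_affine[OF A], where f = "\<lambda>M. integrable M f"])
  also have "\<dots> \<longleftrightarrow> integrable lebesgue (\<lambda>x. f (A *v x + t))"
  proof (subst integrable_density)
    have "integrable lebesgue (\<lambda>x. f (A *v x + t))"
      if "integrable lebesgue (\<lambda>x. \<bar>Determinants.det A\<bar> *\<^sub>R f (A *v x + t))"
      using integrable_scaleR_right[OF that, of "inverse \<bar>Determinants.det A\<bar>"] A by simp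
    then show "integrable (distr lebesgue lebesgue (\<lambda>x. A *v x + t)) (\<lambda>x. \<bar>Determinants.det A\<bar> *\<^sub>R f x)
        \<longleftrightarrow> integrable lebesgue (\<lambda>x. f (A *v x + t))"
      by (auto simp: integrable_distr_eq)
  qed auto
  finally show "integrable lebesgue f \<longleftrightarrow> integrable lebesgue (\<lambda>x. f (A *v x + t))" .
qed

lemma nn_integral_lebesgue_translate:
  fixes t :: "real^'n"
  assumes f: "f \<in> borel_measurable lebesgue"
  shows "(\<integral>\<^sup>+x. f (x + t) \<partial>lebesgue) = (\<integral>\<^sup>+x. f x \<partial>lebesgue)"
proof -
  have 1: "Determinants.det (Finite_Cartesian_Product.mat 1 :: real^'n^'n) \<noteq> 0" by simp
  have m: "(\<lambda>x. x + t) \<in> lebesgue \<rightarrow>\<^sub>M lebesgue"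
    using measurable_lebesgue_affine[OF 1, of t] by simp
  have "lebesgue = distr lebesgue lebesgue (\<lambda>x. x + t)"
    using lebesgue_eq_density_distr_affine[OF 1, of t] by (simp add: density_1)
  then have "(\<integral>\<^sup>+x. f x \<partial>lebesgue) = (\<integral>\<^sup>+x. f x \<partial>distr lebesgue lebesgue (\<lambda>x. x + t))"
    by (rule arg_cong[where f = "\<lambda>M. nn_integral M f"])
  also have "\<dots> = (\<integral>\<^sup>+x. f (x + t) \<partial>lebesgue)"
    by (rule nn_integral_distr[OF m]) (use f in simp)
  finally show ?thesis ..
qed

lemma L2_affine:
  fixes A :: "real^'n^'n"
  assumes A: "Determinants.det A \<noteq> 0" and f: "f \<in> L2 lebesgue"
  shows "(\<lambda>x. f (A *v x + t)) \<in> L2 lebesgue"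
proof (rule L2I)
  show "(\<lambda>x. f (A *v x + t)) \<in> borel_measurable lebesgue"
    by (rule lebesgue_measurable_affine[OF A L2_measurable[OF f]])
  have "(\<lambda>x. (cmod (f x))\<^sup>2) \<in> borel_measurable lebesgue"
    using L2_measurable[OF f] by measurable
  from lebesgue_integrable_affine[OF A this, of t]
  show "integrable lebesgue (\<lambda>x. (cmod (f (A *v x + t)))\<^sup>2)"
    using L2_integrable[OF f] by simp
qed

lemma L2_inner_affine:
  fixes A :: "real^'n^'n"
  assumes A: "Determinants.det A \<noteq> 0" and f: "f \<in> L2 lebesgue" and g: "g \<in> L2 lebesgue"
  shows "L2_inner lebesgue (\<lambda>x. f (A *v x + t)) (\<lambda>x. g (A *v x + t))
    = L2_inner lebesgue f g / complex_of_real \<bar>Determinants.det A\<bar>"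
  using lebesgue_integral_affine[OF A, of "\<lambda>x. f x * cnj (g x)" t] A
    borel_measurable_integrable[OF L2_integrable_mult_cnj[OF f g]]
  by (simp add: L2_inner_def scaleR_conv_of_real)

lemma L2_norm_affine:
  fixes A :: "real^'n^'n"
  assumes A: "Determinants.det A \<noteq> 0" and f: "f \<in> L2 lebesgue"
  shows "L2_norm lebesgue (\<lambda>x. f (A *v x + t)) = L2_norm lebesgue f / sqrt \<bar>Determinants.det A\<bar>"
  using lebesgue_integral_affine[OF A, of "\<lambda>x. (cmod (f x))\<^sup>2" t] A
    borel_measurable_integrable[OF L2_integrable[OF f]]
  by (simp add: L2_norm_def flip: real_sqrt_divide)

section \<open>Periodic functions and Fourier series\<close>

lemma Zd_0 [simp]: "0 \<in> Zd"
  and Zd_add [intro]: "k \<in> Zd \<Longrightarrow> m \<in> Zd \<Longrightarrow> k + m \<in> Zd"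
  and Zd_diff [intro]: "k \<in> Zd \<Longrightarrow> m \<in> Zd \<Longrightarrow> k - m \<in> Zd"
  and Zd_minus [intro]: "k \<in> Zd \<Longrightarrow> - k \<in> Zd"
  and Zd_axis [simp]: "axis i 1 \<in> Zd"
  by (auto simp: Zd_def axis_def)

lemma Zd_inner: "k \<in> Zd \<Longrightarrow> m \<in> Zd \<Longrightarrow> k \<bullet> m \<in> \<int>"
  by (auto simp: Zd_def inner_vec_def intro!: Ints_sum)

lemma countable_Zd: "countable (Zd :: (real^'d) set)"
proof (rule countable_subset)
  show "(Zd :: (real^'d) set) \<subseteq> range (\<lambda>f :: 'd \<Rightarrow> int. \<chi> i. of_int (f i))"
  proof
    fix x :: "real^'d" assume "x \<in> Zd"
    then have "x = (\<chi> i. of_int \<lfloor>x $ i\<rfloor>)"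
      by (simp add: Zd_def Finite_Cartesian_Product.vec_eq_iff)
    then show "x \<in> range (\<lambda>f :: 'd \<Rightarrow> int. \<chi> i. of_int (f i))"
      by (rule range_eqI[where x = "\<lambda>i. \<lfloor>x $ i\<rfloor>"])
  qed
qed simp

section \<open>The unnormalised torus and its lattice tiling\<close>

definition torus :: "(real^'d) measure" where
  "torus = lebesgue_on (cbox 0 (\<chi> i. 2 * pi))"

lemma measurable_torus: "f \<in> borel_measurable lebesgue \<Longrightarrow> f \<in> borel_measurable torus"
  unfolding torus_def by (rule measurable_restrict_space1)

lemma finite_measure_torus: "finite_measure torus"
  unfolding torus_def by (rule finite_measure_lebesgue_on) simp

definition periodic :: "(real^'d \<Rightarrow> 'b) \<Rightarrow> bool" where
  "periodic w \<longleftrightarrow> (\<forall>\<xi>. \<forall>k\<in>Zd. w (\<xi> + (2 * pi) *\<^sub>R k) = w \<xi>)"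

text \<open>Half-open, so that every point has exactly one lattice translate inside; the closed cube
  carrying \<open>torus\<close> differs from it by a null set only.\<close>

definition fundamental_domain :: "(real^'d) set" where
  "fundamental_domain = {x. \<forall>i. 0 \<le> x $ i \<and> x $ i < 2 * pi}"

lemma fundamental_domain_unique: "\<exists>!k. k \<in> Zd \<and> y + (2 * pi) *\<^sub>R k \<in> fundamental_domain"
proof -
  \<comment> \<open>One coordinate at a time: the admissible integers form a half-open interval of
    length 1, so the floor function names the only one.\<close>
  have iff: "0 \<le> a + 2 * pi * b \<and> a + 2 * pi * b < 2 * pi \<longleftrightarrow> b = - of_int \<lfloor>a / (2 * pi)\<rfloor>"
    if b: "b \<in> \<int>" for a b :: real
  proof -
    obtain n where n: "b = of_int n" using b by (rule Ints_cases)
    have 1: "0 \<le> a + 2 * pi * b \<longleftrightarrow> - b \<le> a / (2 * pi)"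
      unfolding pos_le_divide_eq[OF mult_pos_pos[OF zero_less_numeral pi_gt_zero]]
      by (auto simp: algebra_simps)
    have 2: "a + 2 * pi * b < 2 * pi \<longleftrightarrow> a / (2 * pi) < - b + 1"
      unfolding pos_divide_less_eq[OF mult_pos_pos[OF zero_less_numeral pi_gt_zero]]
      by (simp add: algebra_simps)
    have "0 \<le> a + 2 * pi * b \<and> a + 2 * pi * b < 2 * pi \<longleftrightarrow> \<lfloor>a / (2 * pi)\<rfloor> = - n"
      unfolding floor_eq_iff 1 2 by (simp add: n)
    also have "\<dots> \<longleftrightarrow> b = - of_int \<lfloor>a / (2 * pi)\<rfloor>"
      unfolding n of_int_minus[symmetric] of_int_eq_iff by auto
    finally show ?thesis .
  qed
  show ?thesis
  proof (rule ex1I[of _ "\<chi> i. - of_int \<lfloor>y $ i / (2 * pi)\<rfloor>"])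
    show "(\<chi> i. - of_int \<lfloor>y $ i / (2 * pi)\<rfloor>) \<in> Zd \<and>
        y + (2 * pi) *\<^sub>R (\<chi> i. - of_int \<lfloor>y $ i / (2 * pi)\<rfloor>) \<in> fundamental_domain"
      using iff[of "- of_int \<lfloor>y $ i / (2 * pi)\<rfloor>" "y $ i" for i]
      by (simp add: Zd_def fundamental_domain_def)
    show "k = (\<chi> i. - of_int \<lfloor>y $ i / (2 * pi)\<rfloor>)"
      if "k \<in> Zd \<and> y + (2 * pi) *\<^sub>R k \<in> fundamental_domain" for k
      using that iff[of "k $ i" "y $ i" for i]
      by (simp add: Zd_def fundamental_domain_def Finite_Cartesian_Product.vec_eq_iff)
  qed
qed

lemma negligible_cube_diff: "negligible (cbox 0 (\<chi> i. 2 * pi) - fundamental_domain :: (real^'d) set)"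
proof (rule negligible_subset)
  show "negligible (\<Union>i. {x :: real^'d. x $ i = 2 * pi})"
    by (intro negligible_Union) (use negligible_standard_hyperplane[of "axis i 1 :: real^'d" "2 * pi" for i] in \<open>auto simp: inner_axis\<close>)
  show "cbox 0 (\<chi> i. 2 * pi) - fundamental_domain \<subseteq> (\<Union>i. {x :: real^'d. x $ i = 2 * pi})"
    by (clarsimp simp: fundamental_domain_def mem_box_cart) (metis less_le)
qed

lemma fundamental_domain_subset: "fundamental_domain \<subseteq> cbox 0 (\<chi> i. 2 * pi)"
  by (auto simp: fundamental_domain_def mem_box_cart less_imp_le)

lemma fundamental_domain_measurable [measurable]: "fundamental_domain \<in> sets lebesgue"
proof -
  have "fundamental_domain = cbox 0 (\<chi> i. 2 * pi) - (cbox 0 (\<chi> i. 2 * pi) - fundamental_domain)"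
    using fundamental_domain_subset by blast
  also have "\<dots> \<in> sets lebesgue"
    by (intro sets.Diff negligible_imp_sets[OF negligible_cube_diff]) auto
  finally show ?thesis .
qed

lemma nn_integral_torus:
  assumes "f \<in> borel_measurable lebesgue"
  shows "(\<integral>\<^sup>+x. f x \<partial>torus) = (\<integral>\<^sup>+x. f x * indicator fundamental_domain x \<partial>lebesgue)"
proof -
  have "AE x in lebesgue. x \<notin> cbox 0 (\<chi> i. 2 * pi) - fundamental_domain"
    by (rule AE_not_in) (use negligible_cube_diff in \<open>simp add: negligible_iff_null_sets\<close>)
  then have "AE x in lebesgue. f x * indicator (cbox 0 (\<chi> i. 2 * pi)) x = f x * indicator fundamental_domain x"
    by (rule eventually_mono) (use fundamental_domain_subset in \<open>auto split: split_indicator\<close>)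
  then show ?thesis
    unfolding torus_def by (subst nn_integral_restrict_space) (auto intro: nn_integral_cong_AE)
qed

lemma lebesgue_measurable_translate:
  fixes t :: "real^'d"
  assumes "f \<in> borel_measurable lebesgue"
  shows "(\<lambda>x. f (x + t)) \<in> borel_measurable lebesgue"
  using lebesgue_measurable_affine[of "Finite_Cartesian_Product.mat 1" f t] assms by simp

text \<open>Tile the translated fundamental domain by the lattice translates of the original one.\<close>

lemma nn_integral_torus_translate:
  fixes w :: "real^'d \<Rightarrow> ennreal"
  assumes w: "w \<in> borel_measurable lebesgue" and p: "periodic w"
  shows "(\<integral>\<^sup>+x. w (x + t) \<partial>torus) = (\<integral>\<^sup>+x. w x \<partial>torus)"
proof -
  let ?I = "indicator (fundamental_domain :: (real^'d) set) :: _ \<Rightarrow> ennreal"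
  have I: "(\<lambda>x. ?I (x + s)) \<in> borel_measurable lebesgue" for s
    by (rule lebesgue_measurable_translate) simp
  have I0: "?I \<in> borel_measurable lebesgue" by simp
  note m = w I I0 lebesgue_measurable_translate[OF w] borel_measurable_times_ennreal
  \<comment> \<open>This sum of indicators is a partition of unity. It is inserted as a factor 1
    before exchanging sum and integral, and collapsed again after the change of variables.\<close>
  have one: "(\<integral>\<^sup>+k. ?I (y + (2 * pi) *\<^sub>R k) \<partial>count_space Zd) = 1" for y
  proof -
    obtain k0 where k0: "{k \<in> Zd. y + (2 * pi) *\<^sub>R k \<in> fundamental_domain} = {k0}"
      using fundamental_domain_unique[of y] by blast
    then have "k0 \<in> Zd" by blast
    have "(\<integral>\<^sup>+k. ?I (y + (2 * pi) *\<^sub>R k) \<partial>count_space Zd) = (\<integral>\<^sup>+k. indicator {k0} k \<partial>count_space Zd)"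
      using k0 by (intro nn_integral_cong) (auto split: split_indicator)
    also have "\<dots> = 1"
      using \<open>k0 \<in> Zd\<close> by (subst nn_integral_indicator) auto
    finally show ?thesis .
  qed
  have wper: "w (x - (2 * pi) *\<^sub>R k) = w x" if "k \<in> Zd" for x k
    using p[unfolded periodic_def, rule_format, OF Zd_minus[OF that], of x] by simp
  have "(\<integral>\<^sup>+x. w (x + t) \<partial>torus) = (\<integral>\<^sup>+x. w (x + t) * ?I x \<partial>lebesgue)"
    by (rule nn_integral_torus) (rule m)
  also have "\<dots> = (\<integral>\<^sup>+x. w x * ?I (x + (- t)) \<partial>lebesgue)"
    using nn_integral_lebesgue_translate[OF borel_measurable_times_ennreal[OF w I[of "- t"]], of t] by simp
  also have "\<dots> = (\<integral>\<^sup>+x. (\<integral>\<^sup>+k. w x * ?I (x + (- t)) * ?I (x + (2 * pi) *\<^sub>R k) \<partial>count_space Zd) \<partial>lebesgue)"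
    by (subst nn_integral_cmult) (simp_all add: one)
  also have "\<dots> = (\<integral>\<^sup>+k. (\<integral>\<^sup>+x. w x * ?I (x + (- t)) * ?I (x + (2 * pi) *\<^sub>R k) \<partial>lebesgue) \<partial>count_space Zd)"
    by (rule nn_integral_count_space_nn_integral[OF countable_Zd]) (intro m)
  also have "\<dots> = (\<integral>\<^sup>+k. (\<integral>\<^sup>+x. w x * ?I x * ?I (x + ((2 * pi) *\<^sub>R (- k) - t)) \<partial>lebesgue) \<partial>count_space Zd)"
  \<comment> \<open>Translating by a period leaves \<open>w\<close> unchanged and moves the lattice
    vector onto the indicator of the translated cell, so the sum over \<open>k\<close> now tiles
    against the original cell.\<close>
  proof (rule nn_integral_cong)
    fix k :: "real^'d" assume k: "k \<in> space (count_space Zd)"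
    have "(\<integral>\<^sup>+x. w x * ?I (x + (- t)) * ?I (x + (2 * pi) *\<^sub>R k) \<partial>lebesgue)
        = (\<integral>\<^sup>+x. w (x + - ((2 * pi) *\<^sub>R k)) * ?I (x + - ((2 * pi) *\<^sub>R k) + (- t))
            * ?I (x + - ((2 * pi) *\<^sub>R k) + (2 * pi) *\<^sub>R k) \<partial>lebesgue)"
      by (rule nn_integral_lebesgue_translate[symmetric]) (intro m)
    also have "\<dots> = (\<integral>\<^sup>+x. w x * ?I x * ?I (x + ((2 * pi) *\<^sub>R (- k) - t)) \<partial>lebesgue)"
      using wper k by (intro nn_integral_cong) (simp add: algebra_simps)
    finally show "(\<integral>\<^sup>+x. w x * ?I (x + (- t)) * ?I (x + (2 * pi) *\<^sub>R k) \<partial>lebesgue)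
        = (\<integral>\<^sup>+x. w x * ?I x * ?I (x + ((2 * pi) *\<^sub>R (- k) - t)) \<partial>lebesgue)" .
  qed
  also have "\<dots> = (\<integral>\<^sup>+k. (\<integral>\<^sup>+x. w x * ?I x * ?I (x + ((2 * pi) *\<^sub>R k - t)) \<partial>lebesgue) \<partial>count_space Zd)"
    by (rule nn_integral_bij_count_space) (auto simp: bij_betw_def inj_on_def image_iff Zd_minus intro!: bexI[of _ "- x" for x])
  also have "\<dots> = (\<integral>\<^sup>+x. (\<integral>\<^sup>+k. w x * ?I x * ?I (x + ((2 * pi) *\<^sub>R k - t)) \<partial>count_space Zd) \<partial>lebesgue)"
    by (rule nn_integral_count_space_nn_integral[OF countable_Zd, symmetric]) (intro m)
  also have "\<dots> = (\<integral>\<^sup>+x. w x * ?I x \<partial>lebesgue)"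
    using one[of "x - t" for x] by (subst nn_integral_cmult) (simp_all add: algebra_simps)
  also have "\<dots> = (\<integral>\<^sup>+x. w x \<partial>torus)"
    by (rule nn_integral_torus[symmetric, OF w])
  finally show ?thesis .
qed

lemma L2_torus_translate:
  fixes w :: "real^'d \<Rightarrow> complex"
  assumes w: "w \<in> borel_measurable lebesgue" and p: "periodic w"
  shows "L2_norm torus (\<lambda>x. w (x + t)) = L2_norm torus w"
    and "w \<in> L2 torus \<Longrightarrow> (\<lambda>x. w (x + t)) \<in> L2 torus"
proof -
  let ?v = "\<lambda>x. ennreal ((cmod (w x))\<^sup>2)"
  have eq: "(\<integral>\<^sup>+x. ?v (x + t) \<partial>torus) = (\<integral>\<^sup>+x. ?v x \<partial>torus)"
    by (rule nn_integral_torus_translate) (use w p in \<open>auto simp: periodic_def\<close>)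
  have m: "w \<in> borel_measurable torus" "(\<lambda>x. w (x + t)) \<in> borel_measurable torus"
    using w lebesgue_measurable_translate[OF w] by (auto intro: measurable_torus)
  note [measurable] = m
  have int: "(\<integral>x. (cmod (v x))\<^sup>2 \<partial>torus) = enn2real (\<integral>\<^sup>+x. ennreal ((cmod (v x))\<^sup>2) \<partial>torus)"
    if [measurable]: "v \<in> borel_measurable torus" for v :: "real^'d \<Rightarrow> complex"
    by (rule integral_eq_nn_integral) auto
  show "L2_norm torus (\<lambda>x. w (x + t)) = L2_norm torus w"
    unfolding L2_norm_def int[OF m(1)] int[OF m(2)] eq ..
  show "(\<lambda>x. w (x + t)) \<in> L2 torus" if "w \<in> L2 torus"
    using that m eq by (auto simp: L2_def integrable_iff_bounded)
qed

section \<open>Characters, orthogonality and Parseval's identity\<close>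

definition character :: "real^'d \<Rightarrow> real^'d \<Rightarrow> complex" where
  "character k \<xi> = exp (- \<i> * complex_of_real (\<xi> \<bullet> k))"

lemma character_0 [simp]: "character 0 \<xi> = 1"
  and character_add: "character (k + m) \<xi> = character k \<xi> * character m \<xi>"
  and character_shift: "character k (\<xi> + t) = character k \<xi> * character k t"
  and cmod_character [simp]: "cmod (character k \<xi>) = 1"
  and character_scaleR: "character k (c *\<^sub>R t) = exp (- \<i> * complex_of_real (c * (t \<bullet> k)))"
  by (simp_all add: character_def inner_add_right inner_add_left exp_add[symmetric] algebra_simps)

text \<open>\<open>t\<close> need not be a lattice vector: besides periods, the result has to handle
  the digit shifts, where \<open>t\<close> is the image of a lattice vector under the inverse of
  \<open>B\<close>.\<close>

lemma character_eq_1_iff: "character k ((2 * pi) *\<^sub>R t) = 1 \<longleftrightarrow> t \<bullet> k \<in> \<int>"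
proof -
  have "character k ((2 * pi) *\<^sub>R t) = 1 \<longleftrightarrow> (\<exists>n::int. - (2 * pi * (t \<bullet> k)) = of_int (2 * n) * pi)"
    unfolding character_scaleR by (simp add: exp_eq_1)
  also have "\<dots> \<longleftrightarrow> t \<bullet> k \<in> \<int>"
  proof
    assume "\<exists>n::int. - (2 * pi * (t \<bullet> k)) = of_int (2 * n) * pi"
    then obtain n :: int where "- (2 * pi * (t \<bullet> k)) = of_int (2 * n) * pi"
      by blast
    then have "pi * (t \<bullet> k) = pi * of_int (- n)"
      by simp
    then have "t \<bullet> k = of_int (- n)"
      by (simp only: mult_cancel_left) simp
    then show "t \<bullet> k \<in> \<int>" by (simp only: Ints_of_int)
  next
    assume "t \<bullet> k \<in> \<int>"
    then obtain n :: int where "t \<bullet> k = of_int n" using Ints_cases by blast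
    then show "\<exists>n::int. - (2 * pi * (t \<bullet> k)) = of_int (2 * n) * pi"
      by (intro exI[of _ "- n"]) simp
  qed
  finally show ?thesis .
qed

lemma character_Zd: "k \<in> Zd \<Longrightarrow> m \<in> Zd \<Longrightarrow> character k ((2 * pi) *\<^sub>R m) = 1"
  by (simp add: character_eq_1_iff Zd_inner)

lemma periodic_character: "k \<in> Zd \<Longrightarrow> periodic (character k)"
  by (simp add: periodic_def character_shift character_Zd)

lemma continuous_character: "continuous_on S (character k)"
  unfolding character_def by (intro continuous_intros)

lemma borel_measurable_character [measurable]: "character k \<in> borel_measurable lebesgue"
  by (rule measurable_completion) (use continuous_character in \<open>auto intro: borel_measurable_continuous_onI\<close>)

lemma L2_torus_bounded:
  assumes "w \<in> borel_measurable torus" "\<And>\<xi>. cmod (w \<xi>) \<le> C"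
  shows "w \<in> L2 torus"
proof (rule L2I)
  note [measurable] = assms(1)
  show "integrable torus (\<lambda>x. (cmod (w x))\<^sup>2)"
  proof (rule finite_measure.integrable_const_bound)
    show "finite_measure (torus :: (real^'a) measure)" by (rule finite_measure_torus)
    show "AE x in torus. norm ((cmod (w x))\<^sup>2) \<le> C\<^sup>2"
      using assms(2) by (auto intro!: AE_I2 power_mono)
  qed simp
qed (fact assms(1))

lemma character_L2: "character k \<in> L2 torus"
  by (rule L2_torus_bounded[of _ 1]) (auto intro: measurable_torus)

lemma L2_norm_character: "L2_norm torus (character k) = L2_norm torus (\<lambda>_ :: real^'d. 1)"
  for k :: "real^'d"
  by (simp add: L2_norm_def)

lemma L2_norm_torus_1_pos: "0 < L2_norm (torus :: (real^'d) measure) (\<lambda>_. 1)"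
proof -
  let ?c = "\<chi> i. 2 * pi :: real^'d"
  have "measure (torus :: (real^'d) measure) (space torus) = measure lebesgue (cbox 0 ?c)"
    unfolding torus_def space_restrict_space by (subst measure_restrict_space) auto
  also have "\<dots> > 0"
    by (subst measure_completion) (auto simp: content_cbox_cart interval_ne_empty_cart less_imp_le)
  finally have "measure (torus :: (real^'d) measure) (space torus) > 0" .
  then show ?thesis by (simp add: L2_norm_def)
qed

text \<open>Shift by \<open>t\<close> with \<open>\<langle>t, k - m\<rangle> = \<pi>\<close> and compare norms.\<close>

lemma character_orthogonal:
  fixes k m :: "real^'d"
  assumes k: "k \<in> Zd" and m: "m \<in> Zd" and neq: "k \<noteq> m"
  shows "L2_inner torus (character k) (character m) = 0"
proof -
  obtain i where i: "k $ i \<noteq> m $ i" using neq by (auto simp: Finite_Cartesian_Product.vec_eq_iff)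
  define t :: "real^'d" where "t = (pi / (m $ i - k $ i)) *\<^sub>R axis i 1"
  have "t \<bullet> (m - k) = pi"
    using i by (simp add: t_def inner_axis')
  then have t: "character (m - k) t = - 1"
    by (simp add: character_def exp_minus)
  \<comment> \<open>The shift turns \<open>e c\<close> into \<open>e (- c)\<close> up to a factor of
    modulus 1, so both have the same norm and the cross term, which is odd in \<open>c\<close>,
    vanishes. The values 1 and \<open>\<i>\<close> of \<open>c\<close> then isolate the real and the
    imaginary part.\<close>
  have "Re (cnj c * L2_inner torus (character k) (character m)) = 0" for c
  proof -
    define e :: "complex \<Rightarrow> real^'d \<Rightarrow> complex" where "e c = (\<lambda>\<xi>. character k \<xi> + c * character m \<xi>)" for c
    have [measurable]: "e c \<in> borel_measurable lebesgue" for c unfolding e_def by measurable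
    have per: "periodic (e c)" for c
      using periodic_character[OF k] periodic_character[OF m] by (simp add: e_def periodic_def)
    have norm: "complex_of_real ((L2_norm torus (e c))\<^sup>2) = complex_of_real ((L2_norm torus (character k))\<^sup>2)
      + complex_of_real ((L2_norm torus (\<lambda>\<xi>. c * character m \<xi>))\<^sup>2)
      + (cnj c * L2_inner torus (character k) (character m) + c * L2_inner torus (character m) (character k))" for c
      unfolding L2_inner_self[symmetric] e_def
      by (simp add: L2_inner_add_left L2_inner_add_right L2_add L2_cmult character_L2
          L2_inner_cmult_left L2_inner_cmult_right algebra_simps)
    have "e c (\<xi> + t) = character k t * e (- c) \<xi>" for \<xi>
      using t character_add[of "m - k" k t] by (simp add: e_def character_shift algebra_simps)
    then have "L2_norm torus (e c) = L2_norm torus (\<lambda>\<xi>. character k t * e (- c) \<xi>)"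
      using L2_torus_translate(1)[OF _ per, of c t] by simp
    then have e: "L2_norm torus (e (- c)) = L2_norm torus (e c)"
      by (simp add: L2_norm_cmult)
    define Z where "Z = cnj c * L2_inner torus (character k) (character m) + c * L2_inner torus (character m) (character k)"
    have "L2_norm torus (\<lambda>\<xi>. - c * character m \<xi>) = L2_norm torus (\<lambda>\<xi>. c * character m \<xi>)"
      unfolding L2_norm_cmult by simp
    with norm[of c] norm[of "- c", unfolded e] have "Z = - Z"
      by (simp add: Z_def)
    then have "cnj c * L2_inner torus (character k) (character m) + c * L2_inner torus (character m) (character k) = 0"
      unfolding Z_def[symmetric] by (simp add: eq_neg_iff_add_eq_0)
    moreover have "L2_inner torus (character m) (character k) = cnj (L2_inner torus (character k) (character m))"
      by (rule L2_inner_commute)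
    ultimately have "cnj c * L2_inner torus (character k) (character m) + cnj (cnj c * L2_inner torus (character k) (character m)) = 0"
      by simp
    then show ?thesis by (simp only: complex_add_cnj of_real_eq_0_iff)
  qed
  from this[of 1] this[of \<i>] show ?thesis
    by (simp add: complex_eq_iff)
qed

text \<open>The frequencies are given through an injective \<open>\<kappa>\<close> because the
  result is also applied to \<open>X\<close>, whose terms are indexed by pairs and whose frequencies
  are negated second components. The norm of the constant 1 stands for the missing normalisation of
  the torus.\<close>

lemma L2_norm_character_sum:
  fixes \<kappa> :: "'i \<Rightarrow> real^'d"
  assumes F: "finite F" and inj: "inj_on \<kappa> F" and Zd: "\<kappa> ` F \<subseteq> Zd"
  shows "(L2_norm torus (\<lambda>\<xi>. \<Sum>i\<in>F. d i * character (\<kappa> i) \<xi>))\<^sup>2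
    = (L2_norm (torus :: (real^'d) measure) (\<lambda>_. 1))\<^sup>2 * (\<Sum>i\<in>F. (cmod (d i))\<^sup>2)"
proof -
  let ?N = "L2_norm (torus :: (real^'d) measure) (\<lambda>_. 1)"
  let ?S = "\<lambda>\<xi>. \<Sum>i\<in>F. d i * character (\<kappa> i) \<xi>"
  have SL: "?S \<in> L2 torus"
    by (intro L2_sum L2_cmult character_L2)
  have orth: "L2_inner torus (character (\<kappa> i)) (character (\<kappa> j)) = (if j = i then complex_of_real (?N\<^sup>2) else 0)"
    if "i \<in> F" "j \<in> F" for i j
    using that Zd inj_onD[OF inj, of i j]
    by (auto simp: L2_inner_self L2_norm_character image_subset_iff simp del: of_real_power intro!: character_orthogonal)
  have "complex_of_real ((L2_norm torus ?S)\<^sup>2)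
      = (\<Sum>i\<in>F. \<Sum>j\<in>F. d i * cnj (d j) * L2_inner torus (character (\<kappa> i)) (character (\<kappa> j)))"
    unfolding L2_inner_self[symmetric]
    by (simp add: L2_inner_sum_left L2_inner_sum_right SL L2_cmult character_L2 L2_inner_cmult_left L2_inner_cmult_right
        sum_distrib_left mult.assoc)
  also have "\<dots> = (\<Sum>i\<in>F. \<Sum>j\<in>F. if j = i then complex_of_real ((cmod (d i))\<^sup>2 * ?N\<^sup>2) else 0)"
    by (intro sum.cong refl) (auto simp: orth complex_norm_square simp del: of_real_power)
  also have "\<dots> = complex_of_real (?N\<^sup>2 * (\<Sum>i\<in>F. (cmod (d i))\<^sup>2))"
    using F by (simp add: sum_distrib_right mult.commute[of "(complex_of_real ?N)\<^sup>2"])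
  finally show ?thesis by (simp only: of_real_eq_iff)
qed

text \<open>The norm is continuous along the net of finite partial sums, and on each of them the
  identity is Pythagoras.\<close>

lemma Parseval:
  fixes w :: "real^'d \<Rightarrow> complex"
  assumes s: "L2_has_sum torus (\<lambda>k \<xi>. d k * character k \<xi>) Zd w"
  shows "((\<lambda>k. (cmod (d k))\<^sup>2) has_sum (L2_norm torus w / L2_norm (torus :: (real^'d) measure) (\<lambda>_. 1))\<^sup>2) Zd"
proof -
  let ?N = "L2_norm (torus :: (real^'d) measure) (\<lambda>_. 1)"
  let ?S = "\<lambda>F \<xi>. \<Sum>k\<in>F. d k * character k \<xi>"
  have SL: "?S F \<in> L2 torus" for F
    by (intro L2_sum L2_cmult character_L2)
  have nS: "(L2_norm torus (?S F))\<^sup>2 = ?N\<^sup>2 * (\<Sum>k\<in>F. (cmod (d k))\<^sup>2)" if F: "finite F" "F \<subseteq> Zd" for F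
    using L2_norm_character_sum[of F "\<lambda>k. k" d] F by simp
  have "((\<lambda>F. L2_norm torus (?S F)) \<longlongrightarrow> L2_norm torus w) (finite_subsets_at_top Zd)"
  proof (rule Lim_transform2[OF tendsto_const])
    show "((\<lambda>F. L2_norm torus w - L2_norm torus (?S F)) \<longlongrightarrow> 0) (finite_subsets_at_top Zd)"
    proof (rule tendsto_norm_zero_cancel, rule tendsto_sandwich[OF _ _ tendsto_const L2_has_sumD(3)[OF s]])
      have "norm (L2_norm torus w - L2_norm torus (?S F)) \<le> L2_norm torus (\<lambda>\<xi>. w \<xi> - ?S F \<xi>)" for F
        using L2_norm_triangle_diff[OF L2_has_sumD(1)[OF s] SL[of F]]
          L2_norm_triangle_diff[OF SL[of F] L2_has_sumD(1)[OF s]] L2_norm_minus_commute[of torus w "?S F"]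
        by (simp add: abs_le_iff)
      then show "\<forall>\<^sub>F F in finite_subsets_at_top Zd. norm (L2_norm torus w - L2_norm torus (?S F))
          \<le> L2_norm torus (\<lambda>\<xi>. w \<xi> - ?S F \<xi>)" by simp
    qed simp
  qed
  then have "((\<lambda>F. (L2_norm torus (?S F) / ?N)\<^sup>2) \<longlongrightarrow> (L2_norm torus w / ?N)\<^sup>2) (finite_subsets_at_top Zd)"
    using L2_norm_torus_1_pos[where 'd = 'd] by (intro tendsto_intros) auto
  then show ?thesis
    unfolding has_sum_def
  proof (rule Lim_transform_eventually)
    show "\<forall>\<^sub>F F in finite_subsets_at_top Zd. (L2_norm torus (?S F) / ?N)\<^sup>2 = (\<Sum>k\<in>F. (cmod (d k))\<^sup>2)"
      using nS L2_norm_torus_1_pos[where 'd = 'd]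
      by (intro eventually_finite_subsets_at_top_weakI) (simp add: power_divide)
  qed
qed

section \<open>Rayleigh quotients\<close>

lemma index_mult_mat_vec_sum:
  assumes "A \<in> carrier_mat n n" "w \<in> carrier_vec n" "i < n"
  shows "vec_index (A *\<^sub>v w) i = (\<Sum>j<n. A $$ (i, j) * vec_index w j)"
  using assms by (simp add: scalar_prod_def atLeast0LessThan)

text \<open>The squared norms \<open>a k = \<parallel>N\<^sup>k v\<parallel>\<^sup>2\<close> are log-convex for Hermitian \<open>N\<close>, so
  \<open>a 1 > a 0\<close> would make them unbounded, which is impossible if the spectral radius is below 1.\<close>

lemma hermitian_norm_le:
  fixes N :: "complex mat" and v :: "nat \<Rightarrow> complex"
  assumes N: "N \<in> carrier_mat n n"
    and herm: "\<And>i j. i < n \<Longrightarrow> j < n \<Longrightarrow> N $$ (i, j) = cnj (N $$ (j, i))"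
    and ev: "\<And>z. eigenvalue N z \<Longrightarrow> cmod z < 1"
  shows "(\<Sum>i<n. (cmod (\<Sum>j<n. N $$ (i, j) * v j))\<^sup>2) \<le> (\<Sum>i<n. (cmod (v i))\<^sup>2)"
proof (cases "n = 0")
  case False
  have sr: "spectral_radius N < 1"
    using spectral_radius_mem_max(1)[OF N] False ev by (auto simp: spectrum_def)
  \<comment> \<open>The Jordan form bounds all powers entrywise by one constant once the spectral
    radius is below 1. This is what excludes geometric growth below.\<close>
  obtain c where c: "norm_bound (N ^\<^sub>m k) c" for k
    using spectral_radius_jnf_norm_bound_less_1_upper_triangular[OF N sr] by blast
  define f where "f k i = (\<Sum>j<n. (N ^\<^sub>m k) $$ (i, j) * v j)" for k i
  have f0: "f 0 i = v i" if "i < n" for i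
  proof -
    have "f 0 i = (\<Sum>j<n. if j = i then v i else 0)"
      unfolding f_def using N that by (intro sum.cong) auto
    then show ?thesis using that by simp
  qed
  have fS: "f (Suc k) i = (\<Sum>j<n. N $$ (i, j) * f k j)" if "i < n" for k i
  proof -
    have Nk: "N ^\<^sub>m k \<in> carrier_mat n n" using N by (rule pow_carrier_mat)
    \<comment> \<open>Matrix powers acquire their new factor on the right, whereas the recursion for
      \<open>f\<close> needs it on the left.\<close>
    have "N ^\<^sub>m Suc k = N * N ^\<^sub>m k"
    proof (induction k)
      case (Suc k)
      have "N ^\<^sub>m Suc (Suc k) = N * N ^\<^sub>m k * N"
        using Suc by simp
      also have "\<dots> = N * (N ^\<^sub>m k * N)"
        by (rule assoc_mult_mat[OF N pow_carrier_mat[OF N] N])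
      finally show ?case by simp
    qed (use N in simp)
    then have "(N ^\<^sub>m Suc k) $$ (i, j) = (\<Sum>l<n. N $$ (i, l) * (N ^\<^sub>m k) $$ (l, j))" if "j < n" for j
      using N Nk that \<open>i < n\<close> by (simp add: scalar_prod_def atLeast0LessThan)
    then have "f (Suc k) i = (\<Sum>j<n. \<Sum>l<n. N $$ (i, l) * (N ^\<^sub>m k) $$ (l, j) * v j)"
      by (simp add: f_def sum_distrib_right)
    also have "\<dots> = (\<Sum>l<n. \<Sum>j<n. N $$ (i, l) * (N ^\<^sub>m k) $$ (l, j) * v j)"
      by (rule sum.swap)
    finally show ?thesis by (simp add: f_def sum_distrib_left mult.assoc)
  qed
  define S where "S k l = (\<Sum>i<n. f k i * cnj (f l i))" for k l
  define a where "a k = (\<Sum>i<n. (cmod (f k i))\<^sup>2)" for k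
  have a_nonneg: "0 \<le> a k" for k unfolding a_def by (intro sum_nonneg) auto
  have Saa: "S k k = complex_of_real (a k)" for k
    by (simp only: S_def a_def of_real_sum complex_norm_square)
  \<comment> \<open>Hermitian symmetry moves one factor \<open>N\<close> to the other slot. Hence
    \<open>a (Suc k)\<close> is also the inner product of the vectors with indices
    \<open>k + 2\<close> and \<open>k\<close>, and Cauchy-Schwarz yields log-convexity.\<close>
  have shift: "S (Suc k) l = S k (Suc l)" for k l
  proof -
    have "S (Suc k) l = (\<Sum>i<n. \<Sum>j<n. N $$ (i, j) * f k j * cnj (f l i))"
      by (simp add: S_def fS sum_distrib_right)
    also have "\<dots> = (\<Sum>j<n. \<Sum>i<n. N $$ (i, j) * f k j * cnj (f l i))"
      by (rule sum.swap)
    also have "\<dots> = (\<Sum>j<n. \<Sum>i<n. f k j * cnj (N $$ (j, i) * f l i))"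
      by (intro sum.cong refl) (subst herm, auto simp: mult_ac)
    finally show ?thesis by (simp add: S_def fS sum_distrib_left)
  qed
  have cs: "(cmod (S k l))\<^sup>2 \<le> a k * a l" for k l
  proof -
    have "cmod (S k l) \<le> (\<Sum>i<n. cmod (f k i) * cmod (f l i))"
      unfolding S_def by (rule order_trans[OF norm_sum]) (simp add: norm_mult)
    then have "(cmod (S k l))\<^sup>2 \<le> (\<Sum>i<n. cmod (f k i) * cmod (f l i))\<^sup>2"
      by (rule power_mono) simp
    also have "\<dots> \<le> a k * a l"
      unfolding a_def by (rule Cauchy_Schwarz_ineq_sum)
    finally show ?thesis .
  qed
  have logconvex: "a (Suc k) * a (Suc k) \<le> a (Suc (Suc k)) * a k" for k
    using cs[of "Suc (Suc k)" k] by (simp add: shift[of "Suc k" k] Saa power2_eq_square)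
  have "a 1 \<le> a 0"
  proof (rule ccontr)
    assume "\<not> a 1 \<le> a 0"
    then have gt: "a 0 < a 1" by simp
    have a0: "0 < a 0"
    proof (rule ccontr)
      assume "\<not> 0 < a 0"
      then have "a 0 = 0" using a_nonneg[of 0] by simp
      then have "f 0 i = 0" if "i < n" for i
        using that unfolding a_def by (subst (asm) sum_nonneg_eq_0_iff) auto
      then have "a 1 = 0" by (simp add: a_def fS)
      with gt \<open>a 0 = 0\<close> show False by simp
    qed
    define q where "q = a 1 / a 0"
    have q: "q > 1" using gt a0 by (simp add: q_def)
    \<comment> \<open>By log-convexity the ratio of consecutive terms cannot fall below its initial
      value \<open>q\<close>.\<close>
    have step: "0 < a k \<and> q * a k \<le> a (Suc k)" for k
    proof (induction k)
      case 0
      then show ?case using a0 by (simp add: q_def)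
    next
      case (Suc k)
      have pos: "0 < a (Suc k)"
        using Suc q mult_pos_pos[of q "a k"] by linarith
      have "(q * a (Suc k)) * a k \<le> a (Suc k) * a (Suc k)"
        using mult_left_mono[of "q * a k" "a (Suc k)" "a (Suc k)"] Suc pos by (simp add: mult_ac)
      also have "\<dots> \<le> a (Suc (Suc k)) * a k" by (rule logconvex)
      finally show ?case using Suc pos by (simp add: mult_le_cancel_right)
    qed
    have growth: "q ^ k * a 0 \<le> a k" for k
    proof (induction k)
      case (Suc k)
      then have "q * (q ^ k * a 0) \<le> q * a k" using q by (intro mult_left_mono) auto
      then show ?case using step[of k] by (simp add: mult.assoc)
    qed simp
    have bdd: "a k \<le> (\<Sum>i<n. (\<Sum>j<n. c * cmod (v j))\<^sup>2)" for k
      unfolding a_def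
    proof (intro sum_mono power_mono)
      fix i assume i: "i \<in> {..<n}"
      have "cmod (f k i) \<le> (\<Sum>j<n. cmod ((N ^\<^sub>m k) $$ (i, j)) * cmod (v j))"
        unfolding f_def by (rule order_trans[OF norm_sum]) (simp add: norm_mult)
      also have "\<dots> \<le> (\<Sum>j<n. c * cmod (v j))"
        using c[of k] N i by (intro sum_mono mult_right_mono) (auto simp: norm_bound_def)
      finally show "cmod (f k i) \<le> (\<Sum>j<n. c * cmod (v j))" .
    qed simp
    obtain k where "(\<Sum>i<n. (\<Sum>j<n. c * cmod (v j))\<^sup>2) / a 0 < q ^ k"
      using real_arch_pow[OF q] by blast
    then show False
      using growth[of k] bdd[of k] a0 by (simp add: pos_divide_less_eq)
  qed
  then show ?thesis by (simp add: a_def fS f0)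
qed simp

text \<open>Scaling by \<open>1 / t\<close> with \<open>t > \<rho>\<close> makes every eigenvalue
  strictly smaller than 1 in modulus, so that \<open>hermitian_norm_le\<close> applies; then
  \<open>t\<close> decreases to \<open>\<rho>\<close>. Approaching from above also covers
  \<open>\<rho> = 0\<close>, where one could not scale by \<open>\<rho>\<close> itself.\<close>

lemma hermitian_form_le:
  fixes N :: "complex mat" and v :: "nat \<Rightarrow> complex"
  assumes N: "N \<in> carrier_mat n n"
    and herm: "\<And>i j. i < n \<Longrightarrow> j < n \<Longrightarrow> N $$ (i, j) = cnj (N $$ (j, i))"
    and ev: "\<And>z. eigenvalue N z \<Longrightarrow> cmod z \<le> \<rho>" and \<rho>: "0 \<le> \<rho>"
  shows "cmod (\<Sum>i<n. (\<Sum>j<n. N $$ (i, j) * v j) * cnj (v i)) \<le> \<rho> * (\<Sum>i<n. (cmod (v i))\<^sup>2)"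
proof -
  define V where "V = (\<Sum>i<n. (cmod (v i))\<^sup>2)"
  define W where "W = (\<Sum>i<n. (cmod (\<Sum>j<n. N $$ (i, j) * v j))\<^sup>2)"
  have V: "0 \<le> V" unfolding V_def by (intro sum_nonneg) auto
  have bound: "W \<le> t\<^sup>2 * V" if t: "t > \<rho>" for t
  proof -
    have t0: "t > 0" using t \<rho> by simp
    let ?N = "complex_of_real (1 / t) \<cdot>\<^sub>m N"
    have "(\<Sum>i<n. (cmod (\<Sum>j<n. ?N $$ (i, j) * v j))\<^sup>2) \<le> V"
      unfolding V_def
    proof (rule hermitian_norm_le)
      show "?N \<in> carrier_mat n n" using N by simp
      show "?N $$ (i, j) = cnj (?N $$ (j, i))" if "i < n" "j < n" for i j
        using that N herm[OF that] by simp
      fix z assume "eigenvalue ?N z"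
      then obtain w where w: "w \<in> carrier_vec n" "w \<noteq> 0\<^sub>v n" "?N *\<^sub>v w = z \<cdot>\<^sub>v w"
        using N by (auto simp: eigenvalue_def eigenvector_def)
      have "N *\<^sub>v w = complex_of_real t \<cdot>\<^sub>v (?N *\<^sub>v w)"
        using N w(1) t0 by (intro eq_vecI) (auto simp: scalar_prod_def sum_distrib_left)
      then have "N *\<^sub>v w = (complex_of_real t * z) \<cdot>\<^sub>v w"
        using w(3) by (simp add: smult_smult_assoc)
      then have "eigenvalue N (complex_of_real t * z)"
        using N w by (auto simp: eigenvalue_def eigenvector_def)
      from ev[OF this] have "t * cmod z \<le> \<rho>" using t0 by (simp add: norm_mult)
      then have "t * cmod z < t * 1" using t by simp
      then show "cmod z < 1" using t0 by (simp only: mult_less_cancel_left_pos)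
    qed
    moreover have "(\<Sum>i<n. (cmod (\<Sum>j<n. ?N $$ (i, j) * v j))\<^sup>2) = W / t\<^sup>2"
    proof -
      have "(cmod (\<Sum>j<n. ?N $$ (i, j) * v j))\<^sup>2 = (cmod (\<Sum>j<n. N $$ (i, j) * v j))\<^sup>2 / t\<^sup>2" if "i < n" for i
      proof -
        have "(\<Sum>j<n. ?N $$ (i, j) * v j) = complex_of_real (1 / t) * (\<Sum>j<n. N $$ (i, j) * v j)"
          unfolding sum_distrib_left using N that by (intro sum.cong) auto
        then show ?thesis
          using t0 by (simp only: norm_mult norm_of_real power_mult_distrib) (simp add: power_divide)
      qed
      then show ?thesis
        unfolding W_def sum_divide_distrib by (intro sum.cong) auto
    qed
    ultimately show ?thesis using t0 by (simp add: pos_divide_le_eq mult.commute)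
  qed
  have "W \<le> \<rho>\<^sup>2 * V"
  proof (rule tendsto_lowerbound)
    show "((\<lambda>t. t\<^sup>2 * V) \<longlongrightarrow> \<rho>\<^sup>2 * V) (at_right \<rho>)"
      by (intro tendsto_intros)
    show "\<forall>\<^sub>F t in at_right \<rho>. W \<le> t\<^sup>2 * V"
      using eventually_at_right_less[of \<rho>] by (rule eventually_mono) (rule bound)
  qed simp
  have "cmod (\<Sum>i<n. (\<Sum>j<n. N $$ (i, j) * v j) * cnj (v i)) \<le> (\<Sum>i<n. cmod (\<Sum>j<n. N $$ (i, j) * v j) * cmod (v i))"
    by (rule order_trans[OF norm_sum]) (simp add: norm_mult)
  then have "(cmod (\<Sum>i<n. (\<Sum>j<n. N $$ (i, j) * v j) * cnj (v i)))\<^sup>2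
      \<le> (\<Sum>i<n. cmod (\<Sum>j<n. N $$ (i, j) * v j) * cmod (v i))\<^sup>2"
    by (rule power_mono) simp
  also have "\<dots> \<le> W * V"
    unfolding W_def V_def by (rule Cauchy_Schwarz_ineq_sum)
  also have "\<dots> \<le> (\<rho> * V)\<^sup>2"
    using mult_right_mono[OF \<open>W \<le> \<rho>\<^sup>2 * V\<close> V] by (simp add: power2_eq_square mult_ac)
  finally show ?thesis
    unfolding V_def[symmetric] by (rule power2_le_imp_le) (use \<rho> V in simp)
qed

lemma mat_adjoint_mult_self:
  fixes H :: "complex mat"
  assumes H: "H \<in> carrier_mat n n"
  shows "mat_adjoint H * H \<in> carrier_mat n n"
    and "i < n \<Longrightarrow> j < n \<Longrightarrow> (mat_adjoint H * H) $$ (i, j) = (\<Sum>k<n. cnj (H $$ (k, i)) * H $$ (k, j))"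
proof -
  have A: "mat_adjoint H \<in> carrier_mat n n"
    using H by (auto simp: mat_adjoint_def)
  then show "mat_adjoint H * H \<in> carrier_mat n n" using H by simp
  show "(mat_adjoint H * H) $$ (i, j) = (\<Sum>k<n. cnj (H $$ (k, i)) * H $$ (k, j))" if "i < n" "j < n"
    using that H A by (simp add: scalar_prod_def atLeast0LessThan mat_adjoint_def)
qed

lemma adjoint_form:
  fixes H :: "complex mat" and v :: "nat \<Rightarrow> complex"
  assumes H: "H \<in> carrier_mat n n"
  shows "(\<Sum>i<n. (\<Sum>j<n. (mat_adjoint H * H) $$ (i, j) * v j) * cnj (v i))
    = complex_of_real (\<Sum>k<n. (cmod (\<Sum>j<n. H $$ (k, j) * v j))\<^sup>2)"
proof -
  have "(\<Sum>i<n. (\<Sum>j<n. (mat_adjoint H * H) $$ (i, j) * v j) * cnj (v i))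
      = (\<Sum>i<n. \<Sum>k<n. \<Sum>j<n. H $$ (k, j) * v j * cnj (H $$ (k, i) * v i))"
    by (simp add: mat_adjoint_mult_self[OF H] sum_distrib_right sum_distrib_left mult_ac)
      (intro sum.cong refl sum.swap)
  also have "\<dots> = (\<Sum>k<n. \<Sum>i<n. \<Sum>j<n. H $$ (k, j) * v j * cnj (H $$ (k, i) * v i))"
    by (rule sum.swap)
  also have "\<dots> = (\<Sum>k<n. (\<Sum>j<n. H $$ (k, j) * v j) * cnj (\<Sum>i<n. H $$ (k, i) * v i))"
    by (simp add: sum_distrib_left sum_distrib_right)
  finally show ?thesis by (simp only: of_real_sum complex_norm_square)
qed

text \<open>By \<open>adjoint_form\<close> an eigenvalue is the quotient of the squared norms of the
  image under \<open>H\<close> and of the eigenvector, hence real and nonnegative.\<close>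

lemma eigenvalue_adjoint_mult_self:
  fixes H :: "complex mat"
  assumes H: "H \<in> carrier_mat n n" and z: "eigenvalue (mat_adjoint H * H) z"
  shows "Im z = 0" "0 \<le> Re z"
proof -
  let ?M = "mat_adjoint H * H"
  note M = mat_adjoint_mult_self(1)[OF H]
  obtain w where w: "w \<in> carrier_vec n" "w \<noteq> 0\<^sub>v n" "?M *\<^sub>v w = z \<cdot>\<^sub>v w"
    using z M by (auto simp: eigenvalue_def eigenvector_def)
  define V where "V = (\<Sum>i<n. (cmod (vec_index w i))\<^sup>2)"
  define R where "R = (\<Sum>k<n. (cmod (\<Sum>j<n. H $$ (k, j) * vec_index w j))\<^sup>2)"
  have "V \<noteq> 0"
  proof
    assume "V = 0"
    then have "vec_index w i = 0" if "i < n" for i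
      using that unfolding V_def by (subst (asm) sum_nonneg_eq_0_iff) auto
    then have "w = 0\<^sub>v n" using w(1) by (intro eq_vecI) auto
    with w(2) show False ..
  qed
  moreover have "0 \<le> V" unfolding V_def by (intro sum_nonneg) auto
  ultimately have V: "0 < V" by simp
  have "(\<Sum>j<n. ?M $$ (i, j) * vec_index w j) = z * vec_index w i" if "i < n" for i
    using arg_cong[OF w(3), of "\<lambda>x. vec_index x i"] that w(1) M
    by (simp add: scalar_prod_def atLeast0LessThan del: index_mult_mat)
  then have "complex_of_real R = (\<Sum>i<n. z * vec_index w i * cnj (vec_index w i))"
    unfolding R_def adjoint_form[OF H, symmetric] by simp
  also have "\<dots> = z * complex_of_real V"
    by (simp only: V_def of_real_sum complex_norm_square sum_distrib_left mult.assoc)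
  finally have "z = complex_of_real (R / V)" using V by (simp add: field_simps)
  moreover have "0 \<le> R" unfolding R_def by (intro sum_nonneg) auto
  ultimately show "Im z = 0" "0 \<le> Re z" using V by auto
qed

lemma
  fixes H :: "complex mat"
  assumes H: "H \<in> carrier_mat n n" and n: "n > 0"
  shows min_eigenvalue_nonneg: "0 \<le> min_eigenvalue H"
    and eigenvalue_bounds:
      "eigenvalue (mat_adjoint H * H) z \<Longrightarrow> min_eigenvalue H \<le> Re z \<and> Re z \<le> max_eigenvalue H"
    and min_le_max_eigenvalue: "min_eigenvalue H \<le> max_eigenvalue H"
proof -
  let ?E = "Re ` spectrum (mat_adjoint H * H)"
  note M = mat_adjoint_mult_self(1)[OF H]
  have fin: "finite ?E" using card_finite_spectrum(1)[OF M] by simp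
  have ne: "?E \<noteq> {}" using spectrum_non_empty[OF M n] by simp
  show "0 \<le> min_eigenvalue H"
    unfolding min_eigenvalue_def using fin ne eigenvalue_adjoint_mult_self(2)[OF H]
    by (auto simp: spectrum_def)
  show "min_eigenvalue H \<le> Re z \<and> Re z \<le> max_eigenvalue H" if "eigenvalue (mat_adjoint H * H) z"
    unfolding min_eigenvalue_def max_eigenvalue_def using fin that by (auto simp: spectrum_def)
  show "min_eigenvalue H \<le> max_eigenvalue H"
    unfolding min_eigenvalue_def max_eigenvalue_def using fin ne Min_in[OF fin ne] by auto
qed

text \<open>The eigenvalues of \<open>M\<close> are nonnegative, so the largest one bounds their
  moduli and \<open>hermitian_form_le\<close> gives the upper estimate. For the lower one the same
  lemma is applied to \<open>?m\<close> times the identity minus \<open>M\<close>, whose eigenvalues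
  lie between 0 and \<open>?m - ?\<mu>\<close>.\<close>

lemma
  fixes H :: "complex mat" and v :: "nat \<Rightarrow> complex"
  assumes H: "H \<in> carrier_mat n n" and n: "n > 0"
  shows max_eigenvalue_bound:
      "(\<Sum>p<n. (cmod (\<Sum>q<n. H $$ (p, q) * v q))\<^sup>2) \<le> max_eigenvalue H * (\<Sum>q<n. (cmod (v q))\<^sup>2)"
    and min_eigenvalue_bound:
      "min_eigenvalue H * (\<Sum>q<n. (cmod (v q))\<^sup>2) \<le> (\<Sum>p<n. (cmod (\<Sum>q<n. H $$ (p, q) * v q))\<^sup>2)"
proof -
  define M where "M = mat_adjoint H * H"
  let ?\<mu> = "min_eigenvalue H" and ?m = "max_eigenvalue H"
  define R where "R = (\<Sum>k<n. (cmod (\<Sum>j<n. H $$ (k, j) * v j))\<^sup>2)"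
  define V where "V = (\<Sum>i<n. (cmod (v i))\<^sup>2)"
  note M = mat_adjoint_mult_self[OF H, folded M_def]
  note b = min_eigenvalue_nonneg[OF H n] eigenvalue_bounds[OF H n, folded M_def] min_le_max_eigenvalue[OF H n]
  have herm: "M $$ (i, j) = cnj (M $$ (j, i))" if "i < n" "j < n" for i j
    using that by (simp add: M(2) mult.commute)
  have cm: "cmod z = Re z" if "eigenvalue M z" for z
    using eigenvalue_adjoint_mult_self[OF H, folded M_def, OF that] by (simp add: cmod_eq_Re)
  have "cmod (complex_of_real R) \<le> ?m * V"
    unfolding R_def V_def adjoint_form[OF H, folded M_def, symmetric]
    by (rule hermitian_form_le[OF M(1) herm]) (use b cm in auto)
  then have upper: "R \<le> ?m * V" by simp
  let ?N = "complex_of_real ?m \<cdot>\<^sub>m 1\<^sub>m n - M"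
  have N: "?N \<in> carrier_mat n n" by (rule minus_carrier_mat[OF M(1)])
  have N_ij: "?N $$ (i, j) = (if i = j then complex_of_real ?m else 0) - M $$ (i, j)" if "i < n" "j < n" for i j
    using that M(1) by simp
  have "cmod (\<Sum>i<n. (\<Sum>j<n. ?N $$ (i, j) * v j) * cnj (v i)) \<le> (?m - ?\<mu>) * V"
    unfolding V_def
  proof (rule hermitian_form_le[OF N])
    show "?N $$ (i, j) = cnj (?N $$ (j, i))" if "i < n" "j < n" for i j
      using N_ij[OF that] N_ij[OF that(2,1)] herm[OF that] by auto
    show "0 \<le> ?m - ?\<mu>" using b by simp
    fix z assume "eigenvalue ?N z"
    then obtain w where w: "w \<in> carrier_vec n" "w \<noteq> 0\<^sub>v n" "?N *\<^sub>v w = z \<cdot>\<^sub>v w"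
      using N by (auto simp: eigenvalue_def eigenvector_def)
    have "M *\<^sub>v w = (complex_of_real ?m - z) \<cdot>\<^sub>v w"
    proof (rule eq_vecI)
      fix i assume "i < dim_vec ((complex_of_real ?m - z) \<cdot>\<^sub>v w)"
      then have i: "i < n" using w(1) by simp
      have "z * vec_index w i = (\<Sum>j<n. ?N $$ (i, j) * vec_index w j)"
        using arg_cong[OF w(3), of "\<lambda>x. vec_index x i"] i w(1)
        unfolding index_mult_mat_vec_sum[OF N w(1) i] by simp
      also have "\<dots> = (\<Sum>j<n. (if j = i then complex_of_real ?m * vec_index w j else 0) - M $$ (i, j) * vec_index w j)"
        using i by (intro sum.cong refl) (auto simp: N_ij left_diff_distrib)
      also have "\<dots> = complex_of_real ?m * vec_index w i - vec_index (M *\<^sub>v w) i"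
        using i w(1) M(1) by (simp add: sum_subtractf scalar_prod_def atLeast0LessThan)
      finally show "vec_index (M *\<^sub>v w) i = vec_index ((complex_of_real ?m - z) \<cdot>\<^sub>v w) i"
        using i w(1) by (simp add: left_diff_distrib)
    qed (use w(1) M(1) in auto)
    then have e: "eigenvalue M (complex_of_real ?m - z)"
      using w M(1) by (auto simp: eigenvalue_def eigenvector_def)
    have "z = complex_of_real (Re z)"
      using eigenvalue_adjoint_mult_self(1)[OF H, folded M_def, OF e] by (simp add: complex_eq_iff)
    then have "cmod z = \<bar>Re z\<bar>" by (metis norm_of_real)
    then show "cmod z \<le> ?m - ?\<mu>" using b(2)[OF e] by simp
  qed
  moreover have "(\<Sum>i<n. (\<Sum>j<n. ?N $$ (i, j) * v j) * cnj (v i)) = complex_of_real (?m * V - R)"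
  proof -
    have "(\<Sum>j<n. ?N $$ (i, j) * v j) = complex_of_real ?m * v i - (\<Sum>j<n. M $$ (i, j) * v j)" if i: "i < n" for i
    proof -
      have "(\<Sum>j<n. ?N $$ (i, j) * v j) = (\<Sum>j<n. (if j = i then complex_of_real ?m * v j else 0) - M $$ (i, j) * v j)"
        using i by (intro sum.cong refl) (auto simp: N_ij left_diff_distrib)
      then show ?thesis using i by (simp add: sum_subtractf)
    qed
    then have "(\<Sum>i<n. (\<Sum>j<n. ?N $$ (i, j) * v j) * cnj (v i))
        = (\<Sum>i<n. complex_of_real ?m * (v i * cnj (v i)))
          - (\<Sum>i<n. (\<Sum>j<n. M $$ (i, j) * v j) * cnj (v i))"
      by (simp add: left_diff_distrib sum_subtractf mult.assoc)
    also have "\<dots> = complex_of_real (?m * V - R)"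
      unfolding adjoint_form[OF H, folded M_def] R_def V_def
      by (simp only: of_real_diff of_real_mult of_real_sum complex_norm_square sum_distrib_left)
    finally show ?thesis .
  qed
  ultimately have "\<bar>?m * V - R\<bar> \<le> (?m - ?\<mu>) * V" by (simp only: norm_of_real)
  then have lower: "?\<mu> * V \<le> R" by (simp add: left_diff_distrib)
  show "(\<Sum>p<n. (cmod (\<Sum>q<n. H $$ (p, q) * v q))\<^sup>2) \<le> ?m * (\<Sum>q<n. (cmod (v q))\<^sup>2)"
    and "?\<mu> * (\<Sum>q<n. (cmod (v q))\<^sup>2) \<le> (\<Sum>p<n. (cmod (\<Sum>q<n. H $$ (p, q) * v q))\<^sup>2)"
    using upper lower by (simp_all add: R_def V_def)
qed

section \<open>The filter bank\<close>

text \<open>Translates between the flat row index of the block matrix and the pair of block and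
  component. The \<open>+ 1\<close> appears because components are numbered from 1 while rows start
  at 0.\<close>

lemma sum_div_mod:
  fixes g :: "nat \<Rightarrow> nat \<Rightarrow> 'b :: comm_monoid_add"
  assumes "L \<ge> 1"
  shows "(\<Sum>p<a * L. g (p div L) (p mod L + 1)) = (\<Sum>r<a. \<Sum>l\<in>{1..L}. g r l)"
proof -
  have "(\<Sum>(r, l)\<in>{..<a} \<times> {1..L}. g r l) = (\<Sum>p<a * L. g (p div L) (p mod L + 1))"
  proof (rule sum.reindex_bij_witness[where j = "\<lambda>(r, l). r * L + (l - 1)" and i = "\<lambda>p. (p div L, p mod L + 1)"])
    fix rl assume "rl \<in> {..<a} \<times> {1..L}"
    then obtain r l where "rl = (r, l)" "r < a" "l \<noteq> 0" "l \<le> L" by auto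
    then obtain l' where rl: "rl = (r, Suc l')" "r < a" "l' < L"
      using not0_implies_Suc[of l] by auto
    then have "r * L + l' < Suc r * L" by simp
    also have "\<dots> \<le> a * L" using rl by (intro mult_right_mono) auto
    finally show "(case rl of (r, l) \<Rightarrow> r * L + (l - 1)) \<in> {..<a * L}" using rl by simp
    show "((case rl of (r, l) \<Rightarrow> r * L + (l - 1)) div L, (case rl of (r, l) \<Rightarrow> r * L + (l - 1)) mod L + 1) = rl"
      using rl assms by simp
    show "g ((case rl of (r, l) \<Rightarrow> r * L + (l - 1)) div L) ((case rl of (r, l) \<Rightarrow> r * L + (l - 1)) mod L + 1)
        = (case rl of (r, l) \<Rightarrow> g r l)"
      using rl assms by simp
  next
    fix p assume "p \<in> {..<a * L}"
    then show "(p div L, p mod L + 1) \<in> {..<a} \<times> {1..L}"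
      using assms by (auto simp: less_mult_imp_div_less Suc_le_eq)
  qed auto
  then show ?thesis by (simp add: sum.cartesian_product)
qed

lemma has_sum_finite_Times:
  fixes g :: "'r \<Rightarrow> 'k \<Rightarrow> 'b :: {comm_monoid_add, topological_comm_monoid_add}"
  assumes "finite R" "\<And>r. r \<in> R \<Longrightarrow> (g r has_sum T r) J"
  shows "((\<lambda>(r, k). g r k) has_sum (\<Sum>r\<in>R. T r)) (R \<times> J)"
  using assms
proof (induction R rule: finite_induct)
  case (insert r R)
  have "bij_betw (Pair r) J ({r} \<times> J)"
    by (auto simp: bij_betw_def inj_on_def)
  from has_sum_reindex_bij_betw[OF this, of "\<lambda>(r, k). g r k" "T r"]
  have "((\<lambda>(r, k). g r k) has_sum T r) ({r} \<times> J)"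
    using insert.prems[of r] by simp
  moreover have "((\<lambda>(r, k). g r k) has_sum (\<Sum>r\<in>R. T r)) (R \<times> J)"
    using insert by simp
  ultimately have "((\<lambda>(r, k). g r k) has_sum (T r + (\<Sum>r\<in>R. T r))) ({r} \<times> J \<union> R \<times> J)"
    using insert(2) by (intro has_sum_Un_disjoint) auto
  moreover have "{r} \<times> J \<union> R \<times> J = Set.insert r R \<times> J" by auto
  ultimately show ?case using insert by simp
qed simp

lemma dot_transpose: "(Finite_Cartesian_Product.transpose A *v x) \<bullet> y = x \<bullet> (A *v y)"
  for A :: "real^'n^'m"
  by (simp add: transpose_matrix_vector dot_lmul_matrix)

text \<open>The bounds enter as inequalities at every point for two fixed constants; the infimum and
  the supremum are substituted only when the theorem interprets the locale. The coefficients
  \<open>h\<close> are tied to the matrix through the Fourier series in \<open>u\<close>.\<close>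

locale filter_bank =
  fixes A B :: "real^'d^'d" and a L :: nat and K :: "(real^'d) set" and \<beta> :: "nat \<Rightarrow> real^'d"
    and h :: "nat \<Rightarrow> nat \<Rightarrow> nat \<Rightarrow> real^'d \<Rightarrow> complex"
    and u :: "nat \<Rightarrow> nat \<Rightarrow> nat \<Rightarrow> real^'d \<Rightarrow> complex"
    and lam Lam :: real
  assumes A: "dilation_matrix A"
    and B: "B = Finite_Cartesian_Product.transpose A"
    and a: "a = dil_index A"
    and digits: "digit_set B K" "bij_betw \<beta> {..<a} K"
    and L: "L \<ge> 1"
    and u: "\<And>r l j. r < a \<Longrightarrow> l \<in> {1..L} \<Longrightarrow> j \<in> {1..L} \<Longrightarrow>
      fourier_series_rep (\<lambda>k. h r l j k / complex_of_real (sqrt (real a))) (u r l j)"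
    and lam_le: "\<And>\<xi>. lam \<le> min_eigenvalue (filter_block_matrix A L \<beta> u \<xi>)"
    and Lam_ge: "\<And>\<xi>. max_eigenvalue (filter_block_matrix A L \<beta> u \<xi>) \<le> Lam"
begin

section \<open>Digits and their character sums\<close>

lemma card_K: "card K = a" and finite_K: "finite K"
  using digits(2) by (auto simp: bij_betw_same_card[symmetric] bij_betw_finite[symmetric])

lemma digit_ex1: "k \<in> Zd \<Longrightarrow> \<exists>!b. b \<in> K \<and> k - b \<in> (\<lambda>y. B *v y) ` Zd"
  using digits(1) by (simp add: digit_set_def)

lemma a_pos: "a > 0"
proof -
  obtain b where "b \<in> K" using digit_ex1[OF Zd_0] by blast
  then show ?thesis using card_K finite_K by (auto simp: card_gt_0_iff)
qed

lemma det_nonzero: "Determinants.det A \<noteq> 0"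
  using a_pos by (auto simp: a dil_index_def)

lemma A_Zd: "k \<in> Zd \<Longrightarrow> A *v k \<in> Zd"
  using A by (simp add: dilation_matrix_def)

lemma det_a: "\<bar>Determinants.det A\<bar> = real a"
proof -
  have ent: "A $ i $ j \<in> \<int>" for i j
    using A_Zd[OF Zd_axis[of j]] by (simp add: Zd_def matrix_vector_mult_basis column_def)
  have "Determinants.det A \<in> \<int>"
    unfolding Determinants.det_def by (intro Ints_sum Ints_mult Ints_prod ent) auto
  then have "\<bar>Determinants.det A\<bar> \<in> \<int>" by (rule Ints_abs)
  then obtain n where "\<bar>Determinants.det A\<bar> = of_int n" by (rule Ints_cases)
  then show ?thesis by (simp add: a dil_index_def)
qed

abbreviation "Ainv \<equiv> matrix_inv A"
abbreviation "Binv \<equiv> matrix_inv B"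

lemma A_inv: "A *v (Ainv *v x) = x" "Ainv *v (A *v x) = x"
  using matrix_inv_mult[OF det_nonzero] by auto

lemma B_inv: "B *v (Binv *v x) = x" "Binv *v (B *v x) = x"
  using matrix_inv_mult[of B] det_nonzero by (auto simp: B)

lemma Binv_inner: "(Binv *v x) \<bullet> (A *v y) = x \<bullet> y"
  using dot_transpose[of A "Binv *v x" y] by (simp add: B_inv flip: B)

definition shift :: "real^'d \<Rightarrow> real^'d" where
  "shift k = (2 * pi) *\<^sub>R (Binv *v k)"

lemma shift_add: "shift (k + m) = shift k + shift m"
  by (simp add: shift_def matrix_vector_right_distrib scaleR_add_right)

lemma character_shift_A: "k \<in> Zd \<Longrightarrow> m \<in> Zd \<Longrightarrow> character (A *v k) (shift m) = 1"
  by (simp add: shift_def character_eq_1_iff Binv_inner Zd_inner)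

lemma character_shift_B: "n \<in> Zd \<Longrightarrow> m \<in> Zd \<Longrightarrow> character n (shift (B *v m)) = 1"
  by (simp add: shift_def B_inv character_eq_1_iff Zd_inner)

text \<open>Adding a lattice vector permutes the digits modulo \<open>B Zd\<close>, so the sum over the digits is
  multiplied by \<open>character n (shift k)\<close>; if it does not vanish, all these factors are 1.\<close>

lemma sum_character_digits:
  assumes n: "n \<in> Zd"
  shows "(\<Sum>s<a. character n (shift (\<beta> s))) = (if n \<in> (\<lambda>k. A *v k) ` Zd then of_nat a else 0)"
proof -
  define S where "S = (\<Sum>b\<in>K. character n (shift b))"
  have KZ: "b \<in> Zd" if "b \<in> K" for b using digits(1) that by (auto simp: digit_set_def)
  have S: "(\<Sum>s<a. character n (shift (\<beta> s))) = S"
    unfolding S_def by (rule sum.reindex_bij_betw[OF digits(2)])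
  show ?thesis
  proof (cases "n \<in> (\<lambda>k. A *v k) ` Zd")
    case True
    then have "character n (shift b) = 1" if "b \<in> K" for b
      using KZ[OF that] by (auto simp: character_shift_A)
    then have "S = of_nat a" by (simp add: S_def card_K)
    then show ?thesis using S True by simp
  next
    case False
    have fac: "character n (shift k) * S = S" if k: "k \<in> Zd" for k
    proof -
      \<comment> \<open>The digit in the coset of \<open>b + k\<close>; uniqueness of digits makes
        this map injective, hence a permutation of the finite set \<open>K\<close>.\<close>
      define \<pi> where "\<pi> b = (THE b'. b' \<in> K \<and> (b + k) - b' \<in> (\<lambda>y. B *v y) ` Zd)" for b
      have \<pi>: "\<pi> b \<in> K \<and> (b + k) - \<pi> b \<in> (\<lambda>y. B *v y) ` Zd" if "b \<in> K" for b
        unfolding \<pi>_def by (rule theI'[OF digit_ex1[OF Zd_add[OF KZ[OF that] k]]])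
      have inj: "inj_on \<pi> K"
      proof (rule inj_onI)
        fix b b' assume b: "b \<in> K" "b' \<in> K" and eq: "\<pi> b = \<pi> b'"
        obtain y y' where y: "y \<in> Zd" "(b + k) - \<pi> b = B *v y" "y' \<in> Zd" "(b' + k) - \<pi> b' = B *v y'"
          using \<pi>[OF b(1)] \<pi>[OF b(2)] by blast
        have "b - b' = ((b + k) - \<pi> b) - ((b' + k) - \<pi> b')"
          using eq by simp
        also have "\<dots> = B *v (y - y')"
          unfolding y by (simp add: matrix_vector_mult_diff_distrib)
        finally have "b - b' = B *v (y - y')" .
        then have "b - b' \<in> (\<lambda>y. B *v y) ` Zd" using y by blast
        moreover have "b - b \<in> (\<lambda>y. B *v y) ` Zd"
          by (rule image_eqI[of _ _ 0]) auto
        ultimately show "b = b'" using digit_ex1[OF KZ[OF b(1)]] b by blast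
      qed
      have "\<pi> ` K \<subseteq> K" using \<pi> by blast
      then have bij: "bij_betw \<pi> K K"
        using inj finite_K by (simp add: bij_betw_def endo_inj_surj)
      have "character n (shift (b + k)) = character n (shift (\<pi> b))" if b: "b \<in> K" for b
      proof -
        obtain y where y: "y \<in> Zd" "(b + k) - \<pi> b = B *v y" using \<pi>[OF b] by blast
        then have "b + k = \<pi> b + B *v y" by (simp add: algebra_simps)
        then show ?thesis using y n by (simp add: shift_add[of "\<pi> b"] character_shift character_shift_B)
      qed
      then have "(\<Sum>b\<in>K. character n (shift (b + k))) = (\<Sum>b\<in>K. character n (shift (\<pi> b)))"
        by (rule sum.cong[OF refl])
      also have "\<dots> = S" unfolding S_def by (rule sum.reindex_bij_betw[OF bij])
      finally show ?thesis
        by (simp add: S_def shift_add character_shift sum_distrib_left mult.commute)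
    qed
    have "S = 0"
    proof (rule ccontr)
      assume "S \<noteq> 0"
      then have "character n (shift k) = 1" if "k \<in> Zd" for k
        using fac[OF that] by simp
      then have i: "(Binv *v k) \<bullet> n \<in> \<int>" if "k \<in> Zd" for k
        using that by (simp add: shift_def character_eq_1_iff)
      \<comment> \<open>Duality between \<open>A\<close> and its transpose: tested on unit vectors,
        the integrality of these products says that every coordinate of \<open>Ainv *v n\<close> is
        an integer.\<close>
      have "(Binv *v k) \<bullet> n = k \<bullet> (Ainv *v n)" for k
        using Binv_inner[of k "Ainv *v n"] by (simp add: A_inv)
      then have "(Ainv *v n) $ i \<in> \<int>" for i
        using i[OF Zd_axis[of i]] by (simp add: inner_axis')
      then have "Ainv *v n \<in> Zd" by (simp add: Zd_def)
      then have "n \<in> (\<lambda>k. A *v k) ` Zd"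
        by (intro image_eqI[of _ _ "Ainv *v n"]) (simp_all add: A_inv)
      with False show False ..
    qed
    then show ?thesis using S False by simp
  qed
qed

section \<open>Finite sections of the filter bank\<close>

context
  fixes F :: "(nat \<times> (real^'d)) set" and x :: "nat \<times> (real^'d) \<Rightarrow> complex"
  assumes F: "finite F" "F \<subseteq> {1..L} \<times> Zd"
begin

text \<open>\<open>Q r l\<close> has the Fourier coefficients \<open>section_coeff r l n / sqrt a\<close>.  Summing its translates
  in \<open>P r l\<close> annihilates the frequencies outside \<open>A Zd\<close>; at \<open>n = - A k\<close> the coefficient is the
  output of the filter bank at \<open>k\<close>.\<close>

definition X :: "nat \<Rightarrow> real^'d \<Rightarrow> complex" where
  "X j \<xi> = (\<Sum>i\<in>{i \<in> F. fst i = j}. x i * character (- snd i) \<xi>)"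

definition section_coeff :: "nat \<Rightarrow> nat \<Rightarrow> real^'d \<Rightarrow> complex" where
  "section_coeff r l n = (\<Sum>i\<in>F. h r l (fst i) (n + snd i) * x i)"

definition Q :: "nat \<Rightarrow> nat \<Rightarrow> real^'d \<Rightarrow> complex" where
  "Q r l \<xi> = (\<Sum>i\<in>F. x i * character (- snd i) \<xi> * u r l (fst i) \<xi>)"

definition P :: "nat \<Rightarrow> nat \<Rightarrow> real^'d \<Rightarrow> complex" where
  "P r l \<xi> = (\<Sum>s<a. Q r l (\<xi> + shift (\<beta> s)))"

lemma F_D: "i \<in> F \<Longrightarrow> fst i \<in> {1..L}" "i \<in> F \<Longrightarrow> snd i \<in> Zd"
  using F(2) by auto

lemma u_props:
  assumes "r < a" "l \<in> {1..L}" "j \<in> {1..L}"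
  shows "u r l j \<in> borel_measurable lebesgue" "periodic (u r l j)"
    "L2_has_sum torus (\<lambda>k \<xi>. h r l j k / complex_of_real (sqrt (real a)) * character k \<xi>) Zd (u r l j)"
  using u[OF assms] by (auto simp: fourier_series_rep_def periodic_def torus_def character_def)

lemma Q_measurable: "r < a \<Longrightarrow> l \<in> {1..L} \<Longrightarrow> Q r l \<in> borel_measurable lebesgue"
  unfolding Q_def by (intro borel_measurable_sum borel_measurable_times borel_measurable_const
      borel_measurable_character u_props(1) F_D)

lemma Q_periodic: "r < a \<Longrightarrow> l \<in> {1..L} \<Longrightarrow> periodic (Q r l)"
  using u_props(2) periodic_character[OF Zd_minus[OF F_D(2)]] F_D(1)
  unfolding periodic_def Q_def by (intro allI ballI sum.cong refl) simp

text \<open>Multiplying by a character shifts the Fourier coefficients, and the factor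
  \<open>x i * character (- snd i) \<xi>\<close> has constant modulus, so each error norm is only
  scaled. Finitely many such series are added.\<close>

lemma Q_has_sum:
  assumes rl: "r < a" "l \<in> {1..L}"
  shows "L2_has_sum torus (\<lambda>n \<xi>. section_coeff r l n / complex_of_real (sqrt (real a)) * character n \<xi>) Zd (Q r l)"
proof -
  let ?q = "complex_of_real (sqrt (real a))"
  have "L2_has_sum torus (\<lambda>n \<xi>. h r l (fst i) (n + snd i) * x i / ?q * character n \<xi>) Zd
      (\<lambda>\<xi>. x i * character (- snd i) \<xi> * u r l (fst i) \<xi>)" if i: "i \<in> F" for i
  proof -
    note U = u_props[OF rl F_D(1)[OF i]]
    let ?g = "\<lambda>p \<xi>. h r l (fst i) p / ?q * character p \<xi>"
    let ?m = "\<lambda>\<xi>. x i * character (- snd i) \<xi>"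
    have mult: "(\<lambda>\<xi>. ?m \<xi> * f \<xi>) \<in> L2 torus" if "f \<in> L2 torus" for f
    proof -
      have [measurable]: "character (- snd i) \<in> borel_measurable torus" "f \<in> borel_measurable torus"
        using measurable_torus[OF borel_measurable_character] L2_measurable[OF that] by auto
      show ?thesis
        using that by (auto simp: L2_def norm_mult power_mult_distrib)
    qed
    have "L2_has_sum torus (\<lambda>p \<xi>. ?m \<xi> * ?g p \<xi>) Zd (\<lambda>\<xi>. ?m \<xi> * u r l (fst i) \<xi>)"
    proof (rule L2_has_sum_comparison[OF U(3), where C = "cmod (x i)"])
      show "(\<lambda>\<xi>. ?m \<xi> * u r l (fst i) \<xi>) \<in> L2 torus"
        by (rule mult[OF L2_has_sumD(1)[OF U(3)]])
      show "(\<lambda>\<xi>. ?m \<xi> * ?g p \<xi>) \<in> L2 torus" if "p \<in> Zd" for p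
        by (rule mult[OF L2_has_sumD(2)[OF U(3) that]])
      show "L2_norm torus (\<lambda>\<xi>. ?m \<xi> * u r l (fst i) \<xi> - (\<Sum>p\<in>G. ?m \<xi> * ?g p \<xi>))
          \<le> cmod (x i) * L2_norm torus (\<lambda>\<xi>. u r l (fst i) \<xi> - (\<Sum>p\<in>G. ?g p \<xi>))" for G
      proof -
        have "L2_norm torus (\<lambda>\<xi>. ?m \<xi> * u r l (fst i) \<xi> - (\<Sum>p\<in>G. ?m \<xi> * ?g p \<xi>))
            = L2_norm torus (\<lambda>\<xi>. ?m \<xi> * (u r l (fst i) \<xi> - (\<Sum>p\<in>G. ?g p \<xi>)))"
          by (simp add: right_diff_distrib sum_distrib_left)
        also have "\<dots> = L2_norm torus (\<lambda>\<xi>. x i * (u r l (fst i) \<xi> - (\<Sum>p\<in>G. ?g p \<xi>)))"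
          by (simp add: L2_norm_def norm_mult)
        finally show ?thesis by (simp only: L2_norm_cmult order_refl)
      qed
    qed
    moreover have "bij_betw (\<lambda>n. n + snd i) Zd Zd"
      by (rule bij_betw_byWitness[where f' = "\<lambda>n. n - snd i"]) (use F_D(2)[OF i] in auto)
    ultimately have "L2_has_sum torus (\<lambda>n \<xi>. ?m \<xi> * ?g (n + snd i) \<xi>) Zd (\<lambda>\<xi>. ?m \<xi> * u r l (fst i) \<xi>)"
      by (subst L2_has_sum_reindex)
    moreover have "?m \<xi> * ?g (n + snd i) \<xi> = h r l (fst i) (n + snd i) * x i / ?q * character n \<xi>" for n \<xi>
    proof -
      have "character n \<xi> = character (- snd i) \<xi> * character (n + snd i) \<xi>"
        by (simp flip: character_add)
      then show ?thesis by (simp add: mult_ac)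
    qed
    ultimately show ?thesis by (simp only:)
  qed
  then have "L2_has_sum torus (\<lambda>n \<xi>. \<Sum>i\<in>F. h r l (fst i) (n + snd i) * x i / ?q * character n \<xi>) Zd
      (\<lambda>\<xi>. \<Sum>i\<in>F. x i * character (- snd i) \<xi> * u r l (fst i) \<xi>)"
    by (rule L2_has_sum_sum)
  then show ?thesis
    by (simp add: section_coeff_def Q_def[abs_def] sum_distrib_right sum_divide_distrib)
qed

text \<open>Translation by \<open>t\<close> multiplies the coefficient at \<open>n\<close> by
  \<open>character n t\<close>. It keeps the torus norm of every remainder because all remainders
  are periodic, the frequencies being lattice vectors.\<close>

lemma P_has_sum:
  assumes rl: "r < a" "l \<in> {1..L}"
  shows "L2_has_sum torus (\<lambda>n \<xi>. (\<Sum>s<a. character n (shift (\<beta> s))) * (section_coeff r l n / complex_of_real (sqrt (real a))) * character n \<xi>)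
    Zd (P r l)"
proof -
  let ?c = "\<lambda>n. section_coeff r l n / complex_of_real (sqrt (real a))"
  note QS = Q_has_sum[OF rl]
  have "L2_has_sum torus (\<lambda>n \<xi>. ?c n * character n (\<xi> + t)) Zd (\<lambda>\<xi>. Q r l (\<xi> + t))" for t
  proof (rule L2_has_sum_comparison[OF QS, where C = 1])
    show "(\<lambda>\<xi>. Q r l (\<xi> + t)) \<in> L2 torus"
      by (rule L2_torus_translate(2)[OF Q_measurable[OF rl] Q_periodic[OF rl] L2_has_sumD(1)[OF QS]])
    show "(\<lambda>\<xi>. ?c n * character n (\<xi> + t)) \<in> L2 torus" for n
      using L2_cmult[OF character_L2[of n], of "?c n * character n t"]
      by (simp add: character_shift mult_ac)
    show "L2_norm torus (\<lambda>\<xi>. Q r l (\<xi> + t) - (\<Sum>n\<in>G. ?c n * character n (\<xi> + t)))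
        \<le> 1 * L2_norm torus (\<lambda>\<xi>. Q r l \<xi> - (\<Sum>n\<in>G. ?c n * character n \<xi>))" if "finite G" "G \<subseteq> Zd" for G
    proof -
      let ?w = "\<lambda>\<xi>. Q r l \<xi> - (\<Sum>n\<in>G. ?c n * character n \<xi>)"
      have "?w \<in> borel_measurable lebesgue"
        by (intro borel_measurable_diff borel_measurable_sum borel_measurable_times borel_measurable_const
            borel_measurable_character Q_measurable rl)
      moreover have "periodic ?w"
      proof -
        have "character n (\<xi> + (2 * pi) *\<^sub>R k) = character n \<xi>" if "n \<in> G" "k \<in> Zd" for n k \<xi>
          using periodic_character[of n] that \<open>G \<subseteq> Zd\<close> by (auto simp: periodic_def)
        then show ?thesis
          using Q_periodic[OF rl] by (simp add: periodic_def cong: sum.cong)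
      qed
      ultimately show ?thesis using L2_torus_translate(1)[of ?w t] by simp
    qed
  qed
  then have "L2_has_sum torus (\<lambda>n \<xi>. \<Sum>s<a. ?c n * character n (\<xi> + shift (\<beta> s))) Zd (\<lambda>\<xi>. \<Sum>s<a. Q r l (\<xi> + shift (\<beta> s)))"
    by (intro L2_has_sum_sum)
  moreover have "(\<Sum>s<a. ?c n * character n (\<xi> + shift (\<beta> s)))
      = (\<Sum>s<a. character n (shift (\<beta> s))) * ?c n * character n \<xi>" for n \<xi>
    unfolding character_shift sum_distrib_right by (intro sum.cong refl) (simp only: mult_ac)
  ultimately show ?thesis
    by (simp only: P_def[abs_def])
qed

text \<open>On \<open>A Zd\<close> the digit sum is \<open>a\<close>, so the squared coefficient of
  \<open>P\<close> is \<open>a\<close> times that of \<open>section_coeff\<close>; hence the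
  division by \<open>a\<close>. The minus sign matches the offset \<open>m - A *v k\<close> of the
  filters and is harmless because \<open>A Zd\<close> is closed under negation.\<close>

lemma section_coeff_has_sum:
  assumes rl: "r < a" "l \<in> {1..L}"
  shows "((\<lambda>k. (cmod (section_coeff r l (- (A *v k))))\<^sup>2) has_sum
    (L2_norm torus (P r l) / L2_norm (torus :: (real^'d) measure) (\<lambda>_. 1))\<^sup>2 / real a) Zd"
proof -
  let ?V = "(L2_norm torus (P r l) / L2_norm (torus :: (real^'d) measure) (\<lambda>_. 1))\<^sup>2"
  have "((\<lambda>n. (cmod ((\<Sum>s<a. character n (shift (\<beta> s))) * (section_coeff r l n / complex_of_real (sqrt (real a)))))\<^sup>2) has_sum ?V) Zd"
    by (rule Parseval[OF P_has_sum[OF rl]])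
  also have "?this \<longleftrightarrow> ((\<lambda>n. real a * (cmod (section_coeff r l n))\<^sup>2) has_sum ?V) ((\<lambda>k. A *v k) ` Zd)"
  proof (rule has_sum_cong_neutral)
    fix n assume "n \<in> Zd - (\<lambda>k. A *v k) ` Zd"
    then show "(cmod ((\<Sum>s<a. character n (shift (\<beta> s))) * (section_coeff r l n / complex_of_real (sqrt (real a)))))\<^sup>2 = 0"
      by (simp add: sum_character_digits)
  next
    fix n assume "n \<in> Zd \<inter> (\<lambda>k. A *v k) ` Zd"
    then show "(cmod ((\<Sum>s<a. character n (shift (\<beta> s))) * (section_coeff r l n / complex_of_real (sqrt (real a)))))\<^sup>2
        = real a * (cmod (section_coeff r l n))\<^sup>2"
      using a_pos by (simp add: sum_character_digits norm_mult norm_divide power_mult_distrib power_divide)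
        (simp add: power2_eq_square)
  qed (use A_Zd in auto)
  also have "\<dots> \<longleftrightarrow> ((\<lambda>k. real a * (cmod (section_coeff r l (- (A *v k))))\<^sup>2) has_sum ?V) Zd"
  proof -
    have "bij_betw (\<lambda>k. - (A *v k)) Zd ((\<lambda>k. A *v k) ` Zd)"
    proof (rule bij_betw_byWitness[where f' = "\<lambda>n. - (Ainv *v n)"])
      show "(\<lambda>k. - (A *v k)) ` Zd \<subseteq> (\<lambda>k. A *v k) ` Zd"
      proof clarify
        fix k :: "real^'d" assume "k \<in> Zd"
        then show "- (A *v k) \<in> (\<lambda>k. A *v k) ` Zd"
          by (intro image_eqI[of _ _ "- k"]) (auto simp: linear_neg[OF matrix_vector_mul_linear])
      qed
    qed (auto simp: linear_neg[OF matrix_vector_mul_linear] A_inv)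
    from has_sum_reindex_bij_betw[OF this] show ?thesis by (rule sym)
  qed
  finally have "((\<lambda>k. (1 / real a) * (real a * (cmod (section_coeff r l (- (A *v k))))\<^sup>2)) has_sum (1 / real a) * ?V) Zd"
    by (rule has_sum_cmult_right)
  then show ?thesis using a_pos by simp
qed

definition shifted_X :: "real^'d \<Rightarrow> nat \<Rightarrow> complex" where
  "shifted_X \<xi> q = X (q mod L + 1) (\<xi> + shift (\<beta> (q div L)))"

abbreviation "H \<equiv> filter_block_matrix A L \<beta> u"

lemma H_carrier: "H \<xi> \<in> carrier_mat (a * L) (a * L)"
  by (simp add: filter_block_matrix_def a)

text \<open>Grouping the terms of \<open>F\<close> by their first component writes \<open>Q\<close>
  as a row of filters times the vector of the \<open>X j\<close>; the sum over the digits then runs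
  through the block columns.\<close>

lemma P_eq_mult:
  assumes "p < a * L"
  shows "P (p div L) (p mod L + 1) \<xi> = (\<Sum>q<a * L. H \<xi> $$ (p, q) * shifted_X \<xi> q)"
proof -
  let ?r = "p div L" and ?l = "p mod L + 1"
  have "(\<Sum>q<a * L. H \<xi> $$ (p, q) * shifted_X \<xi> q)
      = (\<Sum>q<a * L. u ?r ?l (q mod L + 1) (\<xi> + shift (\<beta> (q div L))) * X (q mod L + 1) (\<xi> + shift (\<beta> (q div L))))"
    using assms by (intro sum.cong refl) (simp add: filter_block_matrix_def shifted_X_def shift_def flip: a B)
  also have "\<dots> = (\<Sum>s<a. \<Sum>j\<in>{1..L}. u ?r ?l j (\<xi> + shift (\<beta> s)) * X j (\<xi> + shift (\<beta> s)))"
    by (rule sum_div_mod[OF L, of "\<lambda>s j. u ?r ?l j (\<xi> + shift (\<beta> s)) * X j (\<xi> + shift (\<beta> s))" a])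
  also have "\<dots> = P ?r ?l \<xi>"
    unfolding P_def
  proof (rule sum.cong[OF refl])
    fix s
    let ?\<eta> = "\<xi> + shift (\<beta> s)"
    have "(\<Sum>j\<in>{1..L}. u ?r ?l j ?\<eta> * X j ?\<eta>)
        = (\<Sum>j\<in>{1..L}. \<Sum>i\<in>{i \<in> F. fst i = j}. x i * character (- snd i) ?\<eta> * u ?r ?l (fst i) ?\<eta>)"
      unfolding X_def sum_distrib_left by (intro sum.cong refl) auto
    also have "\<dots> = Q ?r ?l ?\<eta>"
      unfolding Q_def by (rule sum.group) (use F F_D in auto)
    finally show "(\<Sum>j\<in>{1..L}. u ?r ?l j ?\<eta> * X j ?\<eta>) = Q ?r ?l ?\<eta>" .
  qed
  finally show ?thesis ..
qed

lemma X_L2: "X j \<in> L2 torus"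
  unfolding X_def[abs_def] by (intro L2_sum L2_cmult character_L2)

lemma X_measurable: "X j \<in> borel_measurable lebesgue"
  unfolding X_def[abs_def] by (intro borel_measurable_sum borel_measurable_times borel_measurable_const
      borel_measurable_character)

lemma X_periodic: "periodic (X j)"
  using periodic_character[OF Zd_minus[OF F_D(2)]]
  unfolding periodic_def X_def by (intro allI ballI sum.cong refl) auto

text \<open>Each \<open>X j\<close> occurs once per digit with unchanged norm, which gives the
  factor \<open>a\<close>. In \<open>filter_section\<close> it cancels the denominator of
  \<open>section_coeff_has_sum\<close>, as does the norm of the constant 1, so \<open>lam\<close>
  and \<open>Lam\<close> reach the sequence side unchanged.\<close>

lemma norm_shifted_X:
  "(\<Sum>q<a * L. (L2_norm torus (\<lambda>\<xi>. shifted_X \<xi> q))\<^sup>2)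
    = real a * (L2_norm (torus :: (real^'d) measure) (\<lambda>_. 1))\<^sup>2 * (\<Sum>i\<in>F. (cmod (x i))\<^sup>2)"
proof -
  let ?N = "L2_norm (torus :: (real^'d) measure) (\<lambda>_. 1)"
  have X: "(L2_norm torus (X j))\<^sup>2 = ?N\<^sup>2 * (\<Sum>i\<in>{i \<in> F. fst i = j}. (cmod (x i))\<^sup>2)" for j
    unfolding X_def[abs_def]
    by (rule L2_norm_character_sum) (use F F_D(2) in \<open>auto simp: inj_on_def prod_eq_iff\<close>)
  have "(\<Sum>q<a * L. (L2_norm torus (\<lambda>\<xi>. shifted_X \<xi> q))\<^sup>2) = (\<Sum>q<a * L. (L2_norm torus (X (q mod L + 1)))\<^sup>2)"
    unfolding shifted_X_def by (simp only: L2_torus_translate(1)[OF X_measurable X_periodic])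
  also have "\<dots> = (\<Sum>s<a. \<Sum>j\<in>{1..L}. (L2_norm torus (X j))\<^sup>2)"
    by (rule sum_div_mod[OF L, of "\<lambda>s j. (L2_norm torus (X j))\<^sup>2" a])
  also have "\<dots> = real a * (?N\<^sup>2 * (\<Sum>j\<in>{1..L}. \<Sum>i\<in>{i \<in> F. fst i = j}. (cmod (x i))\<^sup>2))"
    by (simp add: X sum_distrib_left)
  also have "(\<Sum>j\<in>{1..L}. \<Sum>i\<in>{i \<in> F. fst i = j}. (cmod (x i))\<^sup>2) = (\<Sum>i\<in>F. (cmod (x i))\<^sup>2)"
    by (rule sum.group) (use F F_D in auto)
  finally show ?thesis by (simp add: mult.assoc)
qed

text \<open>The Rayleigh bounds are weakened to the constants \<open>lam\<close> and
  \<open>Lam\<close> at each point before integrating, so only sums of squares of square-integrable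
  functions are integrated, never the eigenvalues as functions of \<open>\<xi>\<close>.\<close>

lemma norm_P:
  "lam * (\<Sum>q<a * L. (L2_norm torus (\<lambda>\<xi>. shifted_X \<xi> q))\<^sup>2) \<le> (\<Sum>r<a. \<Sum>l\<in>{1..L}. (L2_norm torus (P r l))\<^sup>2)"
  "(\<Sum>r<a. \<Sum>l\<in>{1..L}. (L2_norm torus (P r l))\<^sup>2) \<le> Lam * (\<Sum>q<a * L. (L2_norm torus (\<lambda>\<xi>. shifted_X \<xi> q))\<^sup>2)"
proof -
  have aL: "a * L > 0" using a_pos L by simp
  have vL: "(\<lambda>\<xi>. shifted_X \<xi> q) \<in> L2 torus" for q
    unfolding shifted_X_def by (rule L2_torus_translate(2)[OF X_measurable X_periodic X_L2])
  have PL: "P (p div L) (p mod L + 1) \<in> L2 torus" if "p < a * L" for p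
    using P_has_sum[of "p div L" "p mod L + 1"] that L
    by (auto simp: L2_has_sum_def less_mult_imp_div_less Suc_le_eq)
  have iv: "integrable torus (\<lambda>\<xi>. \<Sum>q<a * L. (cmod (shifted_X \<xi> q))\<^sup>2)"
    by (intro Bochner_Integration.integrable_sum L2_integrable vL)
  have iP: "integrable torus (\<lambda>\<xi>. \<Sum>p<a * L. (cmod (P (p div L) (p mod L + 1) \<xi>))\<^sup>2)"
    by (intro Bochner_Integration.integrable_sum L2_integrable PL) auto
  have V: "(\<Sum>q<a * L. (L2_norm torus (\<lambda>\<xi>. shifted_X \<xi> q))\<^sup>2) = (\<integral>\<xi>. (\<Sum>q<a * L. (cmod (shifted_X \<xi> q))\<^sup>2) \<partial>torus)"
    unfolding L2_norm_power2 by (rule Bochner_Integration.integral_sum[symmetric]) (intro L2_integrable vL)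
  have "(\<Sum>r<a. \<Sum>l\<in>{1..L}. (L2_norm torus (P r l))\<^sup>2) = (\<Sum>p<a * L. (L2_norm torus (P (p div L) (p mod L + 1)))\<^sup>2)"
    by (rule sum_div_mod[OF L, symmetric])
  also have "\<dots> = (\<integral>\<xi>. (\<Sum>p<a * L. (cmod (P (p div L) (p mod L + 1) \<xi>))\<^sup>2) \<partial>torus)"
    unfolding L2_norm_power2 by (rule Bochner_Integration.integral_sum[symmetric]) (rule L2_integrable[OF PL], simp)
  finally have W: "(\<Sum>r<a. \<Sum>l\<in>{1..L}. (L2_norm torus (P r l))\<^sup>2)
      = (\<integral>\<xi>. (\<Sum>p<a * L. (cmod (P (p div L) (p mod L + 1) \<xi>))\<^sup>2) \<partial>torus)" .
  have Peq: "(\<Sum>p<a * L. (cmod (P (p div L) (p mod L + 1) \<xi>))\<^sup>2) = (\<Sum>p<a * L. (cmod (\<Sum>q<a * L. H \<xi> $$ (p, q) * shifted_X \<xi> q))\<^sup>2)" for \<xi>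
    by (intro sum.cong refl) (simp only: P_eq_mult lessThan_iff)
  have nn: "0 \<le> (\<Sum>q<a * L. (cmod (shifted_X \<xi> q))\<^sup>2)" for \<xi> by (intro sum_nonneg) auto
  have lo: "lam * (\<Sum>q<a * L. (cmod (shifted_X \<xi> q))\<^sup>2) \<le> (\<Sum>p<a * L. (cmod (P (p div L) (p mod L + 1) \<xi>))\<^sup>2)" for \<xi>
    unfolding Peq by (rule order_trans[OF mult_right_mono[OF lam_le nn] min_eigenvalue_bound[OF H_carrier aL]])
  have hi: "(\<Sum>p<a * L. (cmod (P (p div L) (p mod L + 1) \<xi>))\<^sup>2) \<le> Lam * (\<Sum>q<a * L. (cmod (shifted_X \<xi> q))\<^sup>2)" for \<xi>
    unfolding Peq by (rule order_trans[OF max_eigenvalue_bound[OF H_carrier aL] mult_right_mono[OF Lam_ge nn]])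
  show "lam * (\<Sum>q<a * L. (L2_norm torus (\<lambda>\<xi>. shifted_X \<xi> q))\<^sup>2) \<le> (\<Sum>r<a. \<Sum>l\<in>{1..L}. (L2_norm torus (P r l))\<^sup>2)"
    unfolding V W integral_mult_right_zero[symmetric]
    by (rule integral_mono[OF integrable_mult_right[OF iv] iP lo])
  show "(\<Sum>r<a. \<Sum>l\<in>{1..L}. (L2_norm torus (P r l))\<^sup>2) \<le> Lam * (\<Sum>q<a * L. (L2_norm torus (\<lambda>\<xi>. shifted_X \<xi> q))\<^sup>2)"
    unfolding V W integral_mult_right_zero[symmetric]
    by (rule integral_mono[OF iP integrable_mult_right[OF iv] hi])
qed

lemma filter_section:
  obtains T where
    "((\<lambda>(r, l, k). (cmod (\<Sum>i\<in>F. h r l (fst i) (snd i - A *v k) * x i))\<^sup>2) has_sum T) ({..<a} \<times> {1..L} \<times> Zd)"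
    "lam * (\<Sum>i\<in>F. (cmod (x i))\<^sup>2) \<le> T" "T \<le> Lam * (\<Sum>i\<in>F. (cmod (x i))\<^sup>2)"
proof
  let ?N = "L2_norm (torus :: (real^'d) measure) (\<lambda>_. 1)"
  let ?T = "\<Sum>r<a. \<Sum>l\<in>{1..L}. (L2_norm torus (P r l) / ?N)\<^sup>2 / real a"
  have N: "?N\<^sup>2 > 0" using L2_norm_torus_1_pos[where 'd = 'd] by simp
  have T: "?T = (\<Sum>r<a. \<Sum>l\<in>{1..L}. (L2_norm torus (P r l))\<^sup>2) / (real a * ?N\<^sup>2)"
    by (simp add: sum_divide_distrib power_divide mult.commute)
  have pos: "real a * ?N\<^sup>2 > 0" using a_pos N by simp
  show "lam * (\<Sum>i\<in>F. (cmod (x i))\<^sup>2) \<le> ?T"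
    unfolding T pos_le_divide_eq[OF pos] using norm_P(1) unfolding norm_shifted_X by (simp add: mult_ac)
  show "?T \<le> Lam * (\<Sum>i\<in>F. (cmod (x i))\<^sup>2)"
    unfolding T pos_divide_le_eq[OF pos] using norm_P(2) unfolding norm_shifted_X by (simp add: mult_ac)
  have "((\<lambda>(r, l, k). (cmod (section_coeff r l (- (A *v k))))\<^sup>2) has_sum ?T) ({..<a} \<times> {1..L} \<times> Zd)"
    by (intro has_sum_finite_Times) (use section_coeff_has_sum in auto)
  then show "((\<lambda>(r, l, k). (cmod (\<Sum>i\<in>F. h r l (fst i) (snd i - A *v k) * x i))\<^sup>2) has_sum ?T) ({..<a} \<times> {1..L} \<times> Zd)"
    by (simp add: section_coeff_def)
qed

end

end

section \<open>Wavelet frame packets\<close>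

lemma L2_has_sum_inner_left:
  assumes "L2_has_sum M g I f" "w \<in> L2 M"
  shows "((\<lambda>i. L2_inner M (g i) w) has_sum L2_inner M f w) I"
  using L2_has_sum_inner[OF assms] by (subst (1 2) L2_inner_commute) simp

lemma
  fixes k :: "real^'n"
  assumes f: "f \<in> L2 lebesgue"
  shows L2_translate: "(\<lambda>x. f (x - k)) \<in> L2 lebesgue"
    and L2_norm_translate: "L2_norm lebesgue (\<lambda>x. f (x - k)) = L2_norm lebesgue f"
  using L2_affine[of "Finite_Cartesian_Product.mat 1" f "- k"]
    L2_norm_affine[of "Finite_Cartesian_Product.mat 1" f "- k"] f by simp_all

lemma summable_on_slice:
  assumes "(\<lambda>(r, i). g r i) summable_on (R \<times> J)" "r \<in> R"
  shows "(g r :: _ \<Rightarrow> real) summable_on J"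
proof -
  have "(\<lambda>(r, i). g r i) summable_on ({r} \<times> J)"
    by (rule summable_on_subset_banach[OF assms(1)]) (use assms(2) in auto)
  moreover have "bij_betw (Pair r) J ({r} \<times> J)"
    by (auto simp: bij_betw_def inj_on_def)
  ultimately show ?thesis
    using summable_on_reindex_bij_betw[of "Pair r" J "{r} \<times> J" "\<lambda>(r, i). g r i"] by simp
qed

context filter_bank
begin

lemma Lam_nonneg: "0 \<le> Lam"
proof -
  have "filter_block_matrix A L \<beta> u 0 \<in> carrier_mat (a * L) (a * L)" "a * L > 0"
    using a_pos L by (simp_all add: filter_block_matrix_def flip: a)
  then show ?thesis
    using min_eigenvalue_nonneg min_le_max_eigenvalue Lam_ge[of 0] by (meson order_trans)
qed

text \<open>Rows are output channels with their position \<open>k\<close>, columns are input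
  components with their position \<open>m\<close>; the offset \<open>m - A *v k\<close> is filtering
  followed by downsampling along \<open>A Zd\<close>.\<close>

lemma filter_l2_bounds:
  "l2_bounds ({..<a} \<times> {1..L} \<times> Zd) ({1..L} \<times> Zd)
    (\<lambda>(r, l, k) (j, m). h r l j (m - A *v k)) lam Lam"
  unfolding l2_bounds_def
proof (intro conjI allI impI)
  show "0 \<le> Lam" by (rule Lam_nonneg)
  fix F :: "(nat \<times> (real^'d)) set" and x :: "nat \<times> (real^'d) \<Rightarrow> complex"
  assume F: "finite F" "F \<subseteq> {1..L} \<times> Zd"
  obtain T where T:
    "((\<lambda>(r, l, k). (cmod (\<Sum>i\<in>F. h r l (fst i) (snd i - A *v k) * x i))\<^sup>2) has_sum T) ({..<a} \<times> {1..L} \<times> Zd)"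
    "lam * (\<Sum>i\<in>F. (cmod (x i))\<^sup>2) \<le> T" "T \<le> Lam * (\<Sum>i\<in>F. (cmod (x i))\<^sup>2)"
    by (rule filter_section[OF F])
  have "(\<lambda>i. (cmod (\<Sum>j\<in>F. (case i of (r, l, k) \<Rightarrow> \<lambda>(j, m). h r l j (m - A *v k)) j * x j))\<^sup>2)
      = (\<lambda>(r, l, k). (cmod (\<Sum>i\<in>F. h r l (fst i) (snd i - A *v k) * x i))\<^sup>2)"
    by (auto simp: fun_eq_iff case_prod_unfold)
  then have s: "((\<lambda>i. (cmod (\<Sum>j\<in>F. (case i of (r, l, k) \<Rightarrow> \<lambda>(j, m). h r l j (m - A *v k)) j * x j))\<^sup>2)
      has_sum T) ({..<a} \<times> {1..L} \<times> Zd)"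
    using T(1) by simp
  show "(\<lambda>i. (cmod (\<Sum>j\<in>F. (case i of (r, l, k) \<Rightarrow> \<lambda>(j, m). h r l j (m - A *v k)) j * x j))\<^sup>2)
      summable_on ({..<a} \<times> {1..L} \<times> Zd)"
    using s by (rule has_sum_imp_summable)
  show "lam * (\<Sum>j\<in>F. (cmod (x j))\<^sup>2) \<le> (\<Sum>\<^sub>\<infinity>i\<in>{..<a} \<times> {1..L} \<times> Zd.
      (cmod (\<Sum>j\<in>F. (case i of (r, l, k) \<Rightarrow> \<lambda>(j, m). h r l j (m - A *v k)) j * x j))\<^sup>2)"
    "(\<Sum>\<^sub>\<infinity>i\<in>{..<a} \<times> {1..L} \<times> Zd.
      (cmod (\<Sum>j\<in>F. (case i of (r, l, k) \<Rightarrow> \<lambda>(j, m). h r l j (m - A *v k)) j * x j))\<^sup>2)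
      \<le> Lam * (\<Sum>j\<in>F. (cmod (x j))\<^sup>2)"
    using T(2,3) unfolding infsumI[OF s] by auto
qed

section \<open>Unitary dilation and the two-scale relation\<close>

abbreviation root_a :: complex where
  "root_a \<equiv> complex_of_real (sqrt (real a))"

definition dilate :: "(real^'d \<Rightarrow> complex) \<Rightarrow> real^'d \<Rightarrow> complex" where
  "dilate w x = root_a * w (A *v x)"

definition undilate :: "(real^'d \<Rightarrow> complex) \<Rightarrow> real^'d \<Rightarrow> complex" where
  "undilate w x = w (Ainv *v x) / root_a"

lemma root_a_nonzero: "root_a \<noteq> 0"
  using a_pos by simp

lemma dilate_undilate [simp]: "dilate (undilate w) = w" "undilate (dilate w) = w"
  using root_a_nonzero by (auto simp: fun_eq_iff dilate_def undilate_def A_inv)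

lemma dilate_L2: "w \<in> L2 lebesgue \<Longrightarrow> dilate w \<in> L2 lebesgue"
  using L2_affine[OF det_nonzero, of w 0] unfolding dilate_def[abs_def] by (simp add: L2_cmult)

lemma undilate_L2:
  assumes "w \<in> L2 lebesgue"
  shows "undilate w \<in> L2 lebesgue"
proof -
  have "Determinants.det Ainv \<noteq> 0" using det_matrix_inv[OF det_nonzero] by auto
  from L2_cmult[OF L2_affine[OF this assms, of 0], of "1 / root_a"] show ?thesis
    by (simp add: undilate_def[abs_def])
qed

lemma dilate_inner:
  assumes "v \<in> L2 lebesgue" "w \<in> L2 lebesgue"
  shows "L2_inner lebesgue (dilate v) (dilate w) = L2_inner lebesgue v w"
proof -
  have "root_a * root_a = of_nat a"
    by (simp flip: of_real_mult)
  then show ?thesis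
    using L2_inner_affine[OF det_nonzero assms, of 0] a_pos
    unfolding dilate_def[abs_def] by (simp add: L2_inner_cmult_left L2_inner_cmult_right det_a flip: mult.assoc)
qed

lemma dilate_norm:
  assumes "v \<in> L2 lebesgue"
  shows "L2_norm lebesgue (dilate v) = L2_norm lebesgue v"
  using L2_norm_affine[OF det_nonzero assms, of 0] a_pos
  unfolding dilate_def[abs_def] by (simp add: L2_norm_cmult det_a)

lemma undilate_norm:
  assumes "v \<in> L2 lebesgue"
  shows "L2_norm lebesgue (undilate v) = L2_norm lebesgue v"
  using dilate_norm[OF undilate_L2[OF assms]] by simp

definition dilate_shift :: "(nat \<Rightarrow> real^'d \<Rightarrow> complex) \<Rightarrow> nat \<times> (real^'d) \<Rightarrow> real^'d \<Rightarrow> complex" where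
  "dilate_shift \<psi> i = dilate (\<lambda>x. \<psi> (fst i) (x - snd i))"

text \<open>The adjoint of the unitary dilation is its inverse, so the dilation can be moved from
  the generators to the test function.\<close>

lemma dilate_shift_inner:
  assumes "\<psi> (fst i) \<in> L2 lebesgue" "w \<in> L2 lebesgue"
  shows "L2_inner lebesgue (dilate_shift \<psi> i) w = L2_inner lebesgue (\<lambda>x. \<psi> (fst i) (x - snd i)) (undilate w)"
  using dilate_inner[OF L2_translate[OF assms(1)] undilate_L2[OF assms(2)]] by (simp add: dilate_shift_def)

text \<open>Translating by \<open>k\<close> before dilating equals translating by
  \<open>A *v k\<close> afterwards. After reindexing, all translates are expanded in the same
  functions \<open>dilate_shift \<psi> i\<close> and only the filter is displaced.\<close>

lemma filtered_translate:
  assumes f: "filtered A L c \<psi> g" and k: "k \<in> Zd"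
    and \<psi>: "\<And>j. j \<in> {1..L} \<Longrightarrow> \<psi> j \<in> L2 lebesgue"
  shows "L2_has_sum lebesgue (\<lambda>i x. c (fst i) (snd i - A *v k) * dilate_shift \<psi> i x) ({1..L} \<times> Zd) (\<lambda>x. g (x - k))"
proof -
  let ?I = "{1..L} \<times> (Zd :: (real^'d) set)"
  let ?G = "\<lambda>i x. c (fst i) (snd i) * dilate_shift \<psi> i x"
  have EL: "dilate_shift \<psi> i \<in> L2 lebesgue" if "i \<in> ?I" for i
    unfolding dilate_shift_def using \<psi> that by (intro dilate_L2 L2_translate) auto
  have s: "L2_has_sum lebesgue ?G ?I g"
    using f by (simp add: filtered_def dilate_shift_def dilate_def case_prod_unfold mult.assoc flip: a)
  have "L2_has_sum lebesgue (\<lambda>i x. ?G i (x - k)) ?I (\<lambda>x. g (x - k))"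
  proof (rule L2_has_sum_comparison[OF s, where C = 1])
    show "(\<lambda>x. g (x - k)) \<in> L2 lebesgue"
      by (rule L2_translate[OF L2_has_sumD(1)[OF s]])
    show "(\<lambda>x. ?G i (x - k)) \<in> L2 lebesgue" if "i \<in> ?I" for i
      by (rule L2_translate[OF L2_has_sumD(2)[OF s that]])
    fix F assume "finite F" "F \<subseteq> ?I"
    then have "(\<lambda>x. g x - (\<Sum>i\<in>F. ?G i x)) \<in> L2 lebesgue"
      using L2_has_sumD(1,2)[OF s] by (intro L2_diff L2_sum) auto
    from L2_norm_translate[OF this, of k]
    show "L2_norm lebesgue (\<lambda>x. g (x - k) - (\<Sum>i\<in>F. ?G i (x - k)))
        \<le> 1 * L2_norm lebesgue (\<lambda>x. g x - (\<Sum>i\<in>F. ?G i x))" by simp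
  qed
  moreover have "bij_betw (\<lambda>i. (fst i, snd i - A *v k)) ?I ?I"
    by (rule bij_betw_byWitness[where f' = "\<lambda>i. (fst i, snd i + A *v k)"]) (use A_Zd[OF k] in auto)
  ultimately have "L2_has_sum lebesgue (\<lambda>i x. ?G (fst i, snd i - A *v k) (x - k)) ?I (\<lambda>x. g (x - k))"
    by (subst L2_has_sum_reindex)
  moreover have "dilate_shift \<psi> (fst i, snd i - A *v k) (x - k) = dilate_shift \<psi> i x" for i x
    by (simp add: dilate_shift_def dilate_def matrix_vector_mult_diff_distrib)
  ultimately show ?thesis by simp
qed

lemma filtered_inner:
  assumes f: "filtered A L c \<psi> g" and k: "k \<in> Zd"
    and \<psi>: "\<And>j. j \<in> {1..L} \<Longrightarrow> \<psi> j \<in> L2 lebesgue" and w: "w \<in> L2 lebesgue"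
  shows "((\<lambda>i. c (fst i) (snd i - A *v k) * L2_inner lebesgue (dilate_shift \<psi> i) w) has_sum
    L2_inner lebesgue (\<lambda>x. g (x - k)) w) ({1..L} \<times> Zd)"
  using L2_has_sum_inner_left[OF filtered_translate[OF f k \<psi>] w] by (simp add: L2_inner_cmult_left)

text \<open>The test function stands in the second slot, so the filters enter linearly and without
  conjugation; compared with the frame coefficients this conjugates every term, which the moduli do
  not see.\<close>

lemma
  assumes \<psi>: "\<And>j. j \<in> {1..L} \<Longrightarrow> \<psi> j \<in> L2 lebesgue"
    and G: "\<And>r l. r < a \<Longrightarrow> l \<in> {1..L} \<Longrightarrow> filtered A L (h r l) \<psi> (G r l)"
    and w: "w \<in> L2 lebesgue"
    and s: "(\<lambda>i. (cmod (L2_inner lebesgue (dilate_shift \<psi> i) w))\<^sup>2) summable_on ({1..L} \<times> Zd)"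
  shows filter_coeffs_summable: "(\<lambda>(r, l, k). (cmod (L2_inner lebesgue (\<lambda>x. G r l (x - k)) w))\<^sup>2)
      summable_on ({..<a} \<times> {1..L} \<times> Zd)" (is ?S)
    and filter_coeffs_upper: "(\<Sum>\<^sub>\<infinity>(r, l, k)\<in>{..<a} \<times> {1..L} \<times> Zd. (cmod (L2_inner lebesgue (\<lambda>x. G r l (x - k)) w))\<^sup>2)
      \<le> Lam * (\<Sum>\<^sub>\<infinity>i\<in>{1..L} \<times> Zd. (cmod (L2_inner lebesgue (dilate_shift \<psi> i) w))\<^sup>2)" (is ?U)
    and filter_coeffs_lower: "lam * (\<Sum>\<^sub>\<infinity>i\<in>{1..L} \<times> Zd. (cmod (L2_inner lebesgue (dilate_shift \<psi> i) w))\<^sup>2)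
      \<le> (\<Sum>\<^sub>\<infinity>(r, l, k)\<in>{..<a} \<times> {1..L} \<times> Zd. (cmod (L2_inner lebesgue (\<lambda>x. G r l (x - k)) w))\<^sup>2)" (is ?D)
proof -
  let ?y = "\<lambda>(r, l, k). L2_inner lebesgue (\<lambda>x. G r l (x - k)) w"
  have y: "((\<lambda>j. (case i of (r, l, k) \<Rightarrow> \<lambda>(j, m). h r l j (m - A *v k)) j * L2_inner lebesgue (dilate_shift \<psi> j) w) has_sum ?y i)
      ({1..L} \<times> Zd)" if i: "i \<in> {..<a} \<times> {1..L} \<times> Zd" for i
  proof -
    obtain r l k where i': "i = (r, l, k)" by (cases i) auto
    then show ?thesis
      using filtered_inner[OF G[of r l] _ \<psi> w, of k] i by (simp add: case_prod_unfold)
  qed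
  have sq: "(\<lambda>i. (cmod (?y i))\<^sup>2) = (\<lambda>(r, l, k). (cmod (L2_inner lebesgue (\<lambda>x. G r l (x - k)) w))\<^sup>2)"
    by (auto simp: fun_eq_iff)
  show ?S using l2_bounds_upper(1)[OF filter_l2_bounds s y] unfolding sq .
  show ?U using l2_bounds_upper(2)[OF filter_l2_bounds s y] unfolding sq .
  show ?D using l2_bounds_lower[OF filter_l2_bounds s y] unfolding sq .
qed

text \<open>A two-scale identity with respect to both \<open>\<phi>\<close> and \<open>f0\<close> forces \<open>\<phi> = f0\<close>, because the lower
  bound of the filter bank makes it injective on square-summable sequences.\<close>

lemma filter_bank_unique:
  assumes lam: "lam > 0"
    and \<phi>: "\<And>j. j \<in> {1..L} \<Longrightarrow> \<phi> j \<in> L2 lebesgue"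
    and bessel: "\<And>w. w \<in> L2 lebesgue \<Longrightarrow>
      (\<lambda>i. (cmod (L2_inner lebesgue w (\<lambda>x. \<phi> (fst i) (x - snd i))))\<^sup>2) summable_on ({1..L} \<times> Zd)"
    and f\<phi>: "\<And>r l. r < a \<Longrightarrow> l \<in> {1..L} \<Longrightarrow> filtered A L (h r l) \<phi> (f r l)"
    and ff: "\<And>r l. r < a \<Longrightarrow> l \<in> {1..L} \<Longrightarrow> filtered A L (h r l) (f 0) (f r l)"
    and j: "j \<in> {1..L}"
  shows "L2_norm lebesgue (\<lambda>x. \<phi> j x - f 0 j x) = 0"
proof -
  have f0: "f 0 j \<in> L2 lebesgue" if "j \<in> {1..L}" for j
    using f\<phi>[OF a_pos that] by (simp add: filtered_def L2_has_sum_def)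
  have sum\<phi>: "(\<lambda>i. (cmod (L2_inner lebesgue (dilate_shift \<phi> i) w))\<^sup>2) summable_on ({1..L} \<times> Zd)" if w: "w \<in> L2 lebesgue" for w
  proof -
    have "cmod (L2_inner lebesgue (dilate_shift \<phi> i) w) = cmod (L2_inner lebesgue (undilate w) (\<lambda>x. \<phi> (fst i) (x - snd i)))"
      if "i \<in> {1..L} \<times> Zd" for i
      using that \<phi> w by (subst dilate_shift_inner) (auto simp: L2_inner_commute[of _ "undilate w"])
    then show ?thesis
      by (intro summable_on_cong[THEN iffD2, OF _ bessel[OF undilate_L2[OF w]]]) (simp only:)
  qed
  \<comment> \<open>\<open>f 0\<close> is itself an output of the filter bank applied to
    \<open>\<phi>\<close>: its coefficients form the slice \<open>r = 0\<close> of a square-summable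
    family.\<close>
  have sumf: "(\<lambda>i. (cmod (L2_inner lebesgue (dilate_shift (f 0) i) w))\<^sup>2) summable_on ({1..L} \<times> Zd)" if w: "w \<in> L2 lebesgue" for w
  proof -
    have "(\<lambda>(r, i). (case i of (l, k) \<Rightarrow> (cmod (L2_inner lebesgue (\<lambda>x. f r l (x - k)) (undilate w)))\<^sup>2))
        summable_on ({..<a} \<times> {1..L} \<times> Zd)"
      using filter_coeffs_summable[OF \<phi> f\<phi> undilate_L2[OF w] sum\<phi>[OF undilate_L2[OF w]]]
      by (simp add: case_prod_unfold)
    then have "(\<lambda>i. case i of (l, k) \<Rightarrow> (cmod (L2_inner lebesgue (\<lambda>x. f 0 l (x - k)) (undilate w)))\<^sup>2)
        summable_on ({1..L} \<times> Zd)"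
      by (rule summable_on_slice) (use a_pos in simp)
    then show ?thesis
      by (rule summable_on_cong[THEN iffD1, rotated]) (use f0 w in \<open>auto simp: dilate_shift_inner\<close>)
  qed
  have eq: "L2_inner lebesgue (\<phi> j) v = L2_inner lebesgue (f 0 j) v" if v: "v \<in> L2 lebesgue" for v
  proof -
    \<comment> \<open>Dilating the test function undoes the dilation inside
      \<open>dilate_shift\<close>, so the entry at \<open>(j, 0)\<close> is the inner product with
      \<open>v\<close> itself.\<close>
    define w where "w = dilate v"
    have w: "w \<in> L2 lebesgue" unfolding w_def by (rule dilate_L2[OF v])
    let ?d = "\<lambda>i. L2_inner lebesgue (dilate_shift \<phi> i) w - L2_inner lebesgue (dilate_shift (f 0) i) w"
    have "(\<lambda>i. 2 * (cmod (L2_inner lebesgue (dilate_shift \<phi> i) w))\<^sup>2 + 2 * (cmod (L2_inner lebesgue (dilate_shift (f 0) i) w))\<^sup>2)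
        summable_on ({1..L} \<times> Zd)"
      by (intro summable_on_add summable_on_cmult_right sum\<phi> sumf w)
    then have sd: "(\<lambda>i. (cmod (?d i))\<^sup>2) summable_on ({1..L} \<times> Zd)"
    proof (rule summable_on_comparison_test)
      show "(cmod (?d i))\<^sup>2 \<le> 2 * (cmod (L2_inner lebesgue (dilate_shift \<phi> i) w))\<^sup>2 + 2 * (cmod (L2_inner lebesgue (dilate_shift (f 0) i) w))\<^sup>2" for i
        using cmod_power2_add_le[of 1 "L2_inner lebesgue (dilate_shift \<phi> i) w" "- L2_inner lebesgue (dilate_shift (f 0) i) w"] by simp
    qed auto
    have "((\<lambda>j. (case i of (r, l, k) \<Rightarrow> \<lambda>(j, m). h r l j (m - A *v k)) j * ?d j) has_sum 0) ({1..L} \<times> Zd)"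
      if i: "i \<in> {..<a} \<times> {1..L} \<times> Zd" for i
    proof -
      obtain r l k where i': "i = (r, l, k)" by (cases i) auto
      then have rlk: "r < a" "l \<in> {1..L}" "k \<in> Zd" using i by auto
      have "((\<lambda>j. h r l (fst j) (snd j - A *v k) * L2_inner lebesgue (dilate_shift \<phi> j) w
          + - (h r l (fst j) (snd j - A *v k) * L2_inner lebesgue (dilate_shift (f 0) j) w)) has_sum
          (L2_inner lebesgue (\<lambda>x. f r l (x - k)) w + - L2_inner lebesgue (\<lambda>x. f r l (x - k)) w)) ({1..L} \<times> Zd)"
        by (intro has_sum_add has_sum_uminusI filtered_inner f\<phi> ff \<phi> f0 w rlk)
      then show ?thesis by (simp add: i' case_prod_unfold right_diff_distrib)
    qed
    from l2_bounds_lower[OF filter_l2_bounds sd this]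
    have "lam * (\<Sum>\<^sub>\<infinity>i\<in>{1..L} \<times> Zd. (cmod (?d i))\<^sup>2) \<le> 0" by simp
    then have "(\<Sum>\<^sub>\<infinity>i\<in>{1..L} \<times> Zd. (cmod (?d i))\<^sup>2) \<le> 0"
      using lam by (simp add: mult_le_0_iff)
    moreover have "(\<Sum>i\<in>{(j, 0)}. (cmod (?d i))\<^sup>2) \<le> (\<Sum>\<^sub>\<infinity>i\<in>{1..L} \<times> Zd. (cmod (?d i))\<^sup>2)"
      using j by (intro finite_sum_le_infsum sd) auto
    ultimately have "(\<Sum>i\<in>{(j, 0)}. (cmod (?d i))\<^sup>2) \<le> 0" by (rule order_trans[rotated])
    then have "?d (j, 0) = 0" by simp
    then show ?thesis
      using dilate_shift_inner[of \<phi> "(j, 0)" w] dilate_shift_inner[of "f 0" "(j, 0)" w] \<phi>[OF j] f0[OF j] w by (simp add: w_def)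
  qed
  have \<psi>: "(\<lambda>x. \<phi> j x - f 0 j x) \<in> L2 lebesgue"
    using \<phi>[OF j] f0[OF j] by auto
  \<comment> \<open>The difference has equal inner products with both functions, so it is orthogonal
    to itself.\<close>
  have "complex_of_real ((L2_norm lebesgue (\<lambda>x. \<phi> j x - f 0 j x))\<^sup>2) = 0"
    unfolding L2_inner_self[symmetric]
    using eq[OF \<psi>] L2_inner_diff_left[OF \<phi>[OF j] f0[OF j] \<psi>] by simp
  then show ?thesis by simp
qed

section \<open>Passing from one scale to the next\<close>

lemma L2_closed_subspace_undilate:
  assumes V: "L2_closed_subspace lebesgue V"
  shows "L2_closed_subspace lebesgue {w. (\<lambda>x. w (Ainv *v x)) \<in> V}"
proof -
  note D = L2_closed_subspaceD[OF V]
  \<comment> \<open>A subspace does not notice the factor \<open>root_a\<close>. The new space is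
    thus the preimage of \<open>V\<close> under the linear isometry \<open>undilate\<close>, and
    closedness is inherited.\<close>
  have iff: "(\<lambda>x. w (Ainv *v x)) \<in> V \<longleftrightarrow> undilate w \<in> V" for w
  proof
    show "undilate w \<in> V" if "(\<lambda>x. w (Ainv *v x)) \<in> V"
      using D(4)[OF that, of "1 / root_a"] by (simp add: undilate_def[abs_def])
    show "(\<lambda>x. w (Ainv *v x)) \<in> V" if "undilate w \<in> V"
      using D(4)[OF that, of root_a] root_a_nonzero by (simp add: undilate_def[abs_def])
  qed
  show ?thesis
    unfolding L2_closed_subspace_def iff mem_Collect_eq
  proof (intro conjI ballI allI impI)
    show "{w. undilate w \<in> V} \<subseteq> L2 lebesgue"
      using D(1) dilate_L2[of "undilate w" for w] by auto
    show "undilate (\<lambda>x. 0) \<in> V" using D(2) by (simp add: undilate_def[abs_def])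
    fix f assume "f \<in> {w. undilate w \<in> V}"
    then have f: "undilate f \<in> V" by simp
    show "undilate (\<lambda>x. c * f x) \<in> V" for c
      using D(4)[OF f, of c] by (simp add: undilate_def[abs_def])
    show "undilate (\<lambda>x. f x + g x) \<in> V" if "g \<in> {w. undilate w \<in> V}" for g
      using D(3)[OF f, of "undilate g"] that by (simp add: undilate_def[abs_def] add_divide_distrib)
  next
    fix f assume f: "f \<in> L2 lebesgue"
      and lim: "\<forall>\<epsilon>>0. \<exists>g\<in>{w. undilate w \<in> V}. L2_norm lebesgue (\<lambda>x. f x - g x) < \<epsilon>"
    show "undilate f \<in> V"
    proof (rule D(5)[OF undilate_L2[OF f]])
      fix \<epsilon> :: real assume "\<epsilon> > 0"
      then obtain g where g: "undilate g \<in> V" "L2_norm lebesgue (\<lambda>x. f x - g x) < \<epsilon>"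
        using lim by blast
      have "g \<in> L2 lebesgue"
        using dilate_L2[OF D(1)[OF g(1)]] by simp
      then have "L2_norm lebesgue (\<lambda>x. undilate f x - undilate g x) < \<epsilon>"
        using undilate_norm[OF L2_diff[OF f]] g(2) by (simp add: undilate_def[abs_def] diff_divide_distrib)
      then show "\<exists>g\<in>V. L2_norm lebesgue (\<lambda>x. undilate f x - g x) < \<epsilon>"
        using g(1) by blast
    qed
  qed
qed

text \<open>The index \<open>s + a * n\<close> enumerates each pair of an old index and a channel
  once. The filter bank inequality for each fixed \<open>n\<close>, summed over \<open>n\<close>, is
  combined with the frame inequality of \<open>V\<close> for the undilated function. With
  \<open>N \<ge> 1\<close> the set \<open>{0..N - 1}\<close> has exactly \<open>N\<close> elements
  despite truncated subtraction.\<close>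

lemma frame_step:
  assumes V: "L2_closed_subspace lebesgue V" and N: "N \<ge> 1" and lam: "0 < lam" "lam \<le> Lam"
    and fr: "is_frame lebesgue V ({0..N - 1} \<times> {1..L} \<times> Zd) (\<lambda>(n, l, k) x. f n l (x - k)) C1 C2"
    and f: "\<And>s n l. s < a \<Longrightarrow> l \<in> {1..L} \<Longrightarrow> filtered A L (h s l) (f n) (f (s + a * n) l)"
  shows "is_frame lebesgue {w. (\<lambda>x. w (Ainv *v x)) \<in> V} ({0..a * N - 1} \<times> {1..L} \<times> Zd)
    (\<lambda>(n, l, k) x. f n l (x - k)) (lam * C1) (Lam * C2)"
proof -
  note D = L2_closed_subspaceD[OF V]
  let ?V = "{w. (\<lambda>x. w (Ainv *v x)) \<in> V}"
  have V': "L2_closed_subspace lebesgue ?V" by (rule L2_closed_subspace_undilate[OF V])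
  have C: "0 < C1" "C1 \<le> C2" using fr by (auto simp: is_frame_def)
  have bij: "bij_betw (\<lambda>(n, s, l, k). (s + a * n, l, k)) ({0..N - 1} \<times> {..<a} \<times> {1..L} \<times> Zd)
      ({0..a * N - 1} \<times> {1..L} \<times> (Zd :: (real^'d) set))"
  proof (rule bij_betw_byWitness[where f' = "\<lambda>(n, l, k). (n div a, n mod a, l, k)"])
    have "s + a * n \<le> a * N - 1" if "n \<le> N - 1" "s < a" for n s
    proof -
      have "s + a * n < a * Suc n" using that by simp
      also have "\<dots> \<le> a * N" using that N by (intro mult_le_mono2) simp
      finally show ?thesis by simp
    qed
    then show "(\<lambda>(n, s, l, k). (s + a * n, l, k)) ` ({0..N - 1} \<times> {..<a} \<times> {1..L} \<times> Zd)
        \<subseteq> {0..a * N - 1} \<times> {1..L} \<times> (Zd :: (real^'d) set)"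
      by auto
    have "n div a \<le> N - 1" if "n \<le> a * N - 1" for n
    proof -
      have "0 < a * N" using a_pos N by simp
      then have "n < N * a" using that by (simp only: mult.commute[of N])
      then have "n div a < N" by (rule less_mult_imp_div_less)
      then show ?thesis by simp
    qed
    then show "(\<lambda>(n, l, k). (n div a, n mod a, l, k)) ` ({0..a * N - 1} \<times> {1..L} \<times> (Zd :: (real^'d) set))
        \<subseteq> {0..N - 1} \<times> {..<a} \<times> {1..L} \<times> Zd"
      using a_pos by auto
  qed (use a_pos in auto)
  have fV: "(\<lambda>x. f n l (x - k)) \<in> V" if "n \<le> N - 1" "l \<in> {1..L}" "k \<in> Zd" for n l k
    using fr that by (auto simp: is_frame_def)
  have fL: "f n l \<in> L2 lebesgue" if "n \<le> N - 1" "l \<in> {1..L}" for n l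
    using D(1)[OF fV[OF that Zd_0]] by simp
  show ?thesis
    unfolding is_frame_def
  proof (intro conjI ballI)
    show "countable ({0..a * N - 1} \<times> {1..L} \<times> (Zd :: (real^'d) set))"
      by (intro countable_SIGMA countable_Zd) auto
    show "0 < lam * C1" using lam C by simp
    show "lam * C1 \<le> Lam * C2" using lam C by (intro mult_mono) auto
    fix i assume "i \<in> {0..a * N - 1} \<times> {1..L} \<times> (Zd :: (real^'d) set)"
    then have "i \<in> (\<lambda>(n, s, l, k). (s + a * n, l, k)) ` ({0..N - 1} \<times> {..<a} \<times> {1..L} \<times> Zd)"
      using bij_betw_imp_surj_on[OF bij] by simp
    then obtain n s l k where i: "i = (s + a * n, l, k)" "n \<le> N - 1" "s < a" "l \<in> {1..L}" "k \<in> Zd"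
      by (elim imageE SigmaE) simp
    have "(\<lambda>x. f (s + a * n) l (x - k)) \<in> ?V"
    \<comment> \<open>The function is a limit of combinations of the
      \<open>dilate_shift (f n) jm\<close>; undoing the dilation in one term leaves a multiple of a
      translate of \<open>f n\<close>, which belongs to \<open>V\<close>.\<close>
    proof (rule L2_closed_subspace_has_sum[OF V' filtered_translate[OF f[OF i(3,4)] i(5) fL[OF i(2)]]])
      fix jm assume jm: "jm \<in> {1..L} \<times> (Zd :: (real^'d) set)"
      have "(\<lambda>x. (h s l (fst jm) (snd jm - A *v k) * root_a) * f n (fst jm) (x - snd jm)) \<in> V"
        using jm i(2) by (intro D(4) fV) auto
      then show "(\<lambda>x. h s l (fst jm) (snd jm - A *v k) * dilate_shift (f n) jm x) \<in> ?V"
        by (simp add: dilate_shift_def dilate_def A_inv mult.assoc)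
    qed
    then show "(case i of (n, l, k) \<Rightarrow> \<lambda>x. f n l (x - k)) \<in> ?V"
      by (simp add: i(1))
  next
    fix w assume w: "w \<in> ?V"
    \<comment> \<open>Against the dilated generators \<open>w\<close> has the same coefficients, up
      to conjugation, as this element of \<open>V\<close> has against the generators themselves, and
      the norms agree.\<close>
    define w' where "w' = undilate w"
    have wL: "w \<in> L2 lebesgue" using w L2_closed_subspaceD(1)[OF V'] by blast
    have w'V: "w' \<in> V"
      using D(4)[of "\<lambda>x. w (Ainv *v x)" "1 / root_a"] w by (simp add: w'_def undilate_def[abs_def])
    have nw: "L2_norm lebesgue w' = L2_norm lebesgue w"
      unfolding w'_def by (rule undilate_norm[OF wL])
    let ?c = "\<lambda>n i. (cmod (L2_inner lebesgue (dilate_shift (f n) i) w))\<^sup>2"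
    let ?b = "\<lambda>n l k. (cmod (L2_inner lebesgue (\<lambda>x. f n l (x - k)) w))\<^sup>2"
    have cw: "?c n i = (cmod (L2_inner lebesgue w' (\<lambda>x. f n (fst i) (x - snd i))))\<^sup>2"
      if "n \<le> N - 1" "i \<in> {1..L} \<times> Zd" for n i
      unfolding w'_def using that fL wL
      by (subst dilate_shift_inner) (auto simp: L2_inner_commute[of _ "\<lambda>x. f n (fst i) (x - snd i)" "undilate w"])
    define c where "c = (\<Sum>\<^sub>\<infinity>(n, i)\<in>{0..N - 1} \<times> {1..L} \<times> Zd. ?c n i)"
    have eqc: "(\<lambda>(n, i). ?c n i) i = (cmod (L2_inner lebesgue w' ((\<lambda>(n, l, k) x. f n l (x - k)) i)))\<^sup>2"
      if "i \<in> {0..N - 1} \<times> {1..L} \<times> Zd" for i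
      using that cw by auto
    have cs: "(\<lambda>(n, i). ?c n i) summable_on ({0..N - 1} \<times> {1..L} \<times> Zd)"
      and c_bounds: "C1 * (L2_norm lebesgue w)\<^sup>2 \<le> c" "c \<le> C2 * (L2_norm lebesgue w)\<^sup>2"
      using fr w'V unfolding is_frame_def nw[symmetric] c_def
      by (simp_all only: eqc cong: summable_on_cong infsum_cong)
    have csn: "?c n summable_on ({1..L} \<times> Zd)" if "n \<in> {0..N - 1}" for n
      by (rule summable_on_slice[OF cs that])
    define cn where "cn n = (\<Sum>\<^sub>\<infinity>i\<in>{1..L} \<times> Zd. ?c n i)" for n
    have "((\<lambda>(n, i). ?c n i) has_sum (\<Sum>n\<in>{0..N - 1}. cn n)) ({0..N - 1} \<times> {1..L} \<times> Zd)"
      unfolding cn_def using csn by (intro has_sum_finite_Times has_sum_infsum) auto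
    then have c: "c = (\<Sum>n\<in>{0..N - 1}. cn n)"
      unfolding c_def by (rule infsumI)
    define bn where "bn n = (\<Sum>\<^sub>\<infinity>(s, l, k)\<in>{..<a} \<times> {1..L} \<times> Zd. ?b (s + a * n) l k)" for n
    have bs: "(\<lambda>(s, l, k). ?b (s + a * n) l k) summable_on ({..<a} \<times> {1..L} \<times> Zd)"
      and b_bounds: "lam * cn n \<le> bn n" "bn n \<le> Lam * cn n" if n: "n \<in> {0..N - 1}" for n
    proof -
      have "f n j \<in> L2 lebesgue" if "j \<in> {1..L}" for j using fL that n by simp
      note fc = this f wL csn[OF n]
      show "(\<lambda>(s, l, k). ?b (s + a * n) l k) summable_on ({..<a} \<times> {1..L} \<times> Zd)"
        by (rule filter_coeffs_summable[where G = "\<lambda>s. f (s + a * n)", OF fc])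
      show "lam * cn n \<le> bn n"
        unfolding bn_def cn_def by (rule filter_coeffs_lower[where G = "\<lambda>s. f (s + a * n)", OF fc])
      show "bn n \<le> Lam * cn n"
        unfolding bn_def cn_def by (rule filter_coeffs_upper[where G = "\<lambda>s. f (s + a * n)", OF fc])
    qed
    have "((\<lambda>(n, i). case i of (s, l, k) \<Rightarrow> ?b (s + a * n) l k) has_sum (\<Sum>n\<in>{0..N - 1}. bn n))
        ({0..N - 1} \<times> {..<a} \<times> {1..L} \<times> Zd)"
      unfolding bn_def using bs by (intro has_sum_finite_Times has_sum_infsum) auto
    then have "((\<lambda>(n, l, k). ?b n l k) has_sum (\<Sum>n\<in>{0..N - 1}. bn n)) ({0..a * N - 1} \<times> {1..L} \<times> Zd)"
      unfolding has_sum_reindex_bij_betw[OF bij, symmetric] by (simp add: case_prod_unfold)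
    moreover have "(\<lambda>(n, l, k). ?b n l k)
        = (\<lambda>i. (cmod (L2_inner lebesgue w ((\<lambda>(n, l, k) x. f n l (x - k)) i)))\<^sup>2)"
      by (auto simp: fun_eq_iff L2_inner_commute[of _ w])
    ultimately have hs: "((\<lambda>i. (cmod (L2_inner lebesgue w ((\<lambda>(n, l, k) x. f n l (x - k)) i)))\<^sup>2) has_sum (\<Sum>n\<in>{0..N - 1}. bn n))
        ({0..a * N - 1} \<times> {1..L} \<times> Zd)" by simp
    then show "(\<lambda>i. (cmod (L2_inner lebesgue w ((\<lambda>(n, l, k) x. f n l (x - k)) i)))\<^sup>2)
        summable_on ({0..a * N - 1} \<times> {1..L} \<times> Zd)"
      by (rule has_sum_imp_summable)
    have "lam * C1 * (L2_norm lebesgue w)\<^sup>2 \<le> lam * c"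
      using c_bounds(1) lam by simp
    also have "\<dots> \<le> (\<Sum>n\<in>{0..N - 1}. bn n)"
      unfolding c sum_distrib_left by (intro sum_mono b_bounds)
    finally show "lam * C1 * (L2_norm lebesgue w)\<^sup>2 \<le> (\<Sum>\<^sub>\<infinity>i\<in>{0..a * N - 1} \<times> {1..L} \<times> Zd.
        (cmod (L2_inner lebesgue w ((\<lambda>(n, l, k) x. f n l (x - k)) i)))\<^sup>2)"
      unfolding infsumI[OF hs] .
    have "(\<Sum>n\<in>{0..N - 1}. bn n) \<le> Lam * c"
      unfolding c sum_distrib_left by (intro sum_mono b_bounds)
    also have "\<dots> \<le> Lam * C2 * (L2_norm lebesgue w)\<^sup>2"
      using c_bounds(2) Lam_nonneg by (simp add: mult.assoc mult_left_mono)
    finally show "(\<Sum>\<^sub>\<infinity>i\<in>{0..a * N - 1} \<times> {1..L} \<times> Zd.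
        (cmod (L2_inner lebesgue w ((\<lambda>(n, l, k) x. f n l (x - k)) i)))\<^sup>2) \<le> Lam * C2 * (L2_norm lebesgue w)\<^sup>2"
      unfolding infsumI[OF hs] .
  qed
qed

end

section \<open>Induction over the scales\<close>

lemma dilated_space_0: "dilated_space A 0 V = V"
  by (simp add: dilated_space_def)

lemma dilated_space_Suc:
  "dilated_space A (Suc j) V = {w. (\<lambda>x. w (matrix_inv A *v x)) \<in> dilated_space A j V}"
  by (simp add: dilated_space_def)

theorem theorem6p1:
  fixes A B :: "real^'d^'d"
    and a L :: nat
    and K :: "(real^'d) set"
    and \<beta> :: "nat \<Rightarrow> real^'d"
    and \<phi> :: "nat \<Rightarrow> real^'d \<Rightarrow> complex"
    and h :: "nat \<Rightarrow> nat \<Rightarrow> nat \<Rightarrow> real^'d \<Rightarrow> complex"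
    and u :: "nat \<Rightarrow> nat \<Rightarrow> nat \<Rightarrow> real^'d \<Rightarrow> complex"
    and H :: "real^'d \<Rightarrow> complex mat"
    and f :: "nat \<Rightarrow> nat \<Rightarrow> real^'d \<Rightarrow> complex"
    and V0 :: "(real^'d \<Rightarrow> complex) set"
    and C1 C2 lam Lam :: real
  assumes A: "dilation_matrix A"
    and B: "B = Finite_Cartesian_Product.transpose A"
    and a: "a = dil_index A"
    and digits: "digit_set B K" "bij_betw \<beta> {..<a} K"
    and L: "L \<ge> 1"
    and phi: "\<forall>l\<in>{1..L}. \<phi> l \<in> L2 lebesgue"
    and V0: "V0 = closed_span lebesgue ({1..L} \<times> Zd) (\<lambda>(l, k) x. \<phi> l (x - k))"
    and frame: "is_frame lebesgue V0 ({1..L} \<times> Zd) (\<lambda>(l, k) x. \<phi> l (x - k)) C1 C2"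
    and h: "\<forall>r<a. \<forall>l\<in>{1..L}. \<forall>j\<in>{1..L}. (\<lambda>k. (cmod (h r l j k))\<^sup>2) summable_on Zd"
    and u: "\<forall>r<a. \<forall>l\<in>{1..L}. \<forall>j\<in>{1..L}.
              fourier_series_rep (\<lambda>k. h r l j k / complex_of_real (sqrt (real a))) (u r l j)"
    and bounded_measurable: "\<forall>r<a. \<forall>s<a. \<forall>l\<in>{1..L}. \<forall>j\<in>{1..L}.
              (\<lambda>\<xi>. u r l j (\<xi> + (2 * pi) *\<^sub>R (matrix_inv B *v \<beta> s))) \<in> borel_measurable lebesgue \<and>
              bounded (range (\<lambda>\<xi>. u r l j (\<xi> + (2 * pi) *\<^sub>R (matrix_inv B *v \<beta> s))))"
    and H: "H = filter_block_matrix A L \<beta> u"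
    and lam: "lam = (INF \<xi>. min_eigenvalue (H \<xi>))"
    and Lam: "Lam = (SUP \<xi>. max_eigenvalue (H \<xi>))"
    and bounds: "0 < lam" "lam \<le> Lam" "bdd_above (range (\<lambda>\<xi>. max_eigenvalue (H \<xi>)))"
    and packets: "wavelet_frame_packets A L h \<phi> f"
  shows "\<forall>j. is_frame lebesgue (dilated_space A j V0) ({0..a ^ j - 1} \<times> {1..L} \<times> Zd)
               (\<lambda>(n, l, k) x. f n l (x - k)) (lam ^ j * C1) (Lam ^ j * C2)"
proof
  have a_pos: "0 < a"
  proof -
    obtain b where "b \<in> K" using digits(1) Zd_0 unfolding digit_set_def by blast
    with digits(2) show ?thesis by (auto simp: bij_betw_def)
  qed
  have HC: "H \<xi> \<in> carrier_mat (a * L) (a * L)" for \<xi>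
    by (simp add: H a filter_block_matrix_def)
  have aL: "a * L > 0" using a_pos L by simp
  interpret filter_bank A B a L K \<beta> h u lam Lam
  proof
    \<comment> \<open>An infimum of reals is a lower bound only for a set bounded below; here 0 is
      such a bound because the eigenvalues in question are nonnegative.\<close>
    show "lam \<le> min_eigenvalue (filter_block_matrix A L \<beta> u \<xi>)" for \<xi>
      unfolding lam H[symmetric]
      by (rule cINF_lower) (auto intro!: bdd_belowI[of _ 0] min_eigenvalue_nonneg[OF HC aL])
    show "max_eigenvalue (filter_block_matrix A L \<beta> u \<xi>) \<le> Lam" for \<xi>
      unfolding Lam H[symmetric] by (rule cSUP_upper[OF UNIV_I bounds(3)])
  qed (use A B a digits L u in auto)
  have phiL: "\<phi> l \<in> L2 lebesgue" if "l \<in> {1..L}" for l using phi that by blast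
  have V0c: "L2_closed_subspace lebesgue V0"
    unfolding V0 by (rule L2_closed_subspace_closed_span) (use phiL in \<open>auto intro: L2_translate\<close>)
  have p1: "filtered A L (h r l) \<phi> (f r l)" if "r < a" "l \<in> {1..L}" for r l
    using packets that unfolding wavelet_frame_packets_def a[symmetric] by blast
  have p2: "filtered A L (h s l) (f r) (f (s + a * r) l)" if "s < a" "l \<in> {1..L}" for s r l
    using packets that unfolding wavelet_frame_packets_def a[symmetric] by blast
  have fL: "f 0 l \<in> L2 lebesgue" if "l \<in> {1..L}" for l
    using p1[OF a_pos that] by (simp add: filtered_def L2_has_sum_def)
  \<comment> \<open>For \<open>s < a\<close> both clauses for packets describe \<open>f s\<close>,
    one with input \<open>\<phi>\<close>, the other with input \<open>f 0\<close>; these are the two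
    identities needed.\<close>
  have zero: "L2_norm lebesgue (\<lambda>x. \<phi> l x - f 0 l x) = 0" if "l \<in> {1..L}" for l
  proof (rule filter_bank_unique[OF bounds(1) phiL _ p1 _ that])
    show "(\<lambda>i. (cmod (L2_inner lebesgue w (\<lambda>x. \<phi> (fst i) (x - snd i))))\<^sup>2) summable_on ({1..L} \<times> Zd)"
      if "w \<in> L2 lebesgue" for w
      using is_frame_Bessel[OF V0c frame that] by (simp add: case_prod_unfold)
    show "filtered A L (h r l) (f 0) (f r l)" if "r < a" "l \<in> {1..L}" for r l
      using p2[OF that, of 0] by simp
  qed
  have zero': "L2_norm lebesgue (\<lambda>x. f 0 l (x - k) - \<phi> l (x - k)) = 0" if "l \<in> {1..L}" for l k
    using L2_norm_translate[OF L2_diff[OF phiL fL], of l l k] zero that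
    by (simp add: L2_norm_minus_commute[of _ "\<lambda>x. f 0 l (x - k)"])
  \<comment> \<open>The frame predicate speaks of functions, so replacing \<open>\<phi>\<close> by
    \<open>f 0\<close> has to be justified: the coefficients agree because the norm of the
    difference vanishes, and the translates of \<open>f 0\<close> lie in \<open>V0\<close> because
    it is closed.\<close>
  have base: "is_frame lebesgue V0 ({0..a ^ 0 - 1} \<times> {1..L} \<times> Zd) (\<lambda>(n, l, k) x. f n l (x - k)) C1 C2"
  proof -
    have bij: "bij_betw (Pair 0) ({1..L} \<times> (Zd :: (real^'d) set)) ({0..a ^ 0 - 1} \<times> {1..L} \<times> Zd)"
      by (auto simp: bij_betw_def inj_on_def)
    have eq: "L2_inner lebesgue w ((\<lambda>(n, l, k) x. f n l (x - k)) (0, i)) = L2_inner lebesgue w ((\<lambda>(l, k) x. \<phi> l (x - k)) i)"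
      if "w \<in> V0" "i \<in> {1..L} \<times> Zd" for w i
      using that zero' phiL fL L2_closed_subspaceD(1)[OF V0c]
      by (auto intro!: L2_inner_eq_if_norm_0 L2_translate)
    show ?thesis
      unfolding is_frame_def
    proof (intro conjI ballI)
      show "countable ({0..a ^ 0 - 1} \<times> {1..L} \<times> (Zd :: (real^'d) set))"
        by (intro countable_SIGMA countable_Zd) auto
      show "0 < C1" "C1 \<le> C2" using frame by (auto simp: is_frame_def)
      fix i assume "i \<in> {0..a ^ 0 - 1} \<times> {1..L} \<times> (Zd :: (real^'d) set)"
      then obtain l k where i: "i = (0, l, k)" "l \<in> {1..L}" "k \<in> Zd" by auto
      have "(\<lambda>x. f 0 l (x - k)) \<in> V0"
      proof (rule L2_closed_subspaceD(5)[OF V0c L2_translate[OF fL[OF i(2)]]])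
        fix \<epsilon> :: real assume "\<epsilon> > 0"
        then show "\<exists>g\<in>V0. L2_norm lebesgue (\<lambda>x. f 0 l (x - k) - g x) < \<epsilon>"
          using zero'[OF i(2), of k] frame i by (intro bexI[of _ "\<lambda>x. \<phi> l (x - k)"]) (auto simp: is_frame_def)
      qed
      then show "(case i of (n, l, k) \<Rightarrow> \<lambda>x. f n l (x - k)) \<in> V0" by (simp add: i)
    next
      fix w assume w: "w \<in> V0"
      let ?g = "\<lambda>i. (cmod (L2_inner lebesgue w ((\<lambda>(n, l, k) x. f n l (x - k)) i)))\<^sup>2"
      let ?p = "\<lambda>i. (cmod (L2_inner lebesgue w ((\<lambda>(l, k) x. \<phi> l (x - k)) i)))\<^sup>2"
      have "?g summable_on ({0..a ^ 0 - 1} \<times> {1..L} \<times> Zd) \<longleftrightarrow> ?p summable_on ({1..L} \<times> Zd)"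
        unfolding summable_on_reindex_bij_betw[OF bij, symmetric]
        by (rule summable_on_cong) (simp only: eq[OF w])
      moreover have "infsum ?g ({0..a ^ 0 - 1} \<times> {1..L} \<times> Zd) = infsum ?p ({1..L} \<times> Zd)"
        unfolding infsum_reindex_bij_betw[OF bij, symmetric]
        by (rule infsum_cong) (simp only: eq[OF w])
      ultimately show "?g summable_on ({0..a ^ 0 - 1} \<times> {1..L} \<times> Zd)"
        "C1 * (L2_norm lebesgue w)\<^sup>2 \<le> infsum ?g ({0..a ^ 0 - 1} \<times> {1..L} \<times> Zd)"
        "infsum ?g ({0..a ^ 0 - 1} \<times> {1..L} \<times> Zd) \<le> C2 * (L2_norm lebesgue w)\<^sup>2"
        using frame w by (auto simp: is_frame_def)
    qed
  qed
  fix j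
  \<comment> \<open>Closedness is carried along in the induction, since the generators of the next
    level are norm limits.\<close>
  have "L2_closed_subspace lebesgue (dilated_space A j V0) \<and>
    is_frame lebesgue (dilated_space A j V0) ({0..a ^ j - 1} \<times> {1..L} \<times> Zd)
      (\<lambda>(n, l, k) x. f n l (x - k)) (lam ^ j * C1) (Lam ^ j * C2)"
  proof (induction j)
    case 0
    then show ?case using base V0c by (simp add: dilated_space_0)
  next
    case (Suc j)
    have "a ^ j \<ge> 1" using a_pos by simp
    from frame_step[OF conjunct1[OF Suc] this bounds(1,2) conjunct2[OF Suc] p2]
      L2_closed_subspace_undilate[OF conjunct1[OF Suc]]
    show ?case by (simp add: dilated_space_Suc mult.assoc)
  qed
  then show "is_frame lebesgue (dilated_space A j V0) ({0..a ^ j - 1} \<times> {1..L} \<times> Zd)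
      (\<lambda>(n, l, k) x. f n l (x - k)) (lam ^ j * C1) (Lam ^ j * C2)" ..
qed

end
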